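(* Let $\mathbb{F}$ be a field of odd characteristic $p$, let $n,s$ be positive integers, and set $q=p^n$. Assume that there are $\sigma,\pi\in\mathbb{F}$ with $(\pi^p-\pi)\sigma^p=1$. Then the elements \[ e_{j,k,a}=(1+\sigma x^{(p^{s})})^{-j\pi+a}\,x^{(k+1)}y^{(j+1)}, \] for $-1\le j<q-1$, $-1\le k<p^{s}-1$ and $a\in\mathbb{F}_p$, form a graded basis of the Albert-Zassenhaus algebra $H(2;(s+1,n);\Phi(1))$ over the integers modulo $(q-1)p^{s+1}$, where $e_{j,k,a}$ has degree $(1-q)(ap^{s}+k)-j \pmod{(q-1)p^{s+1}}$. Let $L$ be the loop algebra of $H(2;(s+1,n);\Phi(1))$ with respect to this grading. Then $L$ is thin, with second diamond in degree $q$. The diamonds of $L$ occur in each degree of the form $t(q-1)+1$ (with $t\ge 0$ an integer), with the diamond type (of the diamonds past the first) being finite exactly when $t\equiv 1 \pmod{p^{s}}$, and infinite otherwise. Those finite types, in order of increasing degree, follow an arithmetic progression, not entirely contained in the prime field $\mathbb{F}_p$. The diamond in degree $(q-1)(p^s+1)+1$ has type $\nu=-1+1/\pi$.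
   Context: **Divided powers.** $\mathcal{O}(2;(n_1,n_2))$ is the associative commutative $\mathbb{F}$-algebra with basis the monomials $x^{(i)}y^{(j)}$, $0\le i<p^{n_1}$, $0\le j<p^{n_2}$, and multiplication $x^{(i)}y^{(j)}\cdot x^{(k)}y^{(l)}=\binom{i+k}{i}\binom{j+l}{j}x^{(i+k)}y^{(j+l)}$. Divided powers with a negative exponent, or with exponent at least $p^{n_1}$ for $x$ (respectively at least $p^{n_2}$ for $y$), are read as $0$. Here $x^{(0)}=y^{(0)}=1$, and $\bar x=x^{(p^{n_1}-1)}$. **The Albert-Zassenhaus algebra.** $H(2;(n_1,n_2);\Phi(1))$ is the vector space $\mathcal{O}(2;(n_1,n_2))$ with the Lie bracket determined bilinearly by \[ \{x^{(i)}y^{(j)},x^{(k)}y^{(l)}\}=x^{(i)}y^{(j-1)}x^{(k-1)}y^{(l)}-x^{(i-1)}y^{(j)}x^{(k)}y^{(l-1)}\quad\text{if } i+k>0, \] \[ \{y^{(j)},y^{(l)}\}=\bar x\,\bigl(y^{(j-1)}y^{(l)}-y^{(j)}y^{(l-1)}\bigr). \] It is a Lie algebra of dimension $p^{n_1+n_2}$. In the theorem $n_1=s+1$, $n_2=n$. **Generalized powers.** For $\alpha,c\in\mathbb{F}$, $(1+c\,x^{(p^s)})^{\alpha}:=\sum_{i=0}^{p-1}\binom{\alpha}{i}\,i!\,c^i\,x^{(ip^s)}\in\mathcal{O}(2;(s+1,n))$, where $\binom{\alpha}{i}=\alpha(\alpha-1)\cdots(\alpha-i+1)/i!$. The product with $x^{(k+1)}y^{(j+1)}$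 is taken in $\mathcal{O}(2;(s+1,n))$. In the degree formula, $a\in\mathbb{F}_p$ is represented by any integer (so $ap^s$ is well defined modulo $p^{s+1}$). "Graded basis over $\mathbb{Z}/N\mathbb{Z}$" means: a basis such that the spans of the basis elements of each given degree form a $\mathbb{Z}/N\mathbb{Z}$-grading of the Lie algebra. **Loop algebra.** If $S=\bigoplus_{k\in\mathbb{Z}/N\mathbb{Z}}S_k$ is a finite-dimensional graded Lie algebra over $\mathbb{F}$ and $T$ is an indeterminate, the loop algebra of $S$ with respect to this grading is the Lie subalgebra of $S\otimes\mathbb{F}[T]$ generated by $S_{\bar 1}\otimes T$. It is graded over the positive integers by the power of $T$. **Thin Lie algebras and diamonds.** A thin Lie algebra is an infinite-dimensional graded Lie algebra $L=\bigoplus_{k\ge1}L_k$ over $\mathbb{F}$ with $\dim L_1=2$, satisfying the covering property $L_{i+1}=[u,L_1]$ for all $0\ne u\in L_i$ and all $i\ge1$, and having at least one two-dimensional component besides $L_1$. The homogeneous components of a thin Lie algebra have dimension one or two; those of dimension two are called diamonds, and they are numbered in order of increasing degree, $L_1$ being the first. **Diamond types.** Iterated brackets are left-normed: $[a,b,c]=[[a,b],c]$. Let $L$ be thin with second diamond $L_q$. Fix generators $X,Y$ of $L$ spanning $L_1$ as follows: $Y\neq0$ with $[L_2,Y]=0$, and $X\in L_1\setminus\langle Y\rangle$ such that $[V,X,X]=0=[V,Y,Y]$ and $[V,Y,X]=-2[V,X,Y]$ for $0\neq V\in L_{q-1}$. If $q>3$ such $X,Y$ are unique up to scalar multiples; if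 $q=3$ one only asks that generators $X,Y$ spanning $L_1$ be chosen so that these last relations hold (without $[L_2,Y]=0$), and types refer to such a choice. Let $L_i$ be a diamond with $i>1$ and let $V$ be a nonzero element of the one-dimensional component $L_{i-1}$. The diamond $L_i$ has finite type $\mu\in\mathbb{F}$ if \[ [V,Y,Y]=0=[V,X,X],\qquad (1-\mu)[V,X,Y]=\mu[V,Y,X], \] and has infinite type ($\infty$) if $[V,Y,Y]=0=[V,X,X]$ and $-[V,X,Y]=[V,Y,X]$. The first diamond $L_1$ is not assigned a type. *)

theory Defs
  imports
    "HOL-Library.Function_Algebras"
    "HOL-Computational_Algebra.Computational_Algebra"
    "HOL-Number_Theory.Cong"
begin

section \<open>Graded and thin Lie algebras\<close>

locale lie_algebra = vector_space scale
  for scale :: "'a::field \<Rightarrow> 'v::ab_group_add \<Rightarrow> 'v" +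
  fixes A :: "'v set" and br :: "'v \<Rightarrow> 'v \<Rightarrow> 'v"
  assumes subspace_carrier: "subspace A"
    and br_closed: "\<lbrakk>x \<in> A; y \<in> A\<rbrakk> \<Longrightarrow> br x y \<in> A"
    and br_add_left: "\<lbrakk>x \<in> A; y \<in> A; z \<in> A\<rbrakk> \<Longrightarrow> br (x + y) z = br x z + br y z"
    and br_add_right: "\<lbrakk>x \<in> A; y \<in> A; z \<in> A\<rbrakk> \<Longrightarrow> br x (y + z) = br x y + br x z"
    and br_scale_left: "\<lbrakk>x \<in> A; y \<in> A\<rbrakk> \<Longrightarrow> br (scale c x) y = scale c (br x y)"
    and br_scale_right: "\<lbrakk>x \<in> A; y \<in> A\<rbrakk> \<Longrightarrow> br x (scale c y) = scale c (br x y)"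
    and br_alternating: "x \<in> A \<Longrightarrow> br x x = 0"
    and jacobi: "\<lbrakk>x \<in> A; y \<in> A; z \<in> A\<rbrakk> \<Longrightarrow>
      br (br x y) z + br (br y z) x + br (br z x) y = 0"

text \<open>The degrees form a set \<open>I\<close> with an addition \<open>plus\<close>. For \<open>\<int>/N\<int>\<close> we take the
  residues \<open>{0..<N}\<close> with addition modulo \<open>N\<close>.\<close>

locale lie_grading = lie_algebra scale A br
  for scale :: "'a::field \<Rightarrow> 'v::ab_group_add \<Rightarrow> 'v" and A br +
  fixes I :: "'i set" and plus :: "'i \<Rightarrow> 'i \<Rightarrow> 'i" and C :: "'i \<Rightarrow> 'v set"
  assumes subspace_component: "i \<in> I \<Longrightarrow> subspace (C i)"
    and span_components: "span (\<Union>i\<in>I. C i) = A"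
    and independent_components:
      "\<lbrakk>finite K; K \<subseteq> I; \<And>i. i \<in> K \<Longrightarrow> v i \<in> C i; (\<Sum>i\<in>K. v i) = 0; k \<in> K\<rbrakk> \<Longrightarrow> v k = 0"
    and br_component: "\<lbrakk>i \<in> I; j \<in> I; x \<in> C i; y \<in> C j\<rbrakk> \<Longrightarrow> br x y \<in> C (plus i j)"

locale thin_lie_algebra =
  lie_grading scale A br "{1..}" "(+)" C
  for scale :: "'a::field \<Rightarrow> 'v::ab_group_add \<Rightarrow> 'v" and A br and C :: "nat \<Rightarrow> 'v set" +
  assumes infinite_dimensional: "\<nexists>B. finite B \<and> span B = A"
    and dim_first: "dim (C 1) = 2"
    and covering: "\<lbrakk>i \<ge> 1; u \<in> C i; u \<noteq> 0\<rbrakk> \<Longrightarrow> C (i + 1) = br u ` C 1"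
    and another_diamond: "\<exists>i>1. dim (C i) = 2"

definition degree_component ::
  "('a::field \<Rightarrow> 'v::ab_group_add \<Rightarrow> 'v) \<Rightarrow> int \<Rightarrow> 'i set \<Rightarrow> ('i \<Rightarrow> 'v) \<Rightarrow> ('i \<Rightarrow> int) \<Rightarrow>
    int \<Rightarrow> 'v set" where
  "degree_component scale N I e deg d = module.span scale (e ` {i \<in> I. [deg i = d] (mod N)})"

definition graded_basis ::
  "('a::field \<Rightarrow> 'v::ab_group_add \<Rightarrow> 'v) \<Rightarrow> 'v set \<Rightarrow> ('v \<Rightarrow> 'v \<Rightarrow> 'v) \<Rightarrow>
    int \<Rightarrow> 'i set \<Rightarrow> ('i \<Rightarrow> 'v) \<Rightarrow> ('i \<Rightarrow> int) \<Rightarrow> bool" where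
  "graded_basis scale A br N I e deg \<longleftrightarrow>
     inj_on e I \<and> \<not> module.dependent scale (e ` I) \<and> module.span scale (e ` I) = A \<and>
     lie_grading scale A br {0..<N} (\<lambda>i j. (i + j) mod N) (degree_component scale N I e deg)"


section \<open>Diamonds and their types\<close>

definition is_diamond ::
  "('a::field \<Rightarrow> 'v::ab_group_add \<Rightarrow> 'v) \<Rightarrow> (nat \<Rightarrow> 'v set) \<Rightarrow> nat \<Rightarrow> bool" where
  "is_diamond scale C i \<longleftrightarrow> i \<ge> 1 \<and> vector_space.dim scale (C i) = 2"

definition second_diamond ::
  "('a::field \<Rightarrow> 'v::ab_group_add \<Rightarrow> 'v) \<Rightarrow> (nat \<Rightarrow> 'v set) \<Rightarrow> nat" where
  "second_diamond scale C = (LEAST i. i > 1 \<and> is_diamond scale C i)"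

definition diamond_generators ::
  "('a::field \<Rightarrow> 'v::ab_group_add \<Rightarrow> 'v) \<Rightarrow> ('v \<Rightarrow> 'v \<Rightarrow> 'v) \<Rightarrow> (nat \<Rightarrow> 'v set) \<Rightarrow>
    'v \<Rightarrow> 'v \<Rightarrow> bool" where
  "diamond_generators scale br C X Y \<longleftrightarrow>
     Y \<in> C 1 \<and> Y \<noteq> 0 \<and> X \<in> C 1 \<and> X \<notin> module.span scale {Y} \<and>
     (second_diamond scale C > 3 \<longrightarrow> (\<forall>u \<in> C 2. br u Y = 0)) \<and>
     (\<forall>V \<in> C (second_diamond scale C - 1). V \<noteq> 0 \<longrightarrow>
        br (br V X) X = 0 \<and> br (br V Y) Y = 0 \<and>
        br (br V Y) X = scale (- 2) (br (br V X) Y))"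

text \<open>In both type predicates the relations do not depend on the choice of \<open>V\<close>, since the component
  preceding the diamond is required to be one-dimensional.\<close>

definition finite_type ::
  "('a::field \<Rightarrow> 'v::ab_group_add \<Rightarrow> 'v) \<Rightarrow> ('v \<Rightarrow> 'v \<Rightarrow> 'v) \<Rightarrow> (nat \<Rightarrow> 'v set) \<Rightarrow>
    'v \<Rightarrow> 'v \<Rightarrow> nat \<Rightarrow> 'a \<Rightarrow> bool" where
  "finite_type scale br C X Y i \<mu> \<longleftrightarrow>
     i > 1 \<and> is_diamond scale C i \<and> vector_space.dim scale (C (i - 1)) = 1 \<and>
     (\<forall>V \<in> C (i - 1). V \<noteq> 0 \<longrightarrow>
        br (br V Y) Y = 0 \<and> br (br V X) X = 0 \<and>
        scale (1 - \<mu>) (br (br V X) Y) = scale \<mu> (br (br V Y) X))"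

definition infinite_type ::
  "('a::field \<Rightarrow> 'v::ab_group_add \<Rightarrow> 'v) \<Rightarrow> ('v \<Rightarrow> 'v \<Rightarrow> 'v) \<Rightarrow> (nat \<Rightarrow> 'v set) \<Rightarrow>
    'v \<Rightarrow> 'v \<Rightarrow> nat \<Rightarrow> bool" where
  "infinite_type scale br C X Y i \<longleftrightarrow>
     i > 1 \<and> is_diamond scale C i \<and> vector_space.dim scale (C (i - 1)) = 1 \<and>
     (\<forall>V \<in> C (i - 1). V \<noteq> 0 \<longrightarrow>
        br (br V Y) Y = 0 \<and> br (br V X) X = 0 \<and>
        - br (br V X) Y = br (br V Y) X)"


section \<open>Loop algebras\<close>

text \<open>\<open>S \<otimes> F[T]\<close> is modelled by the polynomials in \<open>T\<close> with coefficients in \<open>S\<close>, so that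
  \<open>u \<otimes> T\<^sup>k\<close> is \<open>monom u k\<close>.\<close>

definition loop_scale :: "('a::field \<Rightarrow> 'v::ab_group_add \<Rightarrow> 'v) \<Rightarrow> 'a \<Rightarrow> 'v poly \<Rightarrow> 'v poly" where
  "loop_scale scale c f = map_poly (scale c) f"

definition loop_bracket :: "('v::ab_group_add \<Rightarrow> 'v \<Rightarrow> 'v) \<Rightarrow> 'v poly \<Rightarrow> 'v poly \<Rightarrow> 'v poly" where
  "loop_bracket br f g =
     (\<Sum>i\<le>degree f. \<Sum>j\<le>degree g. monom (br (coeff f i) (coeff g j)) (i + j))"

definition poly_carrier :: "'v::ab_group_add set \<Rightarrow> 'v poly set" where
  "poly_carrier A = {f. \<forall>k. coeff f k \<in> A}"

definition lie_subalgebra ::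
  "('a::field \<Rightarrow> 'v::ab_group_add \<Rightarrow> 'v) \<Rightarrow> 'v set \<Rightarrow> ('v \<Rightarrow> 'v \<Rightarrow> 'v) \<Rightarrow> 'v set \<Rightarrow> bool" where
  "lie_subalgebra scale A br M \<longleftrightarrow>
     M \<subseteq> A \<and> module.subspace scale M \<and> (\<forall>x\<in>M. \<forall>y\<in>M. br x y \<in> M)"

text \<open>The grading \<open>S\<close> enters the loop algebra only through its component \<open>S 1\<close>.\<close>

definition loop_algebra ::
  "('a::field \<Rightarrow> 'v::ab_group_add \<Rightarrow> 'v) \<Rightarrow> 'v set \<Rightarrow> ('v \<Rightarrow> 'v \<Rightarrow> 'v) \<Rightarrow> (int \<Rightarrow> 'v set) \<Rightarrow>
    'v poly set" where
  "loop_algebra scale A br S =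
     lie_subalgebra (loop_scale scale) (poly_carrier A) (loop_bracket br) hull
       ((\<lambda>u. monom u 1) ` S 1)"

definition power_component :: "'v::ab_group_add poly set \<Rightarrow> nat \<Rightarrow> 'v poly set" where
  "power_component L k = L \<inter> range (\<lambda>u. monom u k)"


section \<open>The divided power algebra and the Albert-Zassenhaus algebra\<close>

text \<open>An element \<open>f\<close> of \<open>O(2;(n\<^sub>1,n\<^sub>2))\<close> is given by its coefficients: \<open>f (i,j)\<close> is the coefficient
  of \<open>x\<^bsup>(i)\<^esup>y\<^bsup>(j)\<^esup>\<close>. The parameter \<open>p\<close> is always the characteristic of the field.\<close>

definition fun_scale :: "'a::field \<Rightarrow> ('x \<Rightarrow> 'a) \<Rightarrow> 'x \<Rightarrow> 'a" where
  "fun_scale c f = (\<lambda>u. c * f u)"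

definition dp_box :: "nat \<Rightarrow> nat \<Rightarrow> nat \<Rightarrow> (nat \<times> nat) set" where
  "dp_box p n1 n2 = {..<p ^ n1} \<times> {..<p ^ n2}"

definition dp_carrier :: "nat \<Rightarrow> nat \<Rightarrow> nat \<Rightarrow> (nat \<times> nat \<Rightarrow> 'a::field) set" where
  "dp_carrier p n1 n2 = {f. \<forall>u. u \<notin> dp_box p n1 n2 \<longrightarrow> f u = 0}"

definition dp_monom :: "nat \<Rightarrow> nat \<Rightarrow> nat \<Rightarrow> int \<Rightarrow> int \<Rightarrow> nat \<times> nat \<Rightarrow> 'a::field" where
  "dp_monom p n1 n2 i j =
     (\<lambda>u. if 0 \<le> i \<and> i < int (p ^ n1) \<and> 0 \<le> j \<and> j < int (p ^ n2) \<and> u = (nat i, nat j)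
          then 1 else 0)"

text \<open>Bilinear extension of an operation given on pairs of monomials.\<close>

definition dp_extend ::
  "nat \<Rightarrow> nat \<Rightarrow> nat \<Rightarrow> (nat \<times> nat \<Rightarrow> nat \<times> nat \<Rightarrow> nat \<times> nat \<Rightarrow> 'a::field) \<Rightarrow>
    (nat \<times> nat \<Rightarrow> 'a) \<Rightarrow> (nat \<times> nat \<Rightarrow> 'a) \<Rightarrow> nat \<times> nat \<Rightarrow> 'a" where
  "dp_extend p n1 n2 b f g =
     (\<Sum>u\<in>dp_box p n1 n2. \<Sum>v\<in>dp_box p n1 n2. fun_scale (f u * g v) (b u v))"

definition dp_mult ::
  "nat \<Rightarrow> nat \<Rightarrow> nat \<Rightarrow> (nat \<times> nat \<Rightarrow> 'a::field) \<Rightarrow> (nat \<times> nat \<Rightarrow> 'a) \<Rightarrow> nat \<times> nat \<Rightarrow> 'a" where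
  "dp_mult p n1 n2 = dp_extend p n1 n2 (\<lambda>(i, j) (k, l).
     fun_scale (of_nat ((i + k choose i) * (j + l choose j)))
       (dp_monom p n1 n2 (int (i + k)) (int (j + l))))"

definition AZ_monom_bracket ::
  "nat \<Rightarrow> nat \<Rightarrow> nat \<Rightarrow> int \<times> int \<Rightarrow> int \<times> int \<Rightarrow> nat \<times> nat \<Rightarrow> 'a::field" where
  "AZ_monom_bracket p n1 n2 = (\<lambda>(i, j) (k, l).
     let m = dp_monom p n1 n2; mult = dp_mult p n1 n2 in
     if i + k > 0
     then mult (m i (j - 1)) (m (k - 1) l) - mult (m (i - 1) j) (m k (l - 1))
     else mult (m (int (p ^ n1) - 1) 0)
            (mult (m 0 (j - 1)) (m 0 l) - mult (m 0 j) (m 0 (l - 1))))"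

definition AZ_bracket ::
  "nat \<Rightarrow> nat \<Rightarrow> nat \<Rightarrow> (nat \<times> nat \<Rightarrow> 'a::field) \<Rightarrow> (nat \<times> nat \<Rightarrow> 'a) \<Rightarrow> nat \<times> nat \<Rightarrow> 'a" where
  "AZ_bracket p n1 n2 = dp_extend p n1 n2 (\<lambda>(i, j) (k, l).
     AZ_monom_bracket p n1 n2 (int i, int j) (int k, int l))"

text \<open>The library binomial \<open>(gchoose)\<close> is only available in characteristic zero.\<close>

definition field_binomial :: "'a::field \<Rightarrow> nat \<Rightarrow> 'a" where
  "field_binomial \<alpha> i = (\<Prod>m<i. \<alpha> - of_nat m) / of_nat (fact i)"

text \<open>\<open>(1 + c x\<^bsup>(p^s)\<^esup>)\<^bsup>\<alpha>\<^esup>\<close> as an element of \<open>O(2;(s+1,n))\<close>.\<close>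

definition gen_power :: "nat \<Rightarrow> nat \<Rightarrow> nat \<Rightarrow> 'a::field \<Rightarrow> 'a \<Rightarrow> nat \<times> nat \<Rightarrow> 'a" where
  "gen_power p s n c \<alpha> =
     (\<Sum>i<p. fun_scale (field_binomial \<alpha> i * of_nat (fact i) * c ^ i)
        (dp_monom p (s + 1) n (int (i * p ^ s)) 0))"

text \<open>The index \<open>a\<close> runs over the representatives \<open>0, \<dots>, p - 1\<close> of the prime field; changing
  the representative changes neither the element nor its degree modulo \<open>(q - 1) p\<^sup>s\<^sup>+\<^sup>1\<close>.\<close>

definition AZ_index :: "nat \<Rightarrow> nat \<Rightarrow> nat \<Rightarrow> (int \<times> int \<times> int) set" where
  "AZ_index p s n = {-1..<int (p ^ n) - 1} \<times> {-1..<int (p ^ s) - 1} \<times> {0..<int p}"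

definition AZ_elem ::
  "nat \<Rightarrow> nat \<Rightarrow> nat \<Rightarrow> 'a::field \<Rightarrow> 'a \<Rightarrow> int \<times> int \<times> int \<Rightarrow> nat \<times> nat \<Rightarrow> 'a" where
  "AZ_elem p s n \<sigma> \<pi> = (\<lambda>(j, k, a).
     dp_mult p (s + 1) n (gen_power p s n \<sigma> (- of_int j * \<pi> + of_int a))
       (dp_monom p (s + 1) n (k + 1) (j + 1)))"

definition AZ_degree :: "nat \<Rightarrow> nat \<Rightarrow> nat \<Rightarrow> int \<times> int \<times> int \<Rightarrow> int" where
  "AZ_degree p s n = (\<lambda>(j, k, a). (1 - int (p ^ n)) * (a * int (p ^ s) + k) - j)"

end

theory Submission
  imports Defs
begin

text \<open>A function on \<open>\<nat>\<times>\<nat>\<close> is read as a Hurwitz series, that is, as a power series in divided powers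
  in two variables; in characteristic \<open>p\<close> the algebra \<open>O(2;(s+1,n))\<close> is a subring closed under
  \<open>\<partial>\<^sub>x\<close> and \<open>\<partial>\<^sub>y\<close>, and the two cases in the definition of the Albert-Zassenhaus bracket merge
  into \<open>{f,g} = \<partial>\<^sub>yf Dg - Df \<partial>\<^sub>yg\<close> with \<open>Df = \<partial>\<^sub>xf + w f\<close> and \<open>w\<close> the top power of \<open>x\<close>.

  With \<open>z = x\<^bsup>(p^s)\<^esup>\<close>, the truncation of \<open>(1 + \<sigma> z)\<^bsup>\<alpha>\<^esup>\<close> adds to its \<open>x\<close>-derivative the multiple
  \<open>-(\<alpha>\<^sup>p - \<alpha>) \<sigma>\<^sup>p\<close> of the top power of \<open>x\<close>, which is \<open>j\<close> for
  \<open>\<alpha> = -j \<pi> + a\<close>. Hence the defects cancel in brackets, and the \<open>e\<^bsub>j,k,a\<^esub>\<close> multiply up to scalars by adding degrees.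

  Put \<open>M = a p\<^sup>s + k\<close>, \<open>X = e\<^bsub>-1,0,0\<^esub>\<close> and \<open>Y = e\<^bsub>q-2,-1,0\<^esub>\<close>. Then \<open>ad X\<close> maps \<open>e\<^bsub>j,M\<^esub>\<close> to \<open>e\<^bsub>j-1,M\<^esub>\<close>, while
  \<open>ad Y\<close> only acts on \<open>e\<^bsub>0,M\<^esub>\<close> and \<open>e\<^bsub>-1,M\<^esub>\<close>, sending them to nonzero multiples of
  \<open>e\<^bsub>q-2,M-1\<^esub>\<close> and \<open>e\<^bsub>q-3,M-1\<^esub>\<close>. So a degree is one-dimensional except where \<open>e\<^bsub>-1,M\<^esub>\<close> and \<open>e\<^bsub>q-2,M-1\<^esub>\<close>
  meet, the covering property is immediate, and the type of a diamond is read off from the two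
  multiples. For \<open>q = 3\<close> the generators may also be interchanged, which replaces \<open>\<mu>\<close> by \<open>1 - \<mu>\<close>.\<close>

section \<open>Loop algebras of cyclic gradings\<close>

text \<open>Series without truncation make the algebra uniform: the ring laws reduce to the Leibniz
  rule, the bracket becomes a formula in two commuting operators, and truncation survives only as
  the vanishing of binomial coefficients with a carry in base \<open>p\<close>. The hypothesis on
  \<open>\<sigma>\<close> and \<open>\<pi>\<close> enters twice.
  \<open>\<alpha>^p - \<alpha>\<close> is additive and vanishes on the prime field, so at
  \<open>-j \<pi> + a\<close> it equals \<open>-j (\<pi>^p - \<pi>)\<close>, and the hypothesis
  turns the defect into the integer \<open>j\<close>. With the 1 coming from \<open>w\<close> this
  becomes \<open>j + 1\<close>, the exponent of \<open>y\<close>, and a symmetry of binomials makes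
  the two contributions to a bracket cancel. Secondly, \<open>\<pi>\<close> lies outside the prime
  field, so the multiples produced by \<open>Y\<close> never vanish. Write \<open>M + 1\<close> with
  quotient \<open>a\<close> and remainder modulo \<open>p^s\<close>: lowering \<open>M\<close>
  borrows from \<open>a\<close> exactly when the remainder is 0. The diamond in degree
  \<open>t (q - 1) + 1\<close> has \<open>M = -t\<close>, whence the exceptional \<open>t\<close>
  are those congruent to 1 modulo \<open>p^s\<close>; elsewhere the two multiples are opposite,
  which is infinite type.\<close>

context lie_algebra
begin

lemma br_zero_left [simp]: "y \<in> A \<Longrightarrow> br 0 y = 0"
  using br_scale_left[of 0 y 0] subspace_0[OF subspace_carrier] by simp

lemma br_zero_right [simp]: "x \<in> A \<Longrightarrow> br x 0 = 0"
  using br_scale_right[of x 0 0] subspace_0[OF subspace_carrier] by simp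

lemma zero_mem [simp]: "0 \<in> A"
  using subspace_0[OF subspace_carrier] .

lemma br_antisym:
  assumes "x \<in> A" "y \<in> A"
  shows "br x y = - br y x"
proof -
  have "x + y \<in> A" using assms subspace_add[OF subspace_carrier] by blast
  then have "0 = br (x + y) (x + y)" by (simp add: br_alternating)
  also have "\<dots> = br x (x + y) + br y (x + y)"
    using assms \<open>x + y \<in> A\<close> by (simp only: br_add_left)
  also have "\<dots> = br x y + br y x"
    using assms by (simp add: br_add_right br_alternating)
  finally show ?thesis by (metis eq_neg_iff_add_eq_0)
qed

lemma lie_algebra_subset:
  assumes "lie_subalgebra scale A br M"
  shows "lie_algebra scale M br"
proof -
  have M: "M \<subseteq> A" "subspace M" "\<And>x y. x \<in> M \<Longrightarrow> y \<in> M \<Longrightarrow> br x y \<in> M"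
    using assms by (auto simp: lie_subalgebra_def)
  show ?thesis
    by (unfold_locales)
      (use M in \<open>auto simp: subset_iff br_add_left br_add_right br_scale_left br_scale_right
         br_alternating jacobi\<close>)
qed

section \<open>Polynomials with coefficients in a Lie algebra\<close>

lemma coeff_loop_scale [simp]: "coeff (loop_scale scale c f) k = scale c (coeff f k)"
  by (simp add: loop_scale_def coeff_map_poly)

lemma loop_scale_monom [simp]: "loop_scale scale c (monom u k) = monom (scale c u) k"
  by (rule poly_eqI) simp

lemma vector_space_loop_scale: "vector_space (loop_scale scale)"
  by unfold_locales (simp_all add: poly_eq_iff scale_right_distrib scale_left_distrib)

sublocale loop: vector_space "loop_scale scale"
  by (rule vector_space_loop_scale)

text \<open>Regroups the double sum by total degree. Coefficients past the degree are 0, and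
  \<open>br\<close> is known to kill 0 only against elements of \<open>A\<close>, hence the carrier
  hypotheses.\<close>

lemma coeff_loop_bracket:
  assumes "f \<in> poly_carrier A" "g \<in> poly_carrier A"
  shows "coeff (loop_bracket br f g) n = (\<Sum>i\<le>n. br (coeff f i) (coeff g (n - i)))"
proof -
  have mem: "coeff f i \<in> A" "coeff g i \<in> A" for i
    using assms by (auto simp: poly_carrier_def)
  have inner: "(\<Sum>j\<le>degree g. if i + j = n then br (coeff f i) (coeff g j) else 0)
      = (if i \<le> n then br (coeff f i) (coeff g (n - i)) else 0)" for i
  proof -
    have "(\<Sum>j\<le>degree g. if i + j = n then br (coeff f i) (coeff g j) else 0)
        = (\<Sum>j\<le>degree g. if j = n - i then (if i \<le> n then br (coeff f i) (coeff g (n - i)) else 0) else 0)"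
      by (rule sum.cong) auto
    also have "\<dots> = (if i \<le> n then br (coeff f i) (coeff g (n - i)) else 0)"
      by (auto simp: mem coeff_eq_0)
    finally show ?thesis .
  qed
  have "coeff (loop_bracket br f g) n
      = (\<Sum>i\<le>degree f. if i \<le> n then br (coeff f i) (coeff g (n - i)) else 0)"
    by (simp add: loop_bracket_def coeff_sum inner)
  also have "\<dots> = (\<Sum>i\<in>{..degree f} \<inter> {..n}. br (coeff f i) (coeff g (n - i)))"
    by (rule sum.mono_neutral_cong_right) auto
  also have "\<dots> = (\<Sum>i\<le>n. br (coeff f i) (coeff g (n - i)))"
  proof (rule sum.mono_neutral_left)
    show "\<forall>i\<in>{..n} - {..degree f} \<inter> {..n}. br (coeff f i) (coeff g (n - i)) = 0"
    proof
      fix i assume "i \<in> {..n} - {..degree f} \<inter> {..n}"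
      then have "degree f < i" by auto
      then show "br (coeff f i) (coeff g (n - i)) = 0" using mem by (simp add: coeff_eq_0)
    qed
  qed auto
  finally show ?thesis .
qed

lemma monom_mem_poly_carrier [simp]: "monom u k \<in> poly_carrier A \<longleftrightarrow> u \<in> A"
  by (auto simp: poly_carrier_def)

lemma loop_bracket_monom [simp]:
  assumes "u \<in> A" "v \<in> A"
  shows "loop_bracket br (monom u i) (monom v j) = monom (br u v) (i + j)"
proof (rule poly_eqI)
  fix n
  have "coeff (loop_bracket br (monom u i) (monom v j)) n
      = (\<Sum>k\<le>n. br (coeff (monom u i) k) (coeff (monom v j) (n - k)))"
    by (rule coeff_loop_bracket) (simp_all add: assms)
  also have "\<dots> = (\<Sum>k\<le>n. if k = i then (if n = i + j then br u v else 0) else 0)"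
    by (rule sum.cong) (use assms in auto)
  finally have "coeff (loop_bracket br (monom u i) (monom v j)) n
      = (\<Sum>k\<le>n. if k = i then (if n = i + j then br u v else 0) else 0)" .
  then show "coeff (loop_bracket br (monom u i) (monom v j)) n = coeff (monom (br u v) (i + j)) n"
    by auto
qed

lemma subspace_poly_carrier: "loop.subspace (poly_carrier A)"
  using subspace_carrier
  by (auto simp: loop.subspace_def poly_carrier_def subspace_def)

text \<open>Partial sums of the monomials of \<open>f\<close> stay in the carrier, so alternation
  and the Jacobi identity reduce to monomials.\<close>

lemma poly_carrier_induct [consumes 1, case_names zero add]:
  assumes f: "f \<in> poly_carrier A"
    and zero: "P 0"
    and add: "\<And>g u k. \<lbrakk>g \<in> poly_carrier A; P g; u \<in> A\<rbrakk> \<Longrightarrow> P (g + monom u k)"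
  shows "P f"
proof -
  have mem: "coeff f i \<in> A" for i
    using f by (auto simp: poly_carrier_def)
  have "(\<Sum>i<m. monom (coeff f i) i) \<in> poly_carrier A \<and> P (\<Sum>i<m. monom (coeff f i) i)" for m
    by (induction m)
      (use mem loop.subspace_add[OF subspace_poly_carrier] loop.subspace_0[OF subspace_poly_carrier]
        in \<open>auto intro: zero add\<close>)
  then show ?thesis
    using poly_as_sum_of_monoms[of f] by (metis lessThan_Suc_atMost)
qed

lemma lie_algebra_loop: "lie_algebra (loop_scale scale) (poly_carrier A) (loop_bracket br)"
proof unfold_locales
  let ?A = "poly_carrier A" and ?b = "loop_bracket br"
  have mem: "coeff f i \<in> A" if "f \<in> ?A" for f i
    using that by (auto simp: poly_carrier_def)
  note sub = loop.subspace_add[OF subspace_poly_carrier]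
  show "loop.subspace ?A" by (rule subspace_poly_carrier)
  show closed: "?b f g \<in> ?A" if "f \<in> ?A" "g \<in> ?A" for f g
  proof -
    have "(\<Sum>i\<le>n. br (coeff f i) (coeff g (n - i))) \<in> A" for n
      using that mem by (intro subspace_sum[OF subspace_carrier] br_closed) auto
    then have "coeff (?b f g) n \<in> A" for n
      using that by (simp add: coeff_loop_bracket)
    then show ?thesis by (simp add: poly_carrier_def)
  qed
  show addl: "?b (f + g) h = ?b f h + ?b g h" if "f \<in> ?A" "g \<in> ?A" "h \<in> ?A" for f g h
    by (rule poly_eqI) (use that sub mem in \<open>simp add: coeff_loop_bracket br_add_left sum.distrib\<close>)
  show addr: "?b f (g + h) = ?b f g + ?b f h" if "f \<in> ?A" "g \<in> ?A" "h \<in> ?A" for f g h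
    by (rule poly_eqI) (use that sub mem in \<open>simp add: coeff_loop_bracket br_add_right sum.distrib\<close>)
  show "?b (loop_scale scale c f) g = loop_scale scale c (?b f g)" if "f \<in> ?A" "g \<in> ?A" for c f g
    by (rule poly_eqI) (use that mem loop.subspace_scale[OF subspace_poly_carrier] in
      \<open>simp add: coeff_loop_bracket br_scale_left scale_sum_right\<close>)
  show "?b f (loop_scale scale c g) = loop_scale scale c (?b f g)" if "f \<in> ?A" "g \<in> ?A" for c f g
    by (rule poly_eqI) (use that mem loop.subspace_scale[OF subspace_poly_carrier] in
      \<open>simp add: coeff_loop_bracket br_scale_right scale_sum_right\<close>)
  \<comment> \<open>Alternation is not additive: expanding the bracket of
    \<open>g + monom u k\<close> with itself leaves cross terms, which must cancel
    independently.\<close>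
  have antisym: "?b f g + ?b g f = 0" if "f \<in> ?A" "g \<in> ?A" for f g
  proof (rule poly_eqI)
    fix n
    have "(\<Sum>i\<le>n. br (coeff g i) (coeff f (n - i))) = (\<Sum>i\<le>n. br (coeff g (n - i)) (coeff f i))"
      by (rule sum.reindex_bij_witness[of _ "\<lambda>i. n - i" "\<lambda>i. n - i"]) auto
    moreover have "br (coeff f i) (coeff g (n - i)) + br (coeff g (n - i)) (coeff f i) = 0" for i
      using that mem br_antisym by (metis add.left_inverse)
    ultimately show "coeff (?b f g + ?b g f) n = coeff 0 n"
      using that by (simp add: coeff_loop_bracket flip: sum.distrib)
  qed
  have b_zero: "?b 0 f = 0" "?b f 0 = 0" if "f \<in> ?A" for f
    using that mem loop.subspace_0[OF subspace_poly_carrier]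
    by (auto simp: poly_eq_iff coeff_loop_bracket)
  show "?b f f = 0" if "f \<in> ?A" for f
    using that
  proof (induction rule: poly_carrier_induct)
    case zero
    then show ?case by (simp add: b_zero loop.subspace_0[OF subspace_poly_carrier])
  next
    case (add g u k)
    then have "?b (g + monom u k) (g + monom u k)
        = ?b g g + (?b g (monom u k) + ?b (monom u k) g) + monom (br u u) (k + k)"
      using sub by (simp add: addl addr)
    then show ?case using add antisym by (simp add: br_alternating)
  qed
  \<comment> \<open>The Jacobi expression is additive in its first argument and invariant under
    rotation, so each argument in turn is rotated to the front and reduced to monomials.\<close>
  define J where "J f g h = ?b (?b f g) h + ?b (?b g h) f + ?b (?b h f) g" for f g h
  have J1: "J (f + f') g h = J f g h + J f' g h"
    if "f \<in> ?A" "f' \<in> ?A" "g \<in> ?A" "h \<in> ?A" for f f' g h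
    using that sub closed unfolding J_def by (simp add: addl addr)
  have J_cyc: "J f g h = J g h f" for f g h
    unfolding J_def by (simp add: add_ac)
  have J0: "J 0 g h = 0" if "g \<in> ?A" "h \<in> ?A" for g h
    using that closed unfolding J_def by (simp add: b_zero)
  have Jm: "J (monom u i) (monom v j) (monom w k) = 0" if "u \<in> A" "v \<in> A" "w \<in> A" for u v w i j k
  proof -
    have "J (monom u i) (monom v j) (monom w k)
        = monom (br (br u v) w + br (br v w) u + br (br w u) v) (i + j + k)"
      unfolding J_def using that by (simp add: br_closed add_monom add.commute add.left_commute)
    then show ?thesis using that by (simp add: jacobi)
  qed
  have Jm2: "J f (monom v j) (monom w k) = 0" if "f \<in> ?A" "v \<in> A" "w \<in> A" for f v w j k
    using that(1) by (induction rule: poly_carrier_induct) (use that in \<open>auto simp: J0 J1 Jm\<close>)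
  have Jm1: "J f g (monom w k) = 0" if "f \<in> ?A" "g \<in> ?A" "w \<in> A" for f g w k
  proof -
    have "J g (monom w k) f = 0"
      using that(2)
    proof (induction rule: poly_carrier_induct)
      case (add g' u i)
      have "J (monom u i) (monom w k) f = 0"
        using Jm2[of f u w i k] that add by (metis J_cyc)
      then show ?case using that add by (simp add: J1)
    qed (use that J0 in auto)
    then show ?thesis by (metis J_cyc)
  qed
  show "?b (?b f g) h + ?b (?b g h) f + ?b (?b h f) g = 0" if "f \<in> ?A" "g \<in> ?A" "h \<in> ?A" for f g h
  proof -
    have "J h f g = 0"
      using that(3)
    proof (induction rule: poly_carrier_induct)
      case (add h' u k)
      then show ?case using that Jm1[of f g u k] by (simp add: J1 J_cyc[of "monom u k"])
    qed (use that J0 in auto)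
    then show ?thesis by (metis J_cyc J_def)
  qed
qed

end

text \<open>The components of a grading by \<open>\<int>/N\<int>\<close> are indexed by all integers here, periodically.\<close>

locale cyclic_grading =
  lie_grading scale A br "{0..<N}" "\<lambda>i j. (i + j) mod N" S
  for scale :: "'a::field \<Rightarrow> 'v::ab_group_add \<Rightarrow> 'v" and A br and N :: int and S :: "int \<Rightarrow> 'v set" +
  assumes N_pos: "N > 0"
    and component_mod: "S (d mod N) = S d"
begin

lemma subspace_S: "subspace (S d)"
  using subspace_component[of "d mod N"] N_pos by (simp add: component_mod)

lemma S_subset: "S d \<subseteq> A"
proof -
  have "S (d mod N) \<subseteq> (\<Union>i\<in>{0..<N}. S i)"
    by (rule UN_upper) (use N_pos in auto)
  then show ?thesis using span_components span_superset by (metis component_mod subset_trans)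
qed

lemma br_S: "x \<in> S i \<Longrightarrow> y \<in> S j \<Longrightarrow> br x y \<in> S (i + j)"
  using br_component[of "i mod N" "j mod N" x y] N_pos component_mod
  by (metis atLeastLessThan_iff mod_add_eq pos_mod_bound pos_mod_sign)

text \<open>The candidate for the loop algebra. The constant term is excluded because degrees start
  at 1, although \<open>S 0\<close> may be nonzero.\<close>

definition loop_span :: "'v poly set" where
  "loop_span = {f. coeff f 0 = 0 \<and> (\<forall>k. coeff f k \<in> S (int k))}"

lemma loop_span_subset: "loop_span \<subseteq> poly_carrier A"
  using S_subset by (auto simp: loop_span_def poly_carrier_def)

lemma monom_mem_loop_span: "k > 0 \<Longrightarrow> monom u k \<in> loop_span \<longleftrightarrow> u \<in> S (int k)"
  using subspace_0[OF subspace_S] by (auto simp: loop_span_def)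

lemma lie_subalgebra_loop_span:
  "lie_subalgebra (loop_scale scale) (poly_carrier A) (loop_bracket br) loop_span"
proof -
  have "loop.subspace loop_span"
    using subspace_S by (auto simp: loop.subspace_def loop_span_def subspace_def)
  moreover have "loop_bracket br f g \<in> loop_span" if "f \<in> loop_span" "g \<in> loop_span" for f g
  proof -
    have coeff: "coeff (loop_bracket br f g) n = (\<Sum>i\<le>n. br (coeff f i) (coeff g (n - i)))" for n
      using that loop_span_subset by (intro coeff_loop_bracket) auto
    have "br (coeff f i) (coeff g (n - i)) \<in> S (int n)" if "i \<le> n" for i n
    proof -
      have "coeff f i \<in> S (int i)" "coeff g (n - i) \<in> S (int (n - i))"
        using \<open>f \<in> loop_span\<close> \<open>g \<in> loop_span\<close> by (auto simp only: loop_span_def)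
      from br_S[OF this] show ?thesis using that by (simp flip: of_nat_add)
    qed
    then show ?thesis
      using that by (auto simp: loop_span_def coeff intro!: subspace_sum[OF subspace_S])
  qed
  ultimately show ?thesis
    using loop_span_subset by (auto simp: lie_subalgebra_def)
qed

end

text \<open>Conditions on the finite-dimensional algebra that make its loop algebra thin.
  \<open>S_nonzero\<close> supplies the element to which \<open>S_covering\<close> applies in each
  degree, and also makes the loop algebra infinite-dimensional.\<close>

locale thin_cyclic_grading = cyclic_grading scale A br N S
  for scale :: "'a::field \<Rightarrow> 'v::ab_group_add \<Rightarrow> 'v" and A br N S +
  assumes dim_S1: "dim (S 1) = 2"
    and S_nonzero: "S d \<noteq> {0}"
    and S_covering: "\<lbrakk>u \<in> S d; u \<noteq> 0\<rbrakk> \<Longrightarrow> S (d + 1) = br u ` S 1"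
    and S_diamond: "\<exists>k>1. dim (S (int k)) = 2"
begin

text \<open>By covering, \<open>S (k + 1)\<close> is the bracket of one nonzero element of
  \<open>S k\<close> with \<open>S 1\<close>, so induction on \<open>k\<close> puts every monomial
  of \<open>loop_span\<close> into any subalgebra containing the generators.\<close>

lemma loop_algebra_eq: "loop_algebra scale A br S = loop_span"
proof
  show "loop_algebra scale A br S \<subseteq> loop_span"
    unfolding loop_algebra_def
    by (rule hull_minimal) (auto simp: lie_subalgebra_loop_span monom_mem_loop_span)
  have "loop_span \<subseteq> M"
    if M: "lie_subalgebra (loop_scale scale) (poly_carrier A) (loop_bracket br) M"
      "(\<lambda>u. monom u 1) ` S 1 \<subseteq> M" for M
  proof
    have M': "M \<subseteq> poly_carrier A" "loop.subspace M"
      "\<And>f g. f \<in> M \<Longrightarrow> g \<in> M \<Longrightarrow> loop_bracket br f g \<in> M"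
      using M by (auto simp: lie_subalgebra_def)
    have monom_mem: "monom u (Suc k) \<in> M" if "u \<in> S (int (Suc k))" for u k
      using that
    proof (induction k arbitrary: u)
      case 0
      then show ?case using M by auto
    next
      case (Suc k)
      obtain w where w: "w \<in> S (int (Suc k))" "w \<noteq> 0"
        using S_nonzero[of "int (Suc k)"] subspace_0[OF subspace_S] by blast
      then obtain v where v: "v \<in> S 1" "u = br w v"
        using S_covering[OF w] Suc.prems by (auto simp: add.commute)
      have "loop_bracket br (monom w (Suc k)) (monom v 1) \<in> M"
        using Suc.IH w v M by (intro M') auto
      then show ?case
        using v w S_subset by (auto simp: subset_iff)
    qed
    fix f assume f: "f \<in> loop_span"
    have "monom (coeff f i) i \<in> M" for i
    proof (cases i)
      case 0
      then show ?thesis using f loop.subspace_0[OF M'(2)] by (simp add: loop_span_def)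
    next
      case (Suc k)
      then show ?thesis using f monom_mem[of "coeff f i" k] by (auto simp only: loop_span_def)
    qed
    then have "(\<Sum>i\<le>degree f. monom (coeff f i) i) \<in> M"
      by (intro loop.subspace_sum[OF M'(2)])
    then show "f \<in> M" by (simp add: poly_as_sum_of_monoms)
  qed
  then show "loop_span \<subseteq> loop_algebra scale A br S"
    unfolding loop_algebra_def hull_def by blast
qed

lemma power_component_loop:
  assumes "k > 0"
  shows "power_component (loop_algebra scale A br S) k = (\<lambda>u. monom u k) ` S (int k)"
  using assms unfolding power_component_def loop_algebra_eq by (auto simp: monom_mem_loop_span)

lemma dim_monom_image: "loop.dim ((\<lambda>u. monom u k) ` V) = dim V"
proof -
  interpret m: Vector_Spaces.linear scale "loop_scale scale" "\<lambda>u. monom u k"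
    by unfold_locales (simp_all add: add_monom)
  have inj: "inj (\<lambda>u. monom u k)"
    by (auto simp: inj_def)
  obtain B where B: "B \<subseteq> V" "independent B" "V \<subseteq> span B" "card B = dim V"
    by (rule basis_exists)
  show ?thesis
  proof (rule loop.dim_unique)
    show "loop.independent ((\<lambda>u. monom u k) ` B)"
      by (rule m.independent_injective_image) (use B inj in \<open>auto intro: inj_on_subset\<close>)
    show "card ((\<lambda>u. monom u k) ` B) = dim V"
      using B(4) card_image[OF inj_on_subset[OF inj subset_UNIV]] by metis
  qed (use B in \<open>auto simp: m.span_image\<close>)
qed

lemma dim_loop_component:
  "k > 0 \<Longrightarrow> loop.dim (power_component (loop_algebra scale A br S) k) = dim (S (int k))"
  by (simp add: power_component_loop dim_monom_image)

lemma thin_loop: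
  "thin_lie_algebra (loop_scale scale) (loop_algebra scale A br S) (loop_bracket br)
     (power_component (loop_algebra scale A br S))"
proof -
  let ?C = "power_component (loop_algebra scale A br S)"
  interpret P: lie_algebra "loop_scale scale" "poly_carrier A" "loop_bracket br"
    by (rule lie_algebra_loop)
  interpret L: lie_algebra "loop_scale scale" loop_span "loop_bracket br"
    by (rule P.lie_algebra_subset[OF lie_subalgebra_loop_span])
  have C: "?C k = (\<lambda>u. monom u k) ` S (int k)" if "k > 0" for k
    by (rule power_component_loop[OF that])
  have SA: "u \<in> S d \<Longrightarrow> u \<in> A" for u d using S_subset by blast
  show ?thesis
    \<comment> \<open>With \<open>loop_span\<close> as carrier the interpretation \<open>L\<close>
      discharges the Lie algebra axioms; the remaining goals are then folded back.\<close>
    unfolding loop_algebra_eq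
  proof (unfold_locales, unfold loop_algebra_eq[symmetric])
    show sub: "loop.subspace (?C i)" if "i \<in> {1..}" for i
      using that subspace_S[of "int i"]
      by (auto simp: C loop.subspace_def subspace_def add_monom image_iff)
    show "loop.span (\<Union>i\<in>{1..}. ?C i) = loop_algebra scale A br S"
    proof
      show "loop.span (\<Union>i\<in>{1..}. ?C i) \<subseteq> loop_algebra scale A br S"
        using L.subspace_carrier
        by (intro loop.span_minimal) (auto simp: power_component_def loop_algebra_eq)
      show "loop_algebra scale A br S \<subseteq> loop.span (\<Union>i\<in>{1..}. ?C i)"
      proof
        fix f assume f: "f \<in> loop_algebra scale A br S"
        have "monom (coeff f i) i \<in> loop.span (\<Union>i\<in>{1..}. ?C i)" for i
        proof (cases "i = 0")
          case True
          then show ?thesis using f loop.span_zero by (simp add: loop_algebra_eq loop_span_def)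
        next
          case False
          then have "monom (coeff f i) i \<in> ?C i"
            using f C[of i] by (auto simp: loop_algebra_eq loop_span_def)
          with False show ?thesis
            by (intro loop.span_base) (auto simp: Suc_le_eq)
        qed
        then have "(\<Sum>i\<le>degree f. monom (coeff f i) i) \<in> loop.span (\<Union>i\<in>{1..}. ?C i)"
          by (intro loop.span_sum)
        then show "f \<in> loop.span (\<Union>i\<in>{1..}. ?C i)" by (simp add: poly_as_sum_of_monoms)
      qed
    qed
    show "v k = 0"
      if K: "finite K" "K \<subseteq> {1..}" "\<And>i. i \<in> K \<Longrightarrow> v i \<in> ?C i" "(\<Sum>i\<in>K. v i) = 0" "k \<in> K" for K v k
    proof -
      have "\<exists>u. v i = monom u i" if "i \<in> K" for i
        using K(3)[OF that] by (auto simp: power_component_def)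
      then obtain u where u: "\<And>i. i \<in> K \<Longrightarrow> v i = monom (u i) i" by metis
      have "0 = coeff (\<Sum>i\<in>K. v i) k" by (simp add: K)
      also have "\<dots> = (\<Sum>i\<in>K. if i = k then u k else 0)"
        unfolding coeff_sum by (rule sum.cong) (auto simp: u)
      finally have "u k = 0" using K by auto
      then show ?thesis using u K by simp
    qed
    show "loop_bracket br x y \<in> ?C (i + j)"
      if "i \<in> {1..}" "j \<in> {1..}" "x \<in> ?C i" "y \<in> ?C j" for i j x y
      using that br_S by (auto simp: C SA intro!: imageI)
    show "\<nexists>B. finite B \<and> loop.span B = loop_algebra scale A br S"
    proof
      assume "\<exists>B. finite B \<and> loop.span B = loop_algebra scale A br S"
      then obtain B where B: "finite B" "loop.span B = loop_algebra scale A br S" by blast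
      define D where "D = Max (insert 0 (degree ` B))"
      have "loop.span B \<subseteq> {f. degree f \<le> D}"
      proof (rule loop.span_minimal)
        show "B \<subseteq> {f. degree f \<le> D}" using B(1) by (auto simp: D_def)
        show "loop.subspace {f. degree f \<le> D}"
          by (auto simp: loop.subspace_def degree_add_le loop_scale_def
              intro: order.trans[OF map_poly_degree_leq])
      qed
      moreover obtain u where "u \<in> S (int (Suc D))" "u \<noteq> 0"
        using S_nonzero subspace_0[OF subspace_S] by blast
      ultimately show False
        using B(2) monom_mem_loop_span[of "Suc D" u] by (auto simp: loop_algebra_eq degree_monom_eq)
    qed
    show "loop.dim (?C 1) = 2"
      by (simp add: dim_loop_component dim_S1)
    show "?C (i + 1) = loop_bracket br u ` ?C 1" if u: "i \<ge> 1" "u \<in> ?C i" "u \<noteq> 0" for i u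
    proof -
      obtain w where w: "u = monom w i" "w \<in> S (int i)" "w \<noteq> 0"
        using u subsetD[OF equalityD1[OF C], of i u] by auto
      have "?C (i + 1) = (\<lambda>v. monom v (i + 1)) ` (br w ` S 1)"
        using that S_covering[OF w(2,3)] by (simp add: C add.commute)
      also have "\<dots> = loop_bracket br u ` ?C 1"
        using w by (auto simp: C SA image_image intro!: image_cong)
      finally show ?thesis .
    qed
    show "\<exists>i>1. loop.dim (?C i) = 2"
      using S_diamond by (auto simp: dim_loop_component)
  qed
qed

end

section \<open>Hurwitz series\<close>

text \<open>A type of its own because the product of functions is pointwise, whereas here it is
  binomial convolution. Nesting the type gives two variables.\<close>

typedef 'a hurwitz = "UNIV :: (nat \<Rightarrow> 'a) set"
  morphisms hcoeff Hurwitz ..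

setup_lifting type_definition_hurwitz

lemma hcoeff_Hurwitz [simp]: "hcoeff (Hurwitz f) n = f n"
  by (simp add: Hurwitz_inverse)

lemma hurwitz_eqI: "(\<And>n. hcoeff F n = hcoeff G n) \<Longrightarrow> F = G"
  by (metis ext hcoeff_inject)

lemma hurwitz_eq_iff: "F = G \<longleftrightarrow> (\<forall>n. hcoeff F n = hcoeff G n)"
  by (auto intro: hurwitz_eqI)

instantiation hurwitz :: (ab_group_add) ab_group_add
begin
lift_definition zero_hurwitz :: "'a hurwitz" is "\<lambda>_. 0" .
lift_definition plus_hurwitz :: "'a hurwitz \<Rightarrow> 'a hurwitz \<Rightarrow> 'a hurwitz" is "\<lambda>f g n. f n + g n" .
lift_definition minus_hurwitz :: "'a hurwitz \<Rightarrow> 'a hurwitz \<Rightarrow> 'a hurwitz" is "\<lambda>f g n. f n - g n" .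
lift_definition uminus_hurwitz :: "'a hurwitz \<Rightarrow> 'a hurwitz" is "\<lambda>f n. - f n" .
instance by (standard; transfer) (auto simp: algebra_simps)
end

lemma hcoeff_zero [simp]: "hcoeff 0 n = 0" by transfer simp
lemma hcoeff_add [simp]: "hcoeff (F + G) n = hcoeff F n + hcoeff G n" by transfer simp
lemma hcoeff_diff [simp]: "hcoeff (F - G) n = hcoeff F n - hcoeff G n" by transfer simp
lemma hcoeff_uminus [simp]: "hcoeff (- F) n = - hcoeff F n" by transfer simp
lemma hcoeff_sum [simp]: "hcoeff (\<Sum>i\<in>A. F i) n = (\<Sum>i\<in>A. hcoeff (F i) n)"
  by (induction A rule: infinite_finite_induct) auto

text \<open>Differentiation lowers every divided power by one, with coefficient 1, so it is a shift
  of coefficients in any characteristic.\<close>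

lift_definition hderiv :: "'a hurwitz \<Rightarrow> 'a hurwitz" is "\<lambda>f n. f (Suc n)" .

lemma hcoeff_hderiv [simp]: "hcoeff (hderiv F) n = hcoeff F (Suc n)" by transfer simp
lemma hderiv_zero [simp]: "hderiv 0 = 0" by (rule hurwitz_eqI) simp
lemma hderiv_add [simp]: "hderiv (F + G) = hderiv F + hderiv G" by (rule hurwitz_eqI) simp
lemma hderiv_diff [simp]: "hderiv (F - G) = hderiv F - hderiv G" by (rule hurwitz_eqI) simp

instantiation hurwitz :: (comm_ring_1) comm_ring_1
begin
lift_definition one_hurwitz :: "'a hurwitz" is "\<lambda>n. if n = 0 then 1 else 0" .
lift_definition times_hurwitz :: "'a hurwitz \<Rightarrow> 'a hurwitz \<Rightarrow> 'a hurwitz"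
  is "\<lambda>f g n. \<Sum>i\<le>n. of_nat (n choose i) * f i * g (n - i)" .

lemma hcoeff_one [simp]: "hcoeff 1 n = (if n = 0 then 1 else 0)" by transfer simp

lemma hcoeff_mult:
  "hcoeff (F * G) n = (\<Sum>i\<le>n. of_nat (n choose i) * hcoeff F i * hcoeff G (n - i))"
  by transfer simp

text \<open>Pascal's rule applied to \<open>Suc n choose Suc i\<close>. It precedes the ring axioms
  because they are derived from it.\<close>

lemma hderiv_mult: "hderiv (F * G) = hderiv F * G + F * hderiv (G :: 'a hurwitz)"
proof (rule hurwitz_eqI)
  fix n
  have "hcoeff (hderiv (F * G)) n
      = hcoeff F 0 * hcoeff G (Suc n)
        + (\<Sum>i\<le>n. of_nat (Suc n choose Suc i) * hcoeff F (Suc i) * hcoeff G (n - i))"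
    by (simp add: hcoeff_mult sum.atMost_Suc_shift del: binomial_Suc_Suc sum.atMost_Suc)
  also have "(\<Sum>i\<le>n. of_nat (Suc n choose Suc i) * hcoeff F (Suc i) * hcoeff G (n - i))
      = (\<Sum>i\<le>n. of_nat (n choose i) * hcoeff F (Suc i) * hcoeff G (n - i))
        + (\<Sum>i\<le>n. of_nat (n choose Suc i) * hcoeff F (Suc i) * hcoeff G (n - i))"
    by (simp add: algebra_simps sum.distrib)
  also have "(\<Sum>i\<le>n. of_nat (n choose Suc i) * hcoeff F (Suc i) * hcoeff G (n - i))
      = (\<Sum>i<n. of_nat (n choose Suc i) * hcoeff F (Suc i) * hcoeff G (Suc (n - Suc i)))"
    by (rule sum.mono_neutral_cong_right) (auto simp: Suc_diff_Suc order.order_iff_strict binomial_eq_0)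
  also have "hcoeff F 0 * hcoeff G (Suc n) +
      ((\<Sum>i\<le>n. of_nat (n choose i) * hcoeff F (Suc i) * hcoeff G (n - i)) + \<dots>)
      = hcoeff (hderiv F * G) n
        + (\<Sum>i<Suc n. of_nat (n choose i) * hcoeff F i * hcoeff G (Suc (n - i)))"
    by (simp add: hcoeff_mult sum.lessThan_Suc_shift del: sum.lessThan_Suc)
  finally show "hcoeff (hderiv (F * G)) n = hcoeff (hderiv F * G + F * hderiv G) n"
    by (simp add: hcoeff_mult lessThan_Suc_atMost)
qed

lemma hcoeff_mult_0: "hcoeff (F * G) 0 = hcoeff F 0 * hcoeff (G :: 'a hurwitz) 0"
  by (simp add: hcoeff_mult)

instance
proof
  \<comment> \<open>Coefficient \<open>Suc n\<close> is coefficient \<open>n\<close> of the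
    derivative, so the Leibniz rule gives commutativity and associativity by induction on
    \<open>n\<close> for all series at once.\<close>
  have Suc: "hcoeff F (Suc n) = hcoeff (hderiv F) n" for F :: "'a hurwitz" and n
    by simp
  show comm: "F * G = G * F" for F G :: "'a hurwitz"
  proof (rule hurwitz_eqI)
    show "hcoeff (F * G) n = hcoeff (G * F) n" for n
      by (induction n arbitrary: F G)
        (simp_all add: hcoeff_mult_0 Suc hderiv_mult ac_simps del: hcoeff_hderiv)
  qed
  show distrib: "(F + G) * K = F * K + G * K" for F G K :: "'a hurwitz"
    by (rule hurwitz_eqI) (simp add: hcoeff_mult algebra_simps sum.distrib)
  have distrib': "K * (F + G) = K * F + K * G" for F G K :: "'a hurwitz"
    by (metis comm distrib)
  show "(F * G) * K = F * (G * K)" for F G K :: "'a hurwitz"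
  proof (rule hurwitz_eqI)
    show "hcoeff (F * G * K) n = hcoeff (F * (G * K)) n" for n
      by (induction n arbitrary: F G K)
        (simp_all add: hcoeff_mult_0 Suc hderiv_mult distrib distrib' ac_simps del: hcoeff_hderiv)
  qed
  show "1 * F = F" for F :: "'a hurwitz"
  proof (rule hurwitz_eqI)
    fix n
    have "hcoeff (1 * F) n = (\<Sum>i\<le>n. if i = 0 then hcoeff F n else 0)"
      unfolding hcoeff_mult by (rule sum.cong) auto
    then show "hcoeff (1 * F) n = hcoeff F n" by simp
  qed
  show "(0 :: 'a hurwitz) \<noteq> 1"
    by (auto simp: hurwitz_eq_iff)
qed
end

definition hconst :: "'a::zero \<Rightarrow> 'a hurwitz" where
  "hconst c = Hurwitz (\<lambda>n. if n = 0 then c else 0)"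

definition hmonom :: "nat \<Rightarrow> 'a::zero_neq_one hurwitz" where
  "hmonom i = Hurwitz (\<lambda>n. if n = i then 1 else 0)"

lemma hcoeff_hconst [simp]: "hcoeff (hconst c) n = (if n = 0 then c else 0)"
  by (simp add: hconst_def)

lemma hcoeff_hmonom [simp]: "hcoeff (hmonom i) n = (if n = i then 1 else 0)"
  by (simp add: hmonom_def)

lemma hcoeff_hconst_mult [simp]: "hcoeff (hconst c * F) n = c * hcoeff F n"
proof -
  have "hcoeff (hconst c * F) n = (\<Sum>i\<le>n. if i = 0 then c * hcoeff F n else 0)"
    unfolding hcoeff_mult by (rule sum.cong) auto
  then show ?thesis by simp
qed

lemma hconst_add: "hconst (a + b) = hconst a + hconst (b :: 'a::ab_group_add)"
  by (rule hurwitz_eqI) simp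
lemma hconst_uminus: "hconst (- a) = - hconst (a :: 'a::ab_group_add)"
  by (rule hurwitz_eqI) simp
lemma hconst_diff: "hconst (a - b) = hconst a - hconst (b :: 'a::ab_group_add)"
  by (rule hurwitz_eqI) simp
lemma hconst_mult: "hconst (a * b) = hconst a * hconst (b :: 'a::comm_ring_1)"
  by (rule hurwitz_eqI) simp
lemma hconst_0 [simp]: "hconst 0 = 0"
  by (rule hurwitz_eqI) simp
lemma hconst_1 [simp]: "hconst 1 = 1"
  by (rule hurwitz_eqI) simp
lemma hconst_of_nat [simp]: "hconst (of_nat m :: 'a::comm_ring_1) = of_nat m"
  by (induction m) (simp_all add: hconst_add)
lemma hconst_sum: "hconst (\<Sum>i\<in>A. f i :: 'a::ab_group_add) = (\<Sum>i\<in>A. hconst (f i))"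
  by (induction A rule: infinite_finite_induct) (simp_all add: hconst_add)

lemma hmonom_0 [simp]: "hmonom 0 = 1"
  by (rule hurwitz_eqI) simp

lemma hmonom_mult:
  "hmonom i * hmonom k = of_nat (i + k choose i) * (hmonom (i + k) :: 'a::comm_ring_1 hurwitz)"
proof (rule hurwitz_eqI)
  fix n
  have "hcoeff (hmonom i * hmonom k :: 'a hurwitz) n
      = (\<Sum>l\<le>n. if l = i then (if n - i = k then of_nat (n choose i) else 0) else 0)"
    unfolding hcoeff_mult by (rule sum.cong) auto
  also have "\<dots> = (if n = i + k then of_nat (n choose i) else 0)"
    by auto
  also have "\<dots> = hcoeff (of_nat (i + k choose i) * hmonom (i + k) :: 'a hurwitz) n"
    by (simp flip: hconst_of_nat)
  finally show "hcoeff (hmonom i * hmonom k :: 'a hurwitz) n = \<dots>" .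
qed

lemma hderiv_hmonom: "hderiv (hmonom i) = (if i = 0 then 0 else hmonom (i - 1))"
  by (rule hurwitz_eqI) auto

lemma hderiv_hconst [simp]: "hderiv (hconst c) = 0"
  by (rule hurwitz_eqI) auto

section \<open>Two variables and the two partial derivatives\<close>

type_synonym 'a hurwitz2 = "'a hurwitz hurwitz"

text \<open>The outer index is the power of \<open>x\<close> and the inner one that of
  \<open>y\<close>; on the nested type \<open>hderiv\<close> is therefore the
  \<open>x\<close>-derivative and this is the \<open>y\<close>-derivative.\<close>

definition inner_deriv :: "'a hurwitz2 \<Rightarrow> 'a hurwitz2" where
  "inner_deriv F = Hurwitz (\<lambda>i. hderiv (hcoeff F i))"

lemma hcoeff_inner_deriv [simp]: "hcoeff (inner_deriv F) i = hderiv (hcoeff F i)"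
  by (simp add: inner_deriv_def)

lemma hderiv_sum [simp]: "hderiv (\<Sum>i\<in>A. F i) = (\<Sum>i\<in>A. hderiv (F i))"
  by (rule hurwitz_eqI) simp

lemma hderiv_of_nat [simp]: "hderiv (of_nat m :: 'a::comm_ring_1 hurwitz) = 0"
  by (rule hurwitz_eqI) (simp flip: hconst_of_nat)

lemma hderiv_1 [simp]: "hderiv (1 :: 'a::comm_ring_1 hurwitz) = 0"
  using hderiv_of_nat[of 1] by simp

lemma inner_deriv_add [simp]: "inner_deriv (F + G) = inner_deriv F + inner_deriv G"
  by (rule hurwitz_eqI) simp
lemma inner_deriv_diff [simp]: "inner_deriv (F - G) = inner_deriv F - inner_deriv G"
  by (rule hurwitz_eqI) simp
lemma inner_deriv_zero [simp]: "inner_deriv 0 = 0"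
  by (rule hurwitz_eqI) simp
lemma inner_deriv_mult:
  "inner_deriv (F * G) = inner_deriv F * G + F * inner_deriv (G :: 'a::comm_ring_1 hurwitz2)"
  by (rule hurwitz_eqI)
    (simp add: hcoeff_mult hderiv_mult mult.assoc distrib_left sum.distrib)

lemma inner_deriv_hderiv: "inner_deriv (hderiv F) = hderiv (inner_deriv F)"
  by (rule hurwitz_eqI) simp

lemma inner_deriv_hmonom [simp]: "inner_deriv (hmonom i :: 'a::comm_ring_1 hurwitz2) = 0"
proof -
  have "hderiv (1 :: 'a hurwitz) = 0" by (rule hurwitz_eqI) auto
  then show ?thesis by (intro hurwitz_eqI) simp
qed

lemma inner_deriv_hconst [simp]: "inner_deriv (hconst F) = hconst (hderiv F)"
  by (rule hurwitz_eqI) simp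

section \<open>Binomial coefficients and falling factorials in characteristic p\<close>

text \<open>\<open>p ^ m\<close> divides \<open>k * (p ^ m choose k)\<close>; were the binomial
  prime to \<open>p\<close>, it would divide \<open>k\<close>.\<close>

lemma prime_dvd_choose_power:
  assumes "prime p" "0 < k" "k < p ^ m"
  shows "p dvd (p ^ m choose k)"
proof (rule ccontr)
  assume "\<not> p dvd (p ^ m choose k)"
  then have "coprime (p ^ m) (p ^ m choose k)"
    using assms(1) by (simp add: prime_imp_coprime)
  moreover have "p ^ m dvd k * (p ^ m choose k)"
    using times_binomial_minus1_eq[OF assms(2), of "p ^ m"] by simp
  ultimately have "p ^ m dvd k"
    by (simp add: coprime_dvd_mult_left_iff)
  then show False using assms by (auto dest: dvd_imp_le)
qed

locale prime_char =
  fixes p :: nat and ty :: "'a::field itself"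
  assumes CHAR: "CHAR('a) = p" and prime_p: "prime p"
begin

lemma of_nat_eq_0_iff: "(of_nat k :: 'a) = 0 \<longleftrightarrow> p dvd k"
  using of_nat_eq_0_iff_char_dvd[of k, where 'a = 'a] CHAR by simp

lemma of_nat_p [simp]: "(of_nat p :: 'a) = 0"
  by (simp add: of_nat_eq_0_iff)

text \<open>Compares coefficients in \<open>(1 + T)^(p^m + r) = (1 + T^(p^m)) (1 + T)^r\<close>: in
  the Vandermonde sum only the two outer binomials of \<open>p ^ m\<close> survive.\<close>

lemma choose_power_add:
  "(of_nat ((p ^ m + r) choose l) :: 'a)
    = of_nat (r choose l) + (if p ^ m \<le> l then of_nat (r choose (l - p ^ m)) else 0)"
proof -
  have pos: "0 < p ^ m" using prime_p by (simp add: prime_gt_0_nat)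
  have "(of_nat ((p ^ m + r) choose l) :: 'a)
      = (\<Sum>k\<le>l. of_nat (p ^ m choose k) * of_nat (r choose (l - k)))"
    by (simp flip: vandermonde)
  also have "\<dots> = (\<Sum>k\<in>{0, p ^ m} \<inter> {..l}. of_nat (p ^ m choose k) * of_nat (r choose (l - k)))"
  proof (rule sum.mono_neutral_right)
    show "\<forall>k\<in>{..l} - {0, p ^ m} \<inter> {..l}.
        (of_nat (p ^ m choose k) * of_nat (r choose (l - k)) :: 'a) = 0"
    proof
      fix k assume "k \<in> {..l} - {0, p ^ m} \<inter> {..l}"
      then have "p dvd (p ^ m choose k)"
        using prime_dvd_choose_power[OF prime_p, of k m] by (cases "k < p ^ m") (auto simp: binomial_eq_0)
      then show "(of_nat (p ^ m choose k) * of_nat (r choose (l - k)) :: 'a) = 0"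
        by (simp add: of_nat_eq_0_iff)
    qed
  qed auto
  also have "{0, p ^ m} \<inter> {..l} = (if p ^ m \<le> l then {0, p ^ m} else {0})"
    using pos by auto
  finally show ?thesis using pos by simp
qed

text \<open>Lucas's congruence with only the lowest \<open>m\<close> digits split off. Each step
  peels one \<open>p ^ m\<close> off the upper entry and becomes Pascal's rule for
  \<open>i choose j\<close>.\<close>

lemma lucas:
  assumes "r < p ^ m" "l < p ^ m"
  shows "(of_nat ((i * p ^ m + r) choose (j * p ^ m + l)) :: 'a)
    = of_nat (i choose j) * of_nat (r choose l)"
proof (induction i arbitrary: j)
  case 0
  then show ?case
    using assms by (cases j) (auto simp: binomial_eq_0)
next
  case (Suc i)
  have eq: "Suc i * p ^ m + r = p ^ m + (i * p ^ m + r)" by simp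
  show ?case
  proof (cases j)
    case 0
    then show ?thesis
      using assms Suc[of 0] unfolding eq choose_power_add by simp
  next
    case (Suc j')
    then show ?thesis
      using Suc.IH[of j] Suc.IH[of j'] unfolding eq choose_power_add
      by (simp add: distrib_right add.commute)
  qed
qed

text \<open>Since \<open>i + k - p ^ m < i < p ^ m\<close>, both terms of
  \<open>choose_power_add\<close> vanish. This keeps the truncated algebra closed under products and
  kills most brackets.\<close>

lemma choose_carry:
  assumes "i < p ^ m" "k < p ^ m" "p ^ m \<le> i + k"
  shows "(of_nat ((i + k) choose i) :: 'a) = 0"
  using choose_power_add[of m "i + k - p ^ m" i] assms by (simp add: binomial_eq_0)

lemma pow_p_add: "(x + y :: 'a) ^ p = x ^ p + y ^ p"
  using CHAR prime_p by (intro freshmans_dream) auto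

lemma pow_p_of_nat: "(of_nat k :: 'a) ^ p = of_nat k"
  by (induction k) (use prime_p in \<open>auto simp: pow_p_add prime_gt_0_nat\<close>)

lemma pow_p_uminus: "(- x :: 'a) ^ p = - (x ^ p)"
  using pow_p_add[of x "- x"] prime_p
  by (simp add: prime_gt_0_nat power_0_left eq_neg_iff_add_eq_0 add.commute split: if_splits)

lemma pow_p_of_int: "(of_int k :: 'a) ^ p = of_int k"
  by (cases k rule: int_cases2) (simp_all add: pow_p_of_nat pow_p_uminus)

end

text \<open>This is \<open>i!\<close> times the binomial coefficient, without denominators, so that
  \<open>i = p\<close> makes sense as well.\<close>

definition falling :: "'a::comm_ring_1 \<Rightarrow> nat \<Rightarrow> 'a" where
  "falling \<alpha> i = (\<Prod>m<i. \<alpha> - of_nat m)"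

lemma falling_0 [simp]: "falling \<alpha> 0 = 1"
  by (simp add: falling_def)

lemma falling_Suc: "falling \<alpha> (Suc i) = falling \<alpha> i * (\<alpha> - of_nat i)"
  by (simp add: falling_def)

lemma falling_Suc': "falling \<alpha> (Suc i) = \<alpha> * falling (\<alpha> - 1) i"
  unfolding falling_def prod.lessThan_Suc_shift by (simp add: algebra_simps)

text \<open>Chu-Vandermonde. The series with coefficients \<open>falling \<alpha>\<close> represents
  the power of \<open>1 + x\<close> with exponent \<open>\<alpha>\<close>; the induction is the
  Leibniz rule, with the factor \<open>\<alpha> + \<beta> - k\<close> split as
  \<open>(\<alpha> - i) + (\<beta> - (k - i))\<close>.\<close>

lemma falling_vandermonde:
  "(\<Sum>i\<le>k. of_nat (k choose i) * falling \<alpha> i * falling \<beta> (k - i)) = falling (\<alpha> + \<beta>) k"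
proof -
  let ?F = "\<lambda>\<alpha>. Hurwitz (falling \<alpha>)"
  have "hcoeff (?F \<alpha> * ?F \<beta>) k = falling (\<alpha> + \<beta>) k"
  proof (induction k)
    case 0
    then show ?case by (simp add: hcoeff_mult_0)
  next
    case (Suc k)
    have "hcoeff (?F \<alpha> * ?F \<beta>) (Suc k) = hcoeff (hderiv (?F \<alpha> * ?F \<beta>)) k" by simp
    also have "\<dots> = (\<Sum>i\<le>k. of_nat (k choose i) * falling \<alpha> i * falling \<beta> (k - i)
        * (\<alpha> + \<beta> - of_nat k))"
      unfolding hderiv_mult hcoeff_add hcoeff_mult sum.distrib[symmetric]
    proof (rule sum.cong)
      fix i assume "i \<in> {..k}"
      then have eq: "\<alpha> + \<beta> - of_nat k = (\<alpha> - of_nat i) + (\<beta> - of_nat (k - i))"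
        by (simp add: of_nat_diff)
      then show "of_nat (k choose i) * hcoeff (hderiv (?F \<alpha>)) i * hcoeff (?F \<beta>) (k - i)
            + of_nat (k choose i) * hcoeff (?F \<alpha>) i * hcoeff (hderiv (?F \<beta>)) (k - i)
          = of_nat (k choose i) * falling \<alpha> i * falling \<beta> (k - i) * (\<alpha> + \<beta> - of_nat k)"
        by (simp only: falling_Suc hcoeff_hderiv hcoeff_Hurwitz eq)
          (simp only: algebra_simps)
    qed simp
    also have "\<dots> = falling (\<alpha> + \<beta>) k * (\<alpha> + \<beta> - of_nat k)"
      using Suc by (simp add: hcoeff_mult flip: sum_distrib_right)
    finally show ?case by (simp add: falling_Suc)
  qed
  then show ?thesis by (simp add: hcoeff_mult)
qed

text \<open>Both sides are monic of degree \<open>p\<close> in \<open>\<alpha>\<close> and vanish on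
  the \<open>p\<close> elements of the prime field; their difference has lower degree and too many
  roots.\<close>

lemma (in prime_char) falling_p: "falling (\<alpha> :: 'a) p = \<alpha> ^ p - \<alpha>"
proof -
  have p1: "p > 1" by (rule prime_gt_1_nat[OF prime_p])
  define f :: "'a poly" where "f = (\<Prod>m<p. [:- of_nat m, 1:])"
  define g :: "'a poly" where "g = monom 1 p - monom 1 1"
  have deg_f: "degree f = p"
    unfolding f_def by (subst degree_prod_eq_sum_degree) auto
  have "lead_coeff f = 1"
    unfolding f_def by (simp add: lead_coeff_prod)
  then have cf: "coeff f p = 1" using deg_f by simp
  have deg_g: "degree g \<le> p"
    unfolding g_def using p1 by (intro degree_diff_le) (auto intro: order.trans[OF degree_monom_le])
  have cg: "coeff g p = 1" using p1 by (simp add: g_def)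
  have "f = g"
  proof (rule ccontr)
    assume "f \<noteq> g"
    then have nz: "f - g \<noteq> 0" by simp
    have le: "degree (f - g) \<le> p" using deg_f deg_g by (intro degree_diff_le) auto
    have "degree (f - g) \<noteq> p"
    proof
      assume "degree (f - g) = p"
      moreover have "coeff (f - g) p = 0" using cf cg by simp
      ultimately show False using nz leading_coeff_0_iff by metis
    qed
    with le have deg: "degree (f - g) < p" by simp
    have inj: "inj_on (of_nat :: nat \<Rightarrow> 'a) {..<p}"
    proof (rule linorder_inj_onI)
      fix i j :: nat assume ij: "i < j" "i \<in> {..<p}" "j \<in> {..<p}"
      then have "\<not> p dvd (j - i)" by (auto dest: dvd_imp_le)
      then have "(of_nat (j - i) :: 'a) \<noteq> 0" by (simp add: of_nat_eq_0_iff)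
      then show "(of_nat i :: 'a) \<noteq> of_nat j" using ij by (simp add: of_nat_diff)
    qed auto
    have "of_nat ` {..<p} \<subseteq> {x. poly (f - g) x = 0}"
      by (auto simp: f_def g_def poly_prod poly_monom pow_p_of_nat intro!: prod_zero)
    then have "card (of_nat ` {..<p} :: 'a set) \<le> card {x. poly (f - g) x = 0}"
      by (intro card_mono poly_roots_finite nz)
    also have "\<dots> \<le> degree (f - g)" by (rule card_poly_roots_bound[OF nz])
    finally show False using deg inj by (simp add: card_image)
  qed
  then have "poly f \<alpha> = poly g \<alpha>" by simp
  then show ?thesis by (simp add: f_def g_def poly_prod poly_monom falling_def)
qed

text \<open>Below \<open>p\<close> the factorial is a unit, so the division in
  \<open>field_binomial\<close> can be undone.\<close>

lemma (in prime_char) field_binomial_fact: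
  "i < p \<Longrightarrow> field_binomial (\<alpha> :: 'a) i * of_nat (fact i) = falling \<alpha> i"
  using prime_p by (simp add: field_binomial_def falling_def of_nat_eq_0_iff prime_dvd_fact_iff
      del: of_nat_fact)

section \<open>The divided power algebra inside the Hurwitz series\<close>

definition hscalar :: "'a::comm_ring_1 \<Rightarrow> 'a hurwitz2" where
  "hscalar c = hconst (hconst c)"

abbreviation hX :: "nat \<Rightarrow> 'a::comm_ring_1 hurwitz2" where "hX i \<equiv> hmonom i"

definition hY :: "nat \<Rightarrow> 'a::comm_ring_1 hurwitz2" where "hY j = hconst (hmonom j)"

lemma hscalar_mult: "hscalar (a * b) = hscalar a * hscalar b"
  and hscalar_diff: "hscalar (a - b) = hscalar a - hscalar b"
  and hscalar_uminus: "hscalar (- a) = - hscalar a"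
  and hscalar_0 [simp]: "hscalar 0 = 0"
  and hscalar_1 [simp]: "hscalar 1 = 1"
  and hscalar_sum: "hscalar (\<Sum>i\<in>K. f i) = (\<Sum>i\<in>K. hscalar (f i))"
  by (simp_all add: hscalar_def hconst_mult hconst_diff hconst_uminus hconst_sum)

lemma of_nat_hscalar: "(of_nat k :: 'a::comm_ring_1 hurwitz2) = hscalar (of_nat k)"
  by (simp add: hscalar_def)

lemma hX_mult: "hX i * hX k = hscalar (of_nat (i + k choose i)) * hX (i + k)"
  by (simp add: hmonom_mult of_nat_hscalar)

lemma hY_mult: "hY j * hY l = hscalar (of_nat (j + l choose j)) * hY (j + l)"
  unfolding hY_def hconst_mult[symmetric] hmonom_mult by (simp add: hconst_mult hscalar_def)

lemma hY_0 [simp]: "hY 0 = 1"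
  by (simp add: hY_def)

lemma hderiv_hscalar_mult [simp]: "hderiv (hscalar c * F) = hscalar c * hderiv F"
  by (simp add: hderiv_mult hscalar_def)

lemma inner_deriv_hscalar_mult [simp]: "inner_deriv (hscalar c * F) = hscalar c * inner_deriv F"
  by (simp add: inner_deriv_mult hscalar_def)

lemma hderiv_hY_mult [simp]: "hderiv (F * hY j) = hderiv F * hY j"
  by (simp add: hderiv_mult hY_def)

lemma hderiv_hY [simp]: "hderiv (hY j) = 0"
  by (simp add: hY_def)

lemma inner_deriv_hY: "inner_deriv (hY j) = (if j = 0 then 0 else hY (j - 1))"
  by (simp add: hY_def hderiv_hmonom)

section \<open>Functions on the box as series\<close>

definition series :: "(nat \<times> nat \<Rightarrow> 'a) \<Rightarrow> 'a hurwitz2" where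
  "series f = Hurwitz (\<lambda>i. Hurwitz (\<lambda>j. f (i, j)))"

lemma hcoeff_series [simp]: "hcoeff (hcoeff (series f) i) j = f (i, j)"
  by (simp add: series_def)

lemma hurwitz2_eqI: "(\<And>i j. hcoeff (hcoeff F i) j = hcoeff (hcoeff G i) j) \<Longrightarrow> F = G"
  by (intro hurwitz_eqI)

lemma series_eq_iff: "series f = series g \<longleftrightarrow> f = g"
  by (metis hcoeff_series ext surj_pair)

lemma series_eq_0_iff: "series f = 0 \<longleftrightarrow> f = 0"
proof -
  have "series (0 :: nat \<times> nat \<Rightarrow> 'a) = 0" by (rule hurwitz2_eqI) simp
  then show ?thesis by (metis series_eq_iff)
qed

lemma series_0 [simp]: "series 0 = 0"
  by (simp add: series_eq_0_iff)

lemma series_add: "series (f + g) = series f + series g"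
  and series_diff: "series (f - g) = series f - series g"
  by (rule hurwitz2_eqI; simp)+

lemma series_sum: "series (\<Sum>i\<in>K. f i) = (\<Sum>i\<in>K. series (f i))"
  by (induction K rule: infinite_finite_induct) (simp_all only: sum.infinite sum.empty sum.insert
      series_add series_0 not_False_eq_True)

lemma series_scale: "series (fun_scale c f) = hscalar c * series (f :: nat \<times> nat \<Rightarrow> 'a::field)"
  by (rule hurwitz2_eqI) (simp add: fun_scale_def hscalar_def)

lemma hcoeff_hX_hY: "hcoeff (hcoeff (hX i * hY j) k) l = (if (k, l) = (i, j) then 1 else 0)"
  by (simp add: hY_def mult.commute[of "hX i"])

lemma series_dp_monom:
  "series (dp_monom p n1 n2 i j :: nat \<times> nat \<Rightarrow> 'a::field) =
    (if 0 \<le> i \<and> i < int (p ^ n1) \<and> 0 \<le> j \<and> j < int (p ^ n2) then hX (nat i) * hY (nat j) else 0)"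
  by (rule hurwitz2_eqI) (simp add: dp_monom_def hcoeff_hX_hY del: of_nat_power)

lemma fun_scale_vector_space: "vector_space (fun_scale :: 'a::field \<Rightarrow> ('x \<Rightarrow> 'a) \<Rightarrow> 'x \<Rightarrow> 'a)"
  by unfold_locales (auto simp: fun_scale_def algebra_simps fun_eq_iff)

interpretation fs: vector_space "fun_scale :: 'a::field \<Rightarrow> ('x \<Rightarrow> 'a) \<Rightarrow> 'x \<Rightarrow> 'a"
  by (rule fun_scale_vector_space)

lemma finite_dp_box [simp]: "finite (dp_box p n1 n2)"
  by (simp add: dp_box_def)

lemma subspace_dp_carrier: "fs.subspace (dp_carrier p n1 n2)"
  by (auto simp: fs.subspace_def dp_carrier_def fun_scale_def)

lemma dp_monom_mem [simp]: "dp_monom p n1 n2 i j \<in> dp_carrier p n1 n2"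
  by (auto simp: dp_monom_def dp_carrier_def dp_box_def simp del: of_nat_power)

lemma series_carrier:
  assumes "f \<in> dp_carrier p n1 n2"
  shows "series f = (\<Sum>u\<in>dp_box p n1 n2. hscalar (f u) * (hX (fst u) * hY (snd u)))"
proof (rule hurwitz2_eqI)
  fix i j
  have "hcoeff (hcoeff (hscalar c * (hX (fst u) * hY (snd u))) i) j = (if (i, j) = u then c else 0)"
    for c :: 'a and u
    by (cases u) (simp add: hscalar_def hcoeff_hX_hY)
  then show "hcoeff (hcoeff (series f) i) j
      = hcoeff (hcoeff (\<Sum>u\<in>dp_box p n1 n2. hscalar (f u) * (hX (fst u) * hY (snd u))) i) j"
    using assms by (auto simp: dp_carrier_def)
qed

text \<open>Both sides are bilinear, so agreement on pairs of box monomials suffices. It serves for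
  the product and for the Lie bracket alike.\<close>

lemma series_dp_extend:
  assumes "f \<in> dp_carrier p n1 n2" "g \<in> dp_carrier p n1 n2"
    and "\<And>F G F' G'. B (F + F') G = B F G + B F' G" 
    and "\<And>F G F' G'. B F (G + G') = B F G + B F G'"
    and "\<And>c F G. B (hscalar c * F) G = hscalar c * B F G"
    and "\<And>c F G. B F (hscalar c * G) = hscalar c * B F G"
    and "\<And>u v. u \<in> dp_box p n1 n2 \<Longrightarrow> v \<in> dp_box p n1 n2 \<Longrightarrow>
      series (b u v) = B (hX (fst u) * hY (snd u)) (hX (fst v) * hY (snd v))"
  shows "series (dp_extend p n1 n2 b f g) = B (series f) (series (g :: nat \<times> nat \<Rightarrow> 'a::field))"
proof -
  have zero: "B 0 G = 0" "B G 0 = 0" for G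
    using assms(5)[of 0 0 G] assms(6)[of G 0 0] by simp_all
  have suml: "B (\<Sum>u\<in>K. F u) G = (\<Sum>u\<in>K. B (F u) G)" for K F G
    by (induction K rule: infinite_finite_induct) (simp_all add: zero assms(3))
  have sumr: "B G (\<Sum>u\<in>K. F u) = (\<Sum>u\<in>K. B G (F u))" for K F G
    by (induction K rule: infinite_finite_induct) (simp_all add: zero assms(4))
  show ?thesis
    unfolding series_carrier[OF assms(1)] series_carrier[OF assms(2)] dp_extend_def
    by (simp only: suml, simp add: sumr series_sum series_scale assms(5-7) hscalar_mult mult.assoc
        cong: sum.cong, simp add: mult.left_commute)
qed

lemma dp_extend_mem:
  assumes "\<And>u v. b u v \<in> dp_carrier p n1 n2"
  shows "dp_extend p n1 n2 b f g \<in> dp_carrier p n1 n2"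
  unfolding dp_extend_def using assms
  by (intro fs.subspace_sum[OF subspace_dp_carrier] fs.subspace_scale[OF subspace_dp_carrier])

lemma dp_mult_mem [simp]: "dp_mult p n1 n2 f g \<in> dp_carrier p n1 n2"
  unfolding dp_mult_def
  by (rule dp_extend_mem) (auto intro: fs.subspace_scale[OF subspace_dp_carrier])

lemma AZ_monom_bracket_mem [simp]: "AZ_monom_bracket p n1 n2 u v \<in> dp_carrier p n1 n2"
  by (cases u; cases v)
    (auto simp: AZ_monom_bracket_def Let_def intro: fs.subspace_diff[OF subspace_dp_carrier])

lemma AZ_bracket_mem: "AZ_bracket p n1 n2 f g \<in> dp_carrier p n1 n2"
  unfolding AZ_bracket_def by (rule dp_extend_mem) auto

context prime_char
begin

lemma hX_mult_eq_0:
  assumes "i < p ^ m" "k < p ^ m" "p ^ m \<le> i + k"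
  shows "hX i * hX k = (0 :: 'a hurwitz2)"
  by (simp add: hX_mult choose_carry[OF assms])

lemma hY_mult_eq_0:
  assumes "i < p ^ m" "k < p ^ m" "p ^ m \<le> i + k"
  shows "hY i * hY k = (0 :: 'a hurwitz2)"
  by (simp add: hY_mult choose_carry[OF assms])

text \<open>A product leaving the box is 0 by convention in the divided power algebra and 0 among
  the series because of a carry.\<close>

lemma series_dp_mult:
  assumes "f \<in> dp_carrier p n1 n2" "g \<in> dp_carrier p n1 n2"
  shows "series (dp_mult p n1 n2 f g) = series f * series (g :: nat \<times> nat \<Rightarrow> 'a)"
  unfolding dp_mult_def
proof (rule series_dp_extend[OF assms])
  fix u v assume uv: "u \<in> dp_box p n1 n2" "v \<in> dp_box p n1 n2"
  obtain i j k l where ij: "u = (i, j)" "v = (k, l)" by (metis surj_pair)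
  have bd: "i < p ^ n1" "j < p ^ n2" "k < p ^ n1" "l < p ^ n2"
    using uv ij by (auto simp: dp_box_def)
  have prod: "hX i * hY j * (hX k * hY l) = (hX i * hX k) * (hY j * hY l :: 'a hurwitz2)"
    by (simp add: ac_simps)
  have "series (fun_scale (of_nat ((i + k choose i) * (j + l choose j)))
       (dp_monom p n1 n2 (int (i + k)) (int (j + l))) :: nat \<times> nat \<Rightarrow> 'a)
      = (hX i * hX k) * (hY j * hY l)"
  proof (cases "i + k < p ^ n1 \<and> j + l < p ^ n2")
    case True
    then show ?thesis
      by (simp add: series_scale series_dp_monom hX_mult hY_mult hscalar_mult nat_add_distrib
          mult_ac del: of_nat_power of_nat_add)
  next
    case False
    then have "hX i * hX k = (0 :: 'a hurwitz2) \<or> hY j * hY l = (0 :: 'a hurwitz2)"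
      using bd hX_mult_eq_0[of i n1 k] hY_mult_eq_0[of j n2 l] by auto
    then show ?thesis using False
      by (auto simp: series_scale series_dp_monom simp del: of_nat_power of_nat_add)
  qed
  then show "series ((case u of (i, j) \<Rightarrow> \<lambda>(k, l). fun_scale (of_nat ((i + k choose i) * (j + l choose j)))
       (dp_monom p n1 n2 (int (i + k)) (int (j + l)))) v :: nat \<times> nat \<Rightarrow> 'a)
      = hX (fst u) * hY (snd u) * (hX (fst v) * hY (snd v))"
    unfolding ij by (simp add: prod)
qed (simp_all add: algebra_simps)

end

text \<open>For \<open>w\<close> the top power of \<open>x\<close> the additional terms \<open>w (\<partial>\<^sub>yF G - F \<partial>\<^sub>yG)\<close> of \<open>hbracket\<close> vanish on
  monomials of positive total degree in \<open>x\<close>, so that \<open>hbracket\<close> covers both cases of the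
  definition.\<close>

definition twisted_deriv :: "'a::comm_ring_1 hurwitz2 \<Rightarrow> 'a hurwitz2 \<Rightarrow> 'a hurwitz2" where
  "twisted_deriv w F = hderiv F + w * F"

definition hbracket :: "'a::comm_ring_1 hurwitz2 \<Rightarrow> 'a hurwitz2 \<Rightarrow> 'a hurwitz2 \<Rightarrow> 'a hurwitz2" where
  "hbracket w F G = inner_deriv F * twisted_deriv w G - twisted_deriv w F * inner_deriv G"

lemma hbracket_add_left: "hbracket w (F + F') G = hbracket w F G + hbracket w F' G"
  and hbracket_add_right: "hbracket w F (G + G') = hbracket w F G + hbracket w F G'"
  by (simp_all add: hbracket_def twisted_deriv_def algebra_simps)

lemma hbracket_scale_left: "hbracket w (hscalar c * F) G = hscalar c * hbracket w F G"
  and hbracket_scale_right: "hbracket w F (hscalar c * G) = hscalar c * hbracket w F G"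
  by (simp add: hbracket_def twisted_deriv_def, simp add: algebra_simps)+

text \<open>Formally, if \<open>w\<close> is the logarithmic derivative of a function
  \<open>u\<close> of \<open>x\<close> alone, multiplication by \<open>u\<close> turns the bracket
  into \<open>1/u\<close> times the Poisson bracket, and in two variables every multiple of a
  Poisson bracket satisfies Jacobi. The identity is checked here by expansion; the hypothesis makes
  the twisted derivative commute with the \<open>y\<close>-derivative.\<close>

lemma hbracket_jacobi:
  assumes "inner_deriv w = 0"
  shows "hbracket w (hbracket w F G) K + hbracket w (hbracket w G K) F
    + hbracket w (hbracket w K F) G = 0"
  unfolding hbracket_def twisted_deriv_def
  by (simp add: hderiv_mult inner_deriv_mult inner_deriv_hderiv assms) (simp add: algebra_simps)

lemma (in prime_char) series_AZ_bracket:
  assumes "f \<in> dp_carrier p n1 n2" "g \<in> dp_carrier p n1 n2" "n1 > 0"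
  shows "series (AZ_bracket p n1 n2 f g)
    = hbracket (hX (p ^ n1 - 1)) (series f) (series (g :: nat \<times> nat \<Rightarrow> 'a))"
  unfolding AZ_bracket_def
proof (rule series_dp_extend[OF assms(1,2)])
  fix u v assume uv: "u \<in> dp_box p n1 n2" "v \<in> dp_box p n1 n2"
  obtain i j k l where ij: "u = (i, j)" "v = (k, l)" by (metis surj_pair)
  have bd: "i < p ^ n1" "j < p ^ n2" "k < p ^ n1" "l < p ^ n2"
    using uv ij by (auto simp: dp_box_def)
  define P where "P = p ^ n1"
  have P: "0 < P" using prime_p by (simp add: P_def prime_gt_0_nat)
  have ibd: "int i < int (p ^ n1)" "int j < int (p ^ n2)" "int k < int (p ^ n1)"
     "int l < int (p ^ n2)" "int i - 1 < int (p ^ n1)" "int j - 1 < int (p ^ n2)"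
     "int k - 1 < int (p ^ n1)" "int l - 1 < int (p ^ n2)"
     "int (p ^ n1) - 1 < int (p ^ n1)" "0 \<le> int (p ^ n1) - 1" "0 < int (p ^ n2)"
    using bd P prime_gt_0_nat[OF prime_p] by (auto simp: P_def simp del: of_nat_power)
  let ?m = "dp_monom p n1 n2 :: int \<Rightarrow> int \<Rightarrow> nat \<times> nat \<Rightarrow> 'a"
  let ?w = "hX (p ^ n1 - 1) :: 'a hurwitz2"
  have mX: "series (?m (int i - 1) (int j)) = hderiv (hX i * hY j)"
    "series (?m (int k - 1) (int l)) = hderiv (hX k * hY l)"
    and mY: "series (?m (int i) (int j - 1)) = inner_deriv (hX i * hY j)"
    "series (?m (int k) (int l - 1)) = inner_deriv (hX k * hY l)"
    and m: "series (?m (int i) (int j)) = hX i * hY j" "series (?m (int k) (int l)) = hX k * hY l"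
    using ibd by (auto simp: series_dp_monom hderiv_hmonom inner_deriv_mult inner_deriv_hY
        nat_diff_distrib simp del: of_nat_power)
  have mw: "series (?m (int (p ^ n1) - 1) 0) = ?w"
    using ibd by (auto simp: series_dp_monom nat_diff_distrib simp del: of_nat_power)
  \<comment> \<open>One of \<open>i\<close>, \<open>k\<close> is positive, and its power of
    \<open>x\<close> times the top power carries.\<close>
  have w0: "?w * (hX i * F) * (hX k * G) = 0" if "i + k > 0" for F G
  proof -
    have "?w * hX i = 0 \<or> ?w * hX k = 0"
      using that bd P hX_mult_eq_0[of "P - 1" n1 i] hX_mult_eq_0[of "P - 1" n1 k]
      by (cases "i = 0") (auto simp: P_def)
    moreover have "?w * (hX i * F) * (hX k * G) = (?w * hX i) * F * (hX k * G)"
      "?w * (hX i * F) * (hX k * G) = (?w * hX k) * (hX i * F) * G" by (simp_all add: ac_simps)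
    ultimately show ?thesis by (metis mult_zero_left)
  qed
  have "series (AZ_monom_bracket p n1 n2 (int i, int j) (int k, int l) :: nat \<times> nat \<Rightarrow> 'a)
      = hbracket ?w (hX i * hY j) (hX k * hY l)"
  proof (cases "i + k > 0")
    case True
    have w1: "inner_deriv (hX i * hY j) * (?w * (hX k * hY l)) = 0"
      "?w * (hX i * hY j) * inner_deriv (hX k * hY l) = 0"
      using w0[OF True, of "inner_deriv (hY j)" "hY l"] w0[OF True, of "hY j" "inner_deriv (hY l)"]
      by (simp_all add: inner_deriv_mult ac_simps)
    have "0 < int i + int k" using True by linarith
    then show ?thesis
      unfolding AZ_monom_bracket_def Let_def
      by (simp add: series_diff series_dp_mult mX mY hbracket_def twisted_deriv_def
          distrib_left distrib_right w1 del: One_nat_def)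
  next
    case False
    then have ik: "i = 0" "k = 0" by auto
    show ?thesis
      using mY m unfolding ik AZ_monom_bracket_def Let_def
      by (simp add: series_diff series_dp_mult mw hbracket_def twisted_deriv_def
          hderiv_hmonom fs.subspace_diff[OF subspace_dp_carrier] del: of_nat_power One_nat_def)
        (simp add: algebra_simps)
  qed
  then show "series ((case u of (i, j) \<Rightarrow> \<lambda>(k, l). AZ_monom_bracket p n1 n2 (int i, int j) (int k, int l)) v
        :: nat \<times> nat \<Rightarrow> 'a)
      = hbracket ?w (hX (fst u) * hY (snd u)) (hX (fst v) * hY (snd v))"
    by (simp add: ij)
qed (simp_all only: hbracket_add_left hbracket_add_right hbracket_scale_left hbracket_scale_right)

text \<open>\<open>series\<close> is injective and turns the bracket into \<open>hbracket\<close>,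
  so the axioms are inherited.\<close>

lemma (in prime_char) lie_algebra_AZ:
  assumes "n1 > 0"
  shows "lie_algebra (fun_scale :: 'a \<Rightarrow> _) (dp_carrier p n1 n2) (AZ_bracket p n1 n2)"
proof -
  note sa = fs.subspace_add[OF subspace_dp_carrier] fs.subspace_scale[OF subspace_dp_carrier]
  note sb = series_AZ_bracket[OF _ _ assms]
  show ?thesis
  proof unfold_locales
    fix x y z :: "nat \<times> nat \<Rightarrow> 'a" and c :: 'a
    assume x: "x \<in> dp_carrier p n1 n2"
    show "AZ_bracket p n1 n2 x x = 0"
      using x by (simp add: series_eq_0_iff[symmetric] sb) (simp add: hbracket_def mult.commute)
    assume y: "y \<in> dp_carrier p n1 n2"
    show "AZ_bracket p n1 n2 x y \<in> dp_carrier p n1 n2" by (rule AZ_bracket_mem)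
    show "AZ_bracket p n1 n2 (fun_scale c x) y = fun_scale c (AZ_bracket p n1 n2 x y)"
      "AZ_bracket p n1 n2 x (fun_scale c y) = fun_scale c (AZ_bracket p n1 n2 x y)"
      using x y by (simp_all add: series_eq_iff[symmetric] sa sb series_scale
          hbracket_scale_left hbracket_scale_right)
    assume z: "z \<in> dp_carrier p n1 n2"
    show "AZ_bracket p n1 n2 (x + y) z = AZ_bracket p n1 n2 x z + AZ_bracket p n1 n2 y z"
      "AZ_bracket p n1 n2 x (y + z) = AZ_bracket p n1 n2 x y + AZ_bracket p n1 n2 x z"
      using x y z by (simp_all add: series_eq_iff[symmetric] sa sb series_add
          hbracket_add_left hbracket_add_right)
    show "AZ_bracket p n1 n2 (AZ_bracket p n1 n2 x y) z + AZ_bracket p n1 n2 (AZ_bracket p n1 n2 y z) x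
        + AZ_bracket p n1 n2 (AZ_bracket p n1 n2 z x) y = 0"
      using x y z by (simp add: series_eq_0_iff[symmetric] series_add sb AZ_bracket_mem hbracket_jacobi)
  qed (rule subspace_dp_carrier)
qed

lemma falling_0_left: "falling 0 i = (if i = 0 then 1 else 0)"
  by (cases i) (simp_all add: falling_Suc')

section \<open>Structure constants\<close>

locale albert_zassenhaus =
  fixes \<sigma> \<pi> :: "'a::field" and p n s :: nat
  assumes char: "CHAR('a) = p" and odd_p: "odd p"
    and n_pos: "n > 0" and s_pos: "s > 0"
    and param: "(\<pi> ^ p - \<pi>) * \<sigma> ^ p = 1"
begin

sublocale prime_char p "TYPE('a)"
proof
  \<comment> \<open>Oddness excludes characteristic 0.\<close>
  have "p > 0" using odd_p by (auto intro: Nat.gr0I)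
  then show "prime p" using prime_CHAR_semidom[where 'a = 'a] char by simp
qed (rule char)

lemma p_gt_2: "p > 2"
  using prime_p odd_p by (metis even_numeral nat_less_le prime_ge_2_nat)

lemma p_pos [simp]: "0 < p"
  using p_gt_2 by simp

declare n_pos [simp] s_pos [simp]

abbreviation q :: nat where "q \<equiv> p ^ n"

lemma ps_pos: "p ^ s > 0"
  using p_gt_2 by simp

lemma ps_less: "i < p ^ s \<Longrightarrow> i < p ^ (s + 1)"
  using power_increasing[of s "s + 1" p] p_gt_2 by linarith

lemma q_gt_2: "q > 2"
  using p_gt_2 n_pos self_le_power[of p n] by linarith

lemma of_nat_q [simp]: "(of_nat q :: 'a) = 0"
  using n_pos by (simp add: of_nat_eq_0_iff)

section \<open>Truncated powers and their derivatives\<close>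

definition E :: "'a \<Rightarrow> 'a hurwitz2" where
  "E \<alpha> = (\<Sum>i<p. hscalar (falling \<alpha> i * \<sigma> ^ i) * hX (i * p ^ s))"

definition W :: "'a \<Rightarrow> nat \<Rightarrow> nat \<Rightarrow> 'a hurwitz2" where
  "W \<alpha> i J = E \<alpha> * hX i * hY J"

definition xbar :: "'a hurwitz2" where
  "xbar = hX (p ^ (s + 1) - 1)"

text \<open>Lucas with low digits 0: the powers \<open>x^(i p^s)\<close> multiply like the divided
  powers of a single variable.\<close>

lemma hX_block_mult: "hX (i * p ^ s) * hX (j * p ^ s)
    = hscalar (of_nat (i + j choose i)) * (hX ((i + j) * p ^ s) :: 'a hurwitz2)"
  using lucas[of 0 s 0 "i + j" i] ps_pos by (simp add: hX_mult distrib_right)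

lemma hX_block_low: "k < p ^ s \<Longrightarrow> hX (i * p ^ s) * hX k = (hX (i * p ^ s + k) :: 'a hurwitz2)"
  using lucas[of k s 0 i i] ps_pos by (simp add: hX_mult)

lemma xbar_hX: "0 < i \<Longrightarrow> i < p ^ (s + 1) \<Longrightarrow> xbar * hX i = 0"
  unfolding xbar_def using p_gt_2 by (intro hX_mult_eq_0[of _ "s + 1"]) auto

text \<open>Truncation does no harm: terms with \<open>i + j \<ge> p\<close> carry and vanish, and
  \<open>falling_vandermonde\<close> sums the diagonals of the remaining triangle.\<close>

lemma E_mult: "E \<alpha> * E \<beta> = E (\<alpha> + \<beta>)"
proof -
  define t where "t i j = hscalar (falling \<alpha> i * falling \<beta> j * \<sigma> ^ (i + j) * of_nat (i + j choose i))
    * (hX ((i + j) * p ^ s) :: 'a hurwitz2)" for i j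
  have "E \<alpha> * E \<beta> = (\<Sum>i<p. \<Sum>j<p. t i j)"
    unfolding E_def sum_product
  proof (intro sum.cong refl)
    fix i j
    have "hscalar (falling \<alpha> i * \<sigma> ^ i) * hX (i * p ^ s) * (hscalar (falling \<beta> j * \<sigma> ^ j) * hX (j * p ^ s))
        = hscalar (falling \<alpha> i * \<sigma> ^ i) * hscalar (falling \<beta> j * \<sigma> ^ j)
          * (hX (i * p ^ s) * hX (j * p ^ s))" by (simp add: ac_simps)
    then show "hscalar (falling \<alpha> i * \<sigma> ^ i) * hX (i * p ^ s) * (hscalar (falling \<beta> j * \<sigma> ^ j) * hX (j * p ^ s))
        = t i j"
      by (simp add: t_def hX_block_mult hscalar_mult power_add ac_simps)
  qed
  also have "\<dots> = (\<Sum>(i, j)\<in>{..<p} \<times> {..<p}. t i j)"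
    by (simp add: sum.cartesian_product)
  also have "\<dots> = (\<Sum>(i, j)\<in>{(i, j). i + j < p}. t i j)"
  proof (rule sum.mono_neutral_right)
    show "\<forall>u\<in>{..<p} \<times> {..<p} - {(i, j). i + j < p}. (case u of (i, j) \<Rightarrow> t i j) = 0"
    proof (rule ballI, unfold split_paired_all, unfold prod.case)
      fix i j assume "(i, j) \<in> {..<p} \<times> {..<p} - {(i, j). i + j < p}"
      then have "(of_nat (i + j choose i) :: 'a) = 0"
        using choose_carry[of i 1 j] by simp
      then show "t i j = 0" by (simp add: t_def)
    qed
  qed auto
  also have "\<dots> = (\<Sum>k<p. \<Sum>i\<le>k. t i (k - i))"
    by (rule sum.triangle_reindex)
  also have "\<dots> = E (\<alpha> + \<beta>)"
    unfolding E_def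
  proof (intro sum.cong refl)
    fix k
    have "(\<Sum>i\<le>k. t i (k - i))
        = (\<Sum>i\<le>k. hscalar (of_nat (k choose i) * falling \<alpha> i * falling \<beta> (k - i) * \<sigma> ^ k) * hX (k * p ^ s))"
      by (intro sum.cong refl) (simp add: t_def ac_simps)
    also have "\<dots> = hscalar (falling (\<alpha> + \<beta>) k * \<sigma> ^ k) * hX (k * p ^ s)"
      unfolding falling_vandermonde[symmetric] sum_distrib_right hscalar_sum ..
    finally show "(\<Sum>i\<le>k. t i (k - i)) = hscalar (falling (\<alpha> + \<beta>) k * \<sigma> ^ k) * hX (k * p ^ s)" .
  qed
  finally show ?thesis .
qed

lemma E_0 [simp]: "E 0 = 1"
proof -
  have "E 0 = (\<Sum>i<p. if i = 0 then 1 else 0)"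
    unfolding E_def by (intro sum.cong) (auto simp: falling_0_left)
  then show ?thesis using p_gt_2 by simp
qed

lemma E_hX: "k < p ^ s \<Longrightarrow> E \<alpha> * hX k = (\<Sum>i<p. hscalar (falling \<alpha> i * \<sigma> ^ i) * hX (i * p ^ s + k))"
  by (simp add: E_def sum_distrib_right mult.assoc hX_block_low)

lemma xbar_E: "xbar * E \<alpha> = xbar"
proof -
  have "xbar * E \<alpha> = (\<Sum>i<p. if i = 0 then xbar else 0)"
    unfolding E_def sum_distrib_left
  proof (intro sum.cong refl)
    fix i assume "i \<in> {..<p}"
    then show "xbar * (hscalar (falling \<alpha> i * \<sigma> ^ i) * hX (i * p ^ s)) = (if i = 0 then xbar else 0)"
      using xbar_hX[of "i * p ^ s"] ps_pos by (simp add: mult.left_commute[of xbar])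
  qed
  then show ?thesis using p_gt_2 by simp
qed

text \<open>The full product \<open>E (\<alpha> - 1) * hX (p ^ s - 1)\<close> has one term more than
  the derivative. Its index is \<open>p - 1\<close>, its monomial is \<open>xbar\<close> and its
  coefficient contains \<open>falling \<alpha> p\<close>; subtracting it gives the defect.\<close>

lemma hderiv_E:
  "hderiv (E \<alpha>) = hscalar (\<alpha> * \<sigma>) * (E (\<alpha> - 1) * hX (p ^ s - 1)) - hscalar (falling \<alpha> p * \<sigma> ^ p) * xbar"
proof -
  obtain r where r: "p = Suc r" using p_gt_2 by (cases p) auto
  have step: "Suc i * p ^ s - 1 = i * p ^ s + (p ^ s - 1)" for i
    unfolding mult_Suc using ps_pos by linarith
  define t where "t i = hscalar (falling \<alpha> (Suc i) * \<sigma> ^ Suc i) * (hX (i * p ^ s + (p ^ s - 1)) :: 'a hurwitz2)" for i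
  have "hderiv (E \<alpha>) = (\<Sum>i<p. hscalar (falling \<alpha> i * \<sigma> ^ i) * hderiv (hX (i * p ^ s)))"
    by (simp add: E_def)
  also have "\<dots> = (\<Sum>i<r. hscalar (falling \<alpha> (Suc i) * \<sigma> ^ Suc i) * hX (Suc i * p ^ s - 1))"
    unfolding r sum.lessThan_Suc_shift using ps_pos r by (simp add: hderiv_hmonom)
  also have "\<dots> = (\<Sum>i<r. t i)"
    unfolding t_def step ..
  also have "\<dots> = (\<Sum>i<p. t i) - t r"
    unfolding r by simp
  also have "(\<Sum>i<p. t i) = hscalar (\<alpha> * \<sigma>) * (E (\<alpha> - 1) * hX (p ^ s - 1))"
    using ps_pos by (subst E_hX) (simp_all add: t_def sum_distrib_left falling_Suc' hscalar_mult ac_simps)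
  also have "t r = hscalar (falling \<alpha> p * \<sigma> ^ p) * xbar"
    unfolding t_def xbar_def r[symmetric] step[symmetric] by simp
  finally show ?thesis .
qed

lemma W_mult:
  "W \<alpha> i J * W \<beta> i' J'
    = hscalar (of_nat (i + i' choose i) * of_nat (J + J' choose J)) * W (\<alpha> + \<beta>) (i + i') (J + J')"
proof -
  have "W \<alpha> i J * W \<beta> i' J' = (E \<alpha> * E \<beta>) * (hX i * hX i') * (hY J * hY J')"
    unfolding W_def by (simp only: ac_simps)
  then show ?thesis
    unfolding E_mult hX_mult hY_mult hscalar_mult W_def by (simp only: ac_simps)
qed

lemma inner_deriv_E [simp]: "inner_deriv (E \<alpha>) = 0"
proof -
  have "inner_deriv (\<Sum>i\<in>K. f i) = (\<Sum>i\<in>K. inner_deriv (f i))" for K and f :: "nat \<Rightarrow> 'a hurwitz2"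
    by (induction K rule: infinite_finite_induct) auto
  then show ?thesis by (simp add: E_def)
qed

lemma inner_deriv_W: "inner_deriv (W \<alpha> i J) = (if J = 0 then 0 else W \<alpha> i (J - 1))"
  by (simp add: W_def inner_deriv_mult inner_deriv_hY)

text \<open>\<open>hX i\<close> annihilates both \<open>hX (p ^ s - 1)\<close> and
  \<open>xbar\<close>, hence the derivative of \<open>E \<alpha>\<close> and the twist;
  \<open>E \<alpha>\<close> behaves as a constant.\<close>

lemma twisted_deriv_W_pos:
  assumes "0 < i" "i < p ^ s"
  shows "twisted_deriv xbar (W \<alpha> i J) = W \<alpha> (i - 1) J"
proof -
  have "i < p ^ (s + 1)" using assms by (intro ps_less)
  then have 1: "xbar * hX i = 0" using assms by (intro xbar_hX)
  have 2: "hX (p ^ s - 1) * hX i = (0 :: 'a hurwitz2)"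
    using assms by (intro hX_mult_eq_0[of _ s]) auto
  have 3: "hderiv (E \<alpha>) * hX i = 0"
    by (simp add: hderiv_E left_diff_distrib mult.assoc 1 2 del: One_nat_def)
  have 4: "xbar * (E \<alpha> * hX i * hY J) = xbar * hX i * (E \<alpha> * hY J)" by (simp only: ac_simps)
  show ?thesis
    using assms unfolding twisted_deriv_def W_def 4 1
    by (simp add: hderiv_mult 3 hderiv_hmonom)
qed

text \<open>The exponent of \<open>e\<^bsub>j,k,a\<^esub>\<close>, with \<open>J = j + 1\<close>.\<close>

definition expo :: "nat \<Rightarrow> int \<Rightarrow> 'a" where
  "expo J a = (1 - of_nat J) * \<pi> + of_int a"

text \<open>In terms of \<open>j = J - 1\<close> the exponents simply add. \<open>J = J' = 0\<close>
  is excluded because the natural subtraction would truncate the sum of the \<open>j\<close>, which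
  is -2.\<close>

lemma expo_add: "J + J' > 0 \<Longrightarrow> expo J a + expo J' b = expo (J + J' - 1) (a + b)"
  by (cases J; cases J') (simp_all add: expo_def algebra_simps)

text \<open>Frobenius fixes the prime field, so only the multiple of \<open>\<pi>\<close>
  contributes, and \<open>param\<close> evaluates it.\<close>

lemma falling_expo: "falling (expo J a) p * \<sigma> ^ p = 1 - of_nat J"
proof -
  have "(1 - of_nat J :: 'a) = of_int (1 - int J)" by simp
  then have pow: "(1 - of_nat J :: 'a) ^ p = 1 - of_nat J" by (metis pow_p_of_int)
  have "falling (expo J a) p = (1 - of_nat J) * (\<pi> ^ p - \<pi>)"
    unfolding falling_p expo_def pow_p_add power_mult_distrib pow_p_of_int pow
    by (simp add: algebra_simps)
  then show ?thesis using param by (simp add: mult.assoc)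
qed

text \<open>The coefficient of \<open>xbar\<close> is \<open>J = (J - 1) + 1\<close>: the first
  summand is the truncation defect, the second the twist.\<close>

lemma twisted_deriv_W_0:
  "twisted_deriv xbar (W (expo J a) 0 J)
    = hscalar (expo J a * \<sigma>) * W (expo J (a - 1)) (p ^ s - 1) J + hscalar (of_nat J) * (xbar * hY J)"
proof -
  have e: "expo J a - 1 = expo J (a - 1)" by (simp add: expo_def)
  have "twisted_deriv xbar (W (expo J a) 0 J) = hderiv (E (expo J a)) * hY J + xbar * hY J"
    by (simp add: twisted_deriv_def W_def xbar_E flip: mult.assoc)
  then show ?thesis
    unfolding hderiv_E falling_expo e W_def hscalar_diff by (simp add: algebra_simps)
qed

text \<open>The image of \<open>e\<^bsub>j,k,a\<^esub>\<close> among the series, with \<open>i = k + 1\<close> and \<open>J = j + 1\<close>.\<close>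

definition G :: "nat \<Rightarrow> nat \<Rightarrow> int \<Rightarrow> 'a hurwitz2" where
  "G i J a = W (expo J a) i J"

abbreviation hbr :: "'a hurwitz2 \<Rightarrow> 'a hurwitz2 \<Rightarrow> 'a hurwitz2" where
  "hbr \<equiv> hbracket xbar"

section \<open>Brackets of the basis series\<close>

lemma W_xbar:
  assumes "0 < i" "i < p ^ s"
  shows "W \<alpha> i J * (xbar * F) = 0"
proof -
  have "xbar * hX i = 0" using assms by (intro xbar_hX ps_less)
  moreover have "W \<alpha> i J * (xbar * F) = (xbar * hX i) * (E \<alpha> * hY J * F)"
    unfolding W_def by (simp only: ac_simps)
  ultimately show ?thesis by simp
qed

lemma W_low_mult_top: "0 < i \<Longrightarrow> i < p ^ s \<Longrightarrow> W \<alpha> i J * W \<beta> (p ^ s - 1) J' = 0"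
  "0 < i \<Longrightarrow> i < p ^ s \<Longrightarrow> W \<beta> (p ^ s - 1) J' * W \<alpha> i J = 0"
  using choose_carry[of i s "p ^ s - 1"] choose_carry[of "p ^ s - 1" s i] by (simp_all add: W_mult)

text \<open>If \<open>i' = 0\<close> then \<open>i > 0\<close>, and \<open>hX i\<close> kills both
  terms of \<open>twisted_deriv_W_0\<close>.\<close>

lemma W_mult_deriv:
  assumes "i < p ^ s" "i' < p ^ s" "i + i' > 0"
  shows "W \<alpha> i J * twisted_deriv xbar (W (expo J' b) i' J')
    = (if i' = 0 then 0 else hscalar (of_nat (i + i' - 1 choose i) * of_nat (J + J' choose J))
        * W (\<alpha> + expo J' b) (i + i' - 1) (J + J'))"
proof (cases "i' = 0")
  case True
  then have "W \<alpha> i J * (hscalar c * W \<beta> (p ^ s - 1) J') = 0" for c \<beta>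
    using W_low_mult_top(1)[of i \<alpha> J \<beta> J'] assms by (simp add: mult.left_commute[of _ "hscalar c"])
  moreover have "W \<alpha> i J * (hscalar c * (xbar * F)) = 0" for c F
    using W_xbar[of i \<alpha> J F] assms True by (simp add: mult.left_commute[of _ "hscalar c"])
  ultimately show ?thesis
    using True by (simp only: twisted_deriv_W_0 distrib_left) simp
next
  case False
  then show ?thesis
    using assms by (simp add: twisted_deriv_W_pos W_mult)
qed

lemma hbracket_G:
  assumes "i < p ^ s" "i' < p ^ s" "i + i' > 0" "J + J' > 0"
  shows "hbr (G i J a) (G i' J' b)
    = hscalar ((if i' = 0 \<or> J = 0 then 0 else of_nat (i + i' - 1 choose i) * of_nat (J + J' - 1 choose (J - 1)))
        - (if i = 0 \<or> J' = 0 then 0 else of_nat (i + i' - 1 choose i') * of_nat (J + J' - 1 choose (J' - 1))))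
      * G (i + i' - 1) (J + J' - 1) (a + b)"
proof -
  define Z where "Z = W (expo J a + expo J' b) (i + i' - 1) (J + J' - 1)"
  have "inner_deriv (W (expo J a) i J) * twisted_deriv xbar (W (expo J' b) i' J')
      = hscalar (if i' = 0 \<or> J = 0 then 0
          else of_nat (i + i' - 1 choose i) * of_nat (J + J' - 1 choose (J - 1))) * Z"
    using W_mult_deriv[of i i' "expo J a" "J - 1" J' b] assms
    by (auto simp: inner_deriv_W Z_def)
  moreover have "twisted_deriv xbar (W (expo J a) i J) * inner_deriv (W (expo J' b) i' J')
      = hscalar (if i = 0 \<or> J' = 0 then 0
          else of_nat (i + i' - 1 choose i') * of_nat (J + J' - 1 choose (J' - 1))) * Z"
    using W_mult_deriv[of i' i "expo J' b" "J' - 1" J a] assms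
    by (auto simp: inner_deriv_W Z_def mult.commute[of "twisted_deriv _ _"] add.commute)
  ultimately show ?thesis
    unfolding G_def hbracket_def expo_add[OF assms(4), symmetric] Z_def[symmetric]
    by (simp only: hscalar_diff left_diff_distrib)
qed

text \<open>Both sides are \<open>(J + J' - 1)! / ((J - 1)! (J' - 1)!)\<close>. This symmetry
  cancels the \<open>xbar\<close> terms in \<open>hbracket_G_0\<close>.\<close>

lemma binomial_exchange:
  assumes "J > 0" "J' > 0"
  shows "J' * (J + J' - 1 choose (J - 1)) = J * (J + J' - 1 choose (J' - 1))"
proof -
  define M where "M = J + J' - 1"
  have "J' * (M choose (J - 1)) = J' * (M choose J')"
    using assms binomial_symmetric[of "J - 1" M] by (simp add: M_def)
  also have "\<dots> = M * (M - 1 choose (J' - 1))"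
    by (rule times_binomial_minus1_eq) (rule assms)
  also have "(M - 1 choose (J' - 1)) = (M - 1 choose (J - 1))"
    using assms binomial_symmetric[of "J - 1" "M - 1"] by (simp add: M_def)
  also have "M * (M - 1 choose (J - 1)) = J * (M choose J)"
    by (rule times_binomial_minus1_eq[symmetric]) (rule assms)
  also have "(M choose J) = (M choose (J' - 1))"
    using assms binomial_symmetric[of J M] by (simp add: M_def)
  finally show ?thesis by (simp add: M_def)
qed

text \<open>Both low exponents of \<open>x\<close> are 0, so both derivatives are exceptional. The
  \<open>xbar\<close> terms cancel, and the factor \<open>hX (p ^ s - 1)\<close> remains with
  \<open>a + b\<close> lowered by one.\<close>

lemma hbracket_G_0:
  assumes "J + J' > 0"
  shows "hbr (G 0 J a) (G 0 J' b)
    = hscalar (\<sigma> * ((if J = 0 then 0 else expo J' b * of_nat (J + J' - 1 choose (J - 1)))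
        - (if J' = 0 then 0 else expo J a * of_nat (J + J' - 1 choose (J' - 1)))))
      * G (p ^ s - 1) (J + J' - 1) (a + b - 1)"
proof -
  define Z where "Z = W (expo (J + J' - 1) (a + b - 1)) (p ^ s - 1) (J + J' - 1)"
  define Y where "Y = xbar * (hY (J + J' - 1) :: 'a hurwitz2)"
  define r where "r J J' = (if J = 0 then 0 else of_nat (J + J' - 1 choose (J - 1)) :: 'a)" for J J'
  have W: "inner_deriv (W (expo J a) 0 J) * twisted_deriv xbar (W (expo J' b) 0 J')
    = hscalar (expo J' b * \<sigma> * r J J') * W (expo (J + J' - 1) (a + b - 1)) (p ^ s - 1) (J + J' - 1)
      + hscalar (of_nat J' * r J J') * (xbar * hY (J + J' - 1))" for J J' a b
  proof (cases "J = 0")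
    case True
    then show ?thesis by (simp add: inner_deriv_W r_def)
  next
    case False
    have 1: "W (expo J a) 0 (J - 1) * (xbar * hY J') = hscalar (r J J') * (xbar * hY (J + J' - 1))"
    proof -
      have "W (expo J a) 0 (J - 1) * (xbar * hY J') = (xbar * E (expo J a)) * (hY (J - 1) * hY J')"
        unfolding W_def by (simp add: ac_simps)
      then show ?thesis using False
        by (simp add: xbar_E hY_mult r_def mult.left_commute)
    qed
    have 2: "W (expo J a) 0 (J - 1) * W (expo J' (b - 1)) (p ^ s - 1) J'
        = hscalar (r J J') * W (expo (J + J' - 1) (a + b - 1)) (p ^ s - 1) (J + J' - 1)"
      using False expo_add[of J J' a "b - 1"] by (simp add: W_mult r_def add_diff_eq)
    have "inner_deriv (W (expo J a) 0 J) * twisted_deriv xbar (W (expo J' b) 0 J')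
      = hscalar (expo J' b * \<sigma>) * (W (expo J a) 0 (J - 1) * W (expo J' (b - 1)) (p ^ s - 1) J')
       + hscalar (of_nat J') * (W (expo J a) 0 (J - 1) * (xbar * hY J'))"
      using False unfolding inner_deriv_W twisted_deriv_W_0 by (simp add: distrib_left mult.left_commute)
    then show ?thesis unfolding 1 2 by (simp add: hscalar_mult mult.assoc)
  qed
  have ex: "of_nat J' * r J J' = of_nat J * r J' J"
    using binomial_exchange[of J J'] by (cases "J = 0"; cases "J' = 0")
      (auto simp: r_def add.commute[of J'] simp flip: of_nat_mult)
  have W': "twisted_deriv xbar (W (expo J a) 0 J) * inner_deriv (W (expo J' b) 0 J')
    = hscalar (expo J a * \<sigma> * r J' J) * Z + hscalar (of_nat J * r J' J) * Y"
    unfolding mult.commute[of "twisted_deriv xbar _"] W Z_def Y_def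
    by (simp add: add.commute)
  show ?thesis
    unfolding G_def hbracket_def W[of J a J' b] W' Z_def[symmetric] Y_def[symmetric] ex
    by (simp add: r_def hscalar_diff hscalar_mult algebra_simps add.commute[of J'])
qed

section \<open>Brackets with \<open>G 1 0 0\<close> and \<open>G 0 (q - 1) 0\<close>, the series of
  X and Y\<close>

lemma hbracket_X: "i < p ^ s \<Longrightarrow> J > 0 \<Longrightarrow> hbr (G i J a) (G 1 0 0) = G i (J - 1) a"
  using hbracket_G[of i 1 J 0 a 0] s_pos p_gt_2 one_less_power[of p s] by simp

lemma hbracket_X_0: "hbr (G i 0 a) (G 1 0 0) = 0"
  by (simp add: hbracket_def G_def inner_deriv_W)

lemma q_minus_1: "(of_nat (q - 1) :: 'a) = - 1"
  using q_gt_2 of_nat_q by (simp add: of_nat_diff del: of_nat_power)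

lemma choose_q_minus_1:
  "(of_nat (q - 1 choose (q - 2)) :: 'a) = - 1"
proof -
  have "(q - 1 choose (q - 2)) = q - 1"
    using binomial_symmetric[of "q - 2" "q - 1"] q_gt_2 by (simp add: Suc_diff_Suc numeral_2_eq_2)
  then show ?thesis by (simp only: q_minus_1)
qed

lemma expo_q_minus_1: "expo (q - 1) a = 2 * \<pi> + of_int a"
  by (simp only: expo_def q_minus_1) simp

text \<open>Only the term differentiating Y in \<open>y\<close> survives. Its exponents
  \<open>J\<close> and \<open>q - 2\<close> carry once \<open>J \<ge> 2\<close>; for
  \<open>J = 1\<close> the binomial is -1 and cancels the minus sign of the bracket.\<close>

lemma hbracket_Y_pos:
  assumes "0 < i" "i < p ^ s"
  shows "hbr (G i 0 a) (G 0 (q - 1) 0) = - G (i - 1) (q - 2) a"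
    and "hbr (G i 1 a) (G 0 (q - 1) 0) = G (i - 1) (q - 1) a"
    and "2 \<le> J \<Longrightarrow> J < q \<Longrightarrow> hbr (G i J a) (G 0 (q - 1) 0) = 0"
proof -
  have J0: "q - 1 - 1 = q - 2" "1 + (q - 1) - 1 = q - 1" using q_gt_2 by auto
  show "hbr (G i 0 a) (G 0 (q - 1) 0) = - G (i - 1) (q - 2) a"
    using hbracket_G[of i 0 0 "q - 1" a 0] assms ps_pos q_gt_2
    by (simp add: J0 hscalar_uminus del: One_nat_def)
  show "hbr (G i 1 a) (G 0 (q - 1) 0) = G (i - 1) (q - 1) a"
    using hbracket_G[of i 0 1 "q - 1" a 0] assms ps_pos q_gt_2 choose_q_minus_1
    by (simp add: J0 hscalar_uminus del: One_nat_def)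
  assume J: "2 \<le> J" "J < q"
  then have "J + (q - 1) - 1 = (q - 2) + J" "q - 1 - 1 = q - 2" using q_gt_2 by auto
  moreover have "(of_nat ((q - 2) + J choose (q - 2)) :: 'a) = 0"
    using J q_gt_2 by (intro choose_carry[of _ n]) auto
  ultimately show "hbr (G i J a) (G 0 (q - 1) 0) = 0"
    using hbracket_G[of i 0 J "q - 1" a 0] assms ps_pos J by (simp del: One_nat_def)
qed

text \<open>For \<open>J = 1\<close> both summands of \<open>hbracket_G_0\<close> contribute:
  \<open>2 * \<pi>\<close> is \<open>expo (q - 1) 0\<close>, and \<open>a\<close> is
  \<open>expo 1 a\<close> with its two signs cancelling.\<close>

lemma hbracket_Y_0:
  shows "hbr (G 0 0 a) (G 0 (q - 1) 0) = hscalar (- (\<sigma> * (\<pi> + of_int a))) * G (p ^ s - 1) (q - 2) (a - 1)"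
    and "hbr (G 0 1 a) (G 0 (q - 1) 0)
      = hscalar (\<sigma> * (2 * \<pi> + of_int a)) * G (p ^ s - 1) (q - 1) (a - 1)"
    and "2 \<le> J \<Longrightarrow> J < q \<Longrightarrow> hbr (G 0 J a) (G 0 (q - 1) 0) = 0"
proof -
  have J0: "q - 1 - 1 = q - 2" "1 + (q - 1) - 1 = q - 1" using q_gt_2 by auto
  show "hbr (G 0 0 a) (G 0 (q - 1) 0) = hscalar (- (\<sigma> * (\<pi> + of_int a))) * G (p ^ s - 1) (q - 2) (a - 1)"
    using hbracket_G_0[of 0 "q - 1" a 0] q_gt_2
    by (simp add: J0 expo_def[of 0] right_diff_distrib distrib_left del: One_nat_def)
  show "hbr (G 0 1 a) (G 0 (q - 1) 0)
      = hscalar (\<sigma> * (2 * \<pi> + of_int a)) * G (p ^ s - 1) (q - 1) (a - 1)"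
    using hbracket_G_0[of 1 "q - 1" a 0] q_gt_2 choose_q_minus_1
    by (simp add: J0 expo_def[of 1] expo_q_minus_1 del: One_nat_def)
  assume J: "2 \<le> J" "J < q"
  then have J1: "J + (q - 1) - 1 = (q - 2) + J" "q - 1 - 1 = q - 2" "J + (q - 1) - 1 = (J - 1) + (q - 1)"
    using q_gt_2 by auto
  have 1: "(of_nat ((q - 2) + J choose (q - 2)) :: 'a) = 0"
    using J q_gt_2 by (intro choose_carry[of _ n]) auto
  have 2: "(of_nat ((J - 1) + (q - 1) choose (J - 1)) :: 'a) = 0"
    using J q_gt_2 by (intro choose_carry[of _ n]) auto
  show "hbr (G 0 J a) (G 0 (q - 1) 0) = 0"
    using hbracket_G_0[of J "q - 1" a 0] J 1 2 unfolding J1(3)[symmetric]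
    unfolding J1(1,2) by (simp del: One_nat_def)
qed

end

section \<open>The graded basis\<close>

text \<open>At a basis vector of \<open>T k\<close> only \<open>v k\<close> can have a nonzero
  coordinate, the sets being disjoint.\<close>

lemma (in vector_space) independent_span_family:
  assumes B: "independent B" and K: "finite K" "k \<in> K"
    and sub: "\<And>i. i \<in> K \<Longrightarrow> T i \<subseteq> B"
    and disj: "\<And>i j. i \<in> K \<Longrightarrow> j \<in> K \<Longrightarrow> i \<noteq> j \<Longrightarrow> T i \<inter> T j = {}"
    and v: "\<And>i. i \<in> K \<Longrightarrow> v i \<in> span (T i)" "(\<Sum>i\<in>K. v i) = 0"
  shows "v k = 0"
proof -
  have mem: "v i \<in> span B" if "i \<in> K" for i
    using v(1)[OF that] span_mono[OF sub[OF that]] by blast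
  have rep: "representation B (v i) b = 0" if "i \<in> K" "b \<notin> T i" for i b
    using representation_extend[OF B v(1)[OF that(1)] sub[OF that(1)]] representation_ne_zero that(2)
    by metis
  have "representation B (v k) b = 0" for b
  proof (cases "b \<in> T k")
    case True
    have "0 = representation B (\<Sum>i\<in>K. v i) b" by (simp add: v representation_zero)
    also have "\<dots> = (\<Sum>i\<in>K. representation B (v i) b)"
      using mem by (subst representation_sum[OF B]) auto
    also have "\<dots> = (\<Sum>i\<in>K. if i = k then representation B (v k) b else 0)"
      using True disj K(2) by (intro sum.cong) (auto intro!: rep)
    finally show ?thesis using K by simp
  qed (use rep K in auto)
  then show ?thesis
    using sum_nonzero_representation_eq[OF B mem[OF K(2)]] by simp
qed

lemma (in lie_algebra) br_span_mem:
  assumes "X \<subseteq> A" "Y \<subseteq> A" "subspace Z" "\<And>x y. x \<in> X \<Longrightarrow> y \<in> Y \<Longrightarrow> br x y \<in> Z"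
    and x: "x \<in> span X" and y: "y \<in> span Y"
  shows "br x y \<in> Z"
proof -
  have sX: "span X \<subseteq> A" and sY: "span Y \<subseteq> A"
    by (rule span_minimal[OF assms(1) subspace_carrier], rule span_minimal[OF assms(2) subspace_carrier])
  have 1: "br x' y' \<in> Z" if "x' \<in> X" "y' \<in> span Y" for x' y'
  proof -
    have "span Y \<subseteq> {y \<in> A. br x' y \<in> Z}"
      using that(1) assms subspace_carrier
      by (intro span_minimal) (auto simp: subspace_def br_add_right br_scale_right subset_iff)
    then show ?thesis using that by auto
  qed
  have "span X \<subseteq> {x \<in> A. br x y \<in> Z}"
    using y 1 sY assms subspace_carrier
    by (intro span_minimal) (auto simp: subspace_def br_add_left br_scale_left subset_iff)
  then show ?thesis using x by auto
qed

text \<open>A basis extracted from the image of \<open>f\<close> has at least \<open>card T\<close>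
  and at most \<open>card I\<close> elements, so neither passing to the image nor extracting loses
  anything.\<close>

lemma (in vector_space) spanning_family_independent:
  assumes T: "independent T" "T \<subseteq> span (f ` I)" and I: "finite I" "card I = card T"
  shows "inj_on f I" "independent (f ` I)"
proof -
  obtain B where B: "B \<subseteq> f ` I" "independent B" "f ` I \<subseteq> span B"
    using maximal_independent_subset by blast
  have fin: "finite (f ` I)" using I by simp
  then have finB: "finite B" using B finite_subset by blast
  have "T \<subseteq> span B"
    using T(2) B(3) by (metis span_minimal subspace_span subset_trans)
  then have "card T \<le> card B"
    using independent_span_bound[OF finB T(1)] by simp
  moreover have "card B \<le> card (f ` I)" using B fin by (intro card_mono)
  moreover have "card (f ` I) \<le> card I" using I by (intro card_image_le)
  ultimately have "card B = card (f ` I)" "card (f ` I) = card I" using I by auto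
  then show "inj_on f I" "independent (f ` I)"
    using B fin I card_subset_eq eq_card_imp_inj_on by metis+
qed

lemma dp_carrier_expand:
  assumes "f \<in> dp_carrier p n1 n2"
  shows "f = (\<Sum>u\<in>dp_box p n1 n2. fun_scale (f u) (dp_monom p n1 n2 (int (fst u)) (int (snd u))))"
proof -
  have "series (dp_monom p n1 n2 (int (fst u)) (int (snd u)) :: _ \<Rightarrow> 'a) = hX (fst u) * hY (snd u)"
    if "u \<in> dp_box p n1 n2" for u
    using that by (auto simp: series_dp_monom dp_box_def simp del: of_nat_power)
  then have "series f
      = series (\<Sum>u\<in>dp_box p n1 n2. fun_scale (f u) (dp_monom p n1 n2 (int (fst u)) (int (snd u))))"
    unfolding series_carrier[OF assms] series_sum series_scale by (intro sum.cong) auto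
  then show ?thesis by (simp only: series_eq_iff)
qed

lemma dp_monom_basis:
  fixes p n1 n2 :: nat
  defines "T \<equiv> (\<lambda>u. dp_monom p n1 n2 (int (fst u)) (int (snd u)) :: _ \<Rightarrow> 'a::field) ` dp_box p n1 n2"
  shows "fs.independent T" "card T = p ^ (n1 + n2)"
proof -
  let ?m = "\<lambda>u. dp_monom p n1 n2 (int (fst u)) (int (snd u)) :: _ \<Rightarrow> 'a"
  have m: "?m u w = (if w = u then 1 else 0)" if "u \<in> dp_box p n1 n2" for u w
    using that by (cases u) (auto simp: dp_monom_def dp_box_def simp del: of_nat_power)
  have inj: "inj_on ?m (dp_box p n1 n2)"
  proof (rule inj_onI)
    fix u w assume "u \<in> dp_box p n1 n2" "w \<in> dp_box p n1 n2" "?m u = ?m w"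
    then have "?m w u = 1" using m[of u u] by metis
    then show "u = w" using m[of w u] \<open>w \<in> _\<close> by (metis zero_neq_one)
  qed
  show "card T = p ^ (n1 + n2)"
    unfolding T_def card_image[OF inj] by (simp add: dp_box_def power_add)
  show "fs.independent T"
  proof (rule fs.independent_if_scalars_zero)
    show "finite T" by (simp add: T_def)
    fix c x assume c: "(\<Sum>x\<in>T. fun_scale (c x) x) = 0" and "x \<in> T"
    then obtain w where w: "w \<in> dp_box p n1 n2" "x = ?m w" by (auto simp: T_def)
    have "(\<Sum>x\<in>T. fun_scale (c x) x) w = (\<Sum>x\<in>T. c x * x w)"
      by (induction T rule: infinite_finite_induct) (auto simp: fun_scale_def)
    also have "\<dots> = (\<Sum>u\<in>dp_box p n1 n2. c (?m u) * ?m u w)"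
      unfolding T_def by (subst sum.reindex[OF inj]) simp
    also have "\<dots> = (\<Sum>u\<in>dp_box p n1 n2. if u = w then c x else 0)"
      by (intro sum.cong refl) (auto simp: m w(2))
    also have "\<dots> = c x" using w by simp
    finally show "c x = 0" using c by simp
  qed
qed

section \<open>The elements \<open>e\<close> and their brackets\<close>

context albert_zassenhaus
begin

abbreviation H :: "(nat \<times> nat \<Rightarrow> 'a) set" where "H \<equiv> dp_carrier p (s + 1) n"
abbreviation br :: "(nat \<times> nat \<Rightarrow> 'a) \<Rightarrow> (nat \<times> nat \<Rightarrow> 'a) \<Rightarrow> nat \<times> nat \<Rightarrow> 'a"
  where "br \<equiv> AZ_bracket p (s + 1) n"
abbreviation e :: "int \<times> int \<times> int \<Rightarrow> nat \<times> nat \<Rightarrow> 'a" where "e \<equiv> AZ_elem p s n \<sigma> \<pi>"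
abbreviation Ind :: "(int \<times> int \<times> int) set" where "Ind \<equiv> AZ_index p s n"
abbreviation deg :: "int \<times> int \<times> int \<Rightarrow> int" where "deg \<equiv> AZ_degree p s n"
abbreviation N :: int where "N \<equiv> int ((q - 1) * p ^ (s + 1))"
abbreviation S :: "int \<Rightarrow> (nat \<times> nat \<Rightarrow> 'a) set" where
  "S \<equiv> degree_component fun_scale N Ind e deg"

sublocale lie_algebra "fun_scale :: 'a \<Rightarrow> _" H br
  by (rule lie_algebra_AZ) simp

lemma series_br: "f \<in> H \<Longrightarrow> g \<in> H \<Longrightarrow> series (br f g) = hbr (series f) (series g)"
  unfolding xbar_def by (rule series_AZ_bracket) auto

lemma gen_power_mem: "gen_power p s n \<sigma> \<alpha> \<in> H"
  unfolding gen_power_def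
  by (intro fs.subspace_sum[OF subspace_dp_carrier] fs.subspace_scale[OF subspace_dp_carrier]) simp

lemma series_gen_power: "series (gen_power p s n \<sigma> \<alpha>) = E \<alpha>"
  unfolding gen_power_def E_def series_sum
proof (intro sum.cong refl)
  fix i assume "i \<in> {..<p}"
  then have i: "i < p" by simp
  then have "i * p ^ s < p ^ (s + 1)" by simp
  then have "int (i * p ^ s) < int (p ^ (s + 1))" by (simp only: of_nat_less_iff)
  moreover have "0 < int (p ^ n)" by simp
  ultimately show "series (fun_scale (field_binomial \<alpha> i * of_nat (fact i) * \<sigma> ^ i)
      (dp_monom p (s + 1) n (int (i * p ^ s)) 0)) = hscalar (falling \<alpha> i * \<sigma> ^ i) * hX (i * p ^ s)"
    unfolding series_scale field_binomial_fact[OF i] series_dp_monom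
    by (simp del: of_nat_power of_nat_mult)
qed

lemma e_mem: "e u \<in> H"
  by (cases u) (simp add: AZ_elem_def)

lemma series_e:
  assumes "(j, k, a) \<in> Ind"
  shows "series (e (j, k, a)) = G (nat (k + 1)) (nat (j + 1)) a"
proof -
  have b: "0 \<le> k + 1" "k + 1 < int (p ^ s)" "0 \<le> j + 1" "j + 1 < int (p ^ n)"
    using assms by (auto simp: AZ_index_def simp del: of_nat_power)
  then have "nat (k + 1) < p ^ s" by linarith
  then have "nat (k + 1) < p ^ (s + 1)" by (rule ps_less)
  then have "k + 1 < int (p ^ (s + 1))" using b by linarith
  then have "series (e (j, k, a)) = E (- of_int j * \<pi> + of_int a) * (hX (nat (k + 1)) * hY (nat (j + 1)))"
    using b unfolding AZ_elem_def prod.case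
    by (subst series_dp_mult) (auto simp: gen_power_mem series_gen_power series_dp_monom
        simp del: of_nat_power One_nat_def)
  moreover have "of_nat (nat (j + 1)) = (of_int (j + 1) :: 'a)"
    using b by (simp add: of_nat_nat)
  ultimately show ?thesis
    by (simp add: G_def W_def expo_def mult.assoc)
qed

text \<open>With \<open>M = a p\<^sup>s + k\<close> the degree of \<open>e\<^bsub>j,k,a\<^esub>\<close> is \<open>-(q - 1) M - j\<close>, and only the residue of
  \<open>M\<close> modulo \<open>p\<^bsup>s+1\<^esup>\<close> matters.\<close>

definition idx :: "int \<Rightarrow> int \<Rightarrow> int \<times> int \<times> int" where
  "idx j M = (j, (M + 1) mod int (p ^ s) - 1, (M + 1) div int (p ^ s) mod int p)"

definition v :: "int \<Rightarrow> int \<Rightarrow> nat \<times> nat \<Rightarrow> 'a" where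
  "v j M = e (idx j M)"

lemma idx_mem: "-1 \<le> j \<Longrightarrow> j < int q - 1 \<Longrightarrow> idx j M \<in> Ind"
proof -
  assume j: "-1 \<le> j" "j < int q - 1"
  define r where "r = (M + 1) mod int (p ^ s)"
  have "0 \<le> r" "r < int (p ^ s)"
    using ps_pos by (simp_all add: r_def del: of_nat_power)
  then show ?thesis
    using j unfolding idx_def AZ_index_def r_def[symmetric] by (auto simp del: of_nat_power)
qed

lemma v_mem: "v j M \<in> H"
  unfolding v_def by (rule e_mem)

lemma of_int_mod_p: "(of_int (a mod int p) :: 'a) = of_int a"
proof -
  have "(of_int a :: 'a) = of_int (int p * (a div int p) + a mod int p)" by simp
  also have "\<dots> = of_int (a mod int p)" unfolding of_int_add of_int_mult by simp
  finally show ?thesis ..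
qed

text \<open>\<open>idx\<close> reduces the quotient modulo \<open>p\<close>, which
  \<open>expo\<close> cannot see in characteristic \<open>p\<close>; hence the unreduced quotient
  appears.\<close>

lemma series_v:
  assumes "-1 \<le> j" "j < int q - 1"
  shows "series (v j M) = G (nat ((M + 1) mod int (p ^ s))) (nat (j + 1)) ((M + 1) div int (p ^ s))"
  using series_e[OF idx_mem[OF assms, of M, unfolded idx_def]]
  by (simp add: v_def idx_def G_def expo_def of_int_mod_p del: of_nat_power)

lemma series_v':
  assumes "-1 \<le> j" "j < int q - 1" "M + 1 = int (p ^ s) * a + int i" "i < p ^ s"
  shows "series (v j M) = G i (nat (j + 1)) a"
proof -
  have "(M + 1) mod int (p ^ s) = int i" "(M + 1) div int (p ^ s) = a"
    unfolding assms(3) using assms(4) by (simp_all del: of_nat_power)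
  then show ?thesis using series_v[OF assms(1,2), of M] by simp
qed

lemma v_cong:
  assumes "[M = M'] (mod int (p ^ (s + 1)))"
  shows "v j M = v j M'"
proof -
  obtain c where "M = M' + int (p ^ (s + 1)) * c"
    using cong_sym[OF assms] by (auto simp: cong_iff_lin mult.commute)
  then have c: "M + 1 = (M' + 1) + int (p ^ s) * (int p * c)"
    by (simp add: ac_simps)
  have "idx j M = idx j M'"
    unfolding idx_def c using ps_pos by (simp add: div_mult_self2 del: of_nat_power)
  then show ?thesis by (simp add: v_def)
qed

text \<open>The grading needs only that the bracket is some multiple of the element with added
  indices, and 0 when that element does not exist.\<close>

lemma bracket_v:
  assumes j: "-1 \<le> j" "j < int q - 1" and l: "-1 \<le> l" "l < int q - 1"
  shows "br (v j M) (v l K) = 0 \<or>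
    -1 \<le> j + l \<and> j + l < int q - 1 \<and> (\<exists>c. br (v j M) (v l K) = fun_scale c (v (j + l) (M + K)))"
proof -
  define P where "P = int (p ^ s)"
  have P: "P > 0" using ps_pos by (simp add: P_def del: of_nat_power)
  define i where "i = nat ((M + 1) mod P)"
  define i' where "i' = nat ((K + 1) mod P)"
  define a where "a = (M + 1) div P"
  define b where "b = (K + 1) div P"
  define J where "J = nat (j + 1)"
  define J' where "J' = nat (l + 1)"
  have M: "M + 1 = P * a + int i" and K: "K + 1 = P * b + int i'"
    using P by (simp_all add: i_def i'_def a_def b_def)
  have i: "i < p ^ s" "i' < p ^ s"
    using P pos_mod_bound[OF P] by (simp_all add: i_def i'_def P_def nat_less_iff del: of_nat_power)
  have J: "J < q" "J' < q" "j + 1 = int J" "l + 1 = int J'"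
    using j l by (auto simp: J_def J'_def simp del: of_nat_power)
  have s: "series (br (v j M) (v l K)) = hbr (G i J a) (G i' J' b)"
    using j l by (simp add: series_br v_mem series_v i_def i'_def J_def J'_def a_def b_def P_def
        del: One_nat_def of_nat_power)
  show ?thesis
  proof (cases "J + J' = 0")
    case True
    then have "hbr (G i J a) (G i' J' b) = 0" by (simp add: hbracket_def G_def inner_deriv_W)
    then show ?thesis using s by (simp add: series_eq_0_iff)
  next
    case False
    then have JJ: "-1 \<le> j + l" "nat (j + l + 1) = J + J' - 1" using J by auto
    have jl: "J + J' - 1 < q \<longleftrightarrow> j + l < int q - 1"
      using False J by (auto simp del: of_nat_power)
    show ?thesis
    proof (cases "i + i' = 0")
      case True
      define c where "c = \<sigma> * ((if J = 0 then 0 else expo J' b * of_nat (J + J' - 1 choose (J - 1)))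
        - (if J' = 0 then 0 else expo J a * of_nat (J + J' - 1 choose (J' - 1))))"
      have s': "series (br (v j M) (v l K)) = hscalar c * G (p ^ s - 1) (J + J' - 1) (a + b - 1)"
        unfolding s c_def using True False hbracket_G_0[of J J' a b] by simp
      show ?thesis
      proof (cases "J + J' - 1 < q")
        case lt: True
        \<comment> \<open>\<open>M + 1\<close> and \<open>K + 1\<close> are multiples of
          \<open>P\<close>, so \<open>M + K + 1\<close> is one less than a multiple and borrows from
          the quotient.\<close>
        have "M + K + 1 = P * (a + b - 1) + int (p ^ s - 1)"
        proof -
          have "int (p ^ s - 1) = P - 1" using ps_pos unfolding P_def by linarith
          then show ?thesis using M K True by (simp add: algebra_simps)
        qed
        then have "series (v (j + l) (M + K)) = G (p ^ s - 1) (J + J' - 1) (a + b - 1)"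
          using lt jl JJ ps_pos series_v'[of "j + l" "M + K" "a + b - 1" "p ^ s - 1"]
          by (simp add: P_def del: of_nat_power)
        then have "series (br (v j M) (v l K)) = series (fun_scale c (v (j + l) (M + K)))"
          unfolding s' series_scale by simp
        then show ?thesis using lt jl JJ by (auto simp: series_eq_iff)
      next
        case ge: False
        have "(if J = 0 then 0 else of_nat (J + J' - 1 choose (J - 1))) = (0 :: 'a)"
          using choose_carry[of "J - 1" n J'] ge J by auto
        moreover have "(if J' = 0 then 0 else of_nat (J + J' - 1 choose (J' - 1))) = (0 :: 'a)"
          using choose_carry[of "J' - 1" n J] ge J by (auto simp: add.commute)
        ultimately have "c = 0" by (auto simp: c_def split: if_splits)
        then show ?thesis using s' by (simp add: series_eq_0_iff)
      qed
    next
      case ii: False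
      define c where "c = (if i' = 0 \<or> J = 0 then 0 else of_nat (i + i' - 1 choose i) * of_nat (J + J' - 1 choose (J - 1)))
        - (if i = 0 \<or> J' = 0 then 0 else of_nat (i + i' - 1 choose i') * of_nat (J + J' - 1 choose (J' - 1)) :: 'a)"
      have s': "series (br (v j M) (v l K)) = hscalar c * G (i + i' - 1) (J + J' - 1) (a + b)"
        unfolding s c_def using ii False hbracket_G[of i i' J J' a b] i by simp
      show ?thesis
      proof (cases "i + i' - 1 < p ^ s \<and> J + J' - 1 < q")
        case lt: True
        have "M + K + 1 = P * (a + b) + int (i + i' - 1)"
          using M K ii by (auto simp add: algebra_simps of_nat_diff)
        then have "series (v (j + l) (M + K)) = G (i + i' - 1) (J + J' - 1) (a + b)"
          using lt jl JJ series_v'[of "j + l" "M + K" "a + b" "i + i' - 1"]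
          by (simp add: P_def del: of_nat_power)
        then have "series (br (v j M) (v l K)) = series (fun_scale c (v (j + l) (M + K)))"
          unfolding s' series_scale by simp
        then show ?thesis using lt jl JJ by (auto simp: series_eq_iff)
      next
        case ge: False
        \<comment> \<open>Whichever exponent leaves its range, the corresponding binomial factor
          carries.\<close>
        have 1: "(of_nat (i + i' - 1 choose i) * of_nat (J + J' - 1 choose (J - 1)) :: 'a) = 0"
          if "\<not> (i' = 0 \<or> J = 0)"
        proof (cases "i + i' - 1 < p ^ s")
          case True
          then show ?thesis using choose_carry[of "J - 1" n J'] ge J that by auto
        next
          case False
          then show ?thesis using choose_carry[of i s "i' - 1"] i that by auto
        qed
        have 2: "(of_nat (i + i' - 1 choose i') * of_nat (J + J' - 1 choose (J' - 1)) :: 'a) = 0"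
          if "\<not> (i = 0 \<or> J' = 0)"
        proof (cases "i + i' - 1 < p ^ s")
          case True
          then show ?thesis using choose_carry[of "J' - 1" n J] ge J that by (auto simp: add.commute)
        next
          case False
          then show ?thesis using choose_carry[of i' s "i - 1"] i that by (auto simp: add.commute)
        qed
        have "c = 0" using 1 2 by (auto simp: c_def)
        then show ?thesis using s' by (simp add: series_eq_0_iff)
      qed
    qed
  qed
qed

lemma sigma_nonzero: "\<sigma> \<noteq> 0"
proof
  assume "\<sigma> = 0"
  then show False using param by (simp add: zero_power)
qed

text \<open>The span of the \<open>e\<^bsub>j,k,a\<^esub>\<close> with fixed \<open>j\<close> and \<open>k\<close> contains all
  \<open>(1 + \<sigma> z)\<^bsup>-j \<pi>\<^esup> z\<^bsup>i\<^esup> x\<^bsup>(k+1)\<^esup> y\<^bsup>(j+1)\<^esup>\<close> with \<open>z = x\<^bsup>(p^s)\<^esup>\<close>, since \<open>(1 + \<sigma> z)\<^bsup>a\<^esup>\<close> is a polynomial in \<open>z\<close>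
  of degree \<open>a\<close>; the invertible factor \<open>(1 + \<sigma> z)\<^bsup>-j \<pi>\<^esup>\<close> can then be cancelled.\<close>

lemma span_e: "fs.span (e ` Ind) = H"
proof
  show "fs.span (e ` Ind) \<subseteq> H"
    by (rule fs.span_minimal[OF _ subspace_dp_carrier]) (use e_mem in blast)
  \<comment> \<open>The argument runs among the series, where the factors of a product can be
    separated and recombined.\<close>
  define U where "U = series ` fs.span (e ` Ind)"
  have U_add: "F + F' \<in> U" if "F \<in> U" "F' \<in> U" for F F'
  proof -
    obtain f f' where f: "f \<in> fs.span (e ` Ind)" "f' \<in> fs.span (e ` Ind)" "F = series f" "F' = series f'"
      using \<open>F \<in> U\<close> \<open>F' \<in> U\<close> by (auto simp: U_def)
    then have "F + F' = series (f + f')" by (simp add: series_add)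
    then show ?thesis using fs.span_add[OF f(1,2)] unfolding U_def by blast
  qed
  have U_scale: "hscalar c * F \<in> U" if "F \<in> U" for c F
  proof -
    obtain f where f: "f \<in> fs.span (e ` Ind)" "F = series f"
      using \<open>F \<in> U\<close> by (auto simp: U_def)
    then have "hscalar c * F = series (fun_scale c f)" by (simp add: series_scale)
    then show ?thesis using fs.span_scale[OF f(1), of c] unfolding U_def by blast
  qed
  have U_0: "0 \<in> U"
    unfolding U_def using fs.span_zero[of "e ` Ind"] series_0 by (metis image_eqI)
  have U_sum: "(\<Sum>i\<in>K. F i) \<in> U" if "\<And>i. i \<in> K \<Longrightarrow> F i \<in> U" for K and F :: "nat \<Rightarrow> 'a hurwitz2"
    using that by (induction K rule: infinite_finite_induct) (auto intro: U_add U_0)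
  have G_mem: "G i J (int a) \<in> U" if "i < p ^ s" "J < q" "a < p" for i J a
  proof -
    have "(int J - 1, int i - 1, int a) \<in> Ind"
      using that by (auto simp: AZ_index_def simp del: of_nat_power)
    from series_e[OF this] have "G i J (int a) = series (e (int J - 1, int i - 1, int a))" by simp
    then show ?thesis
      unfolding U_def using fs.span_base \<open>_ \<in> Ind\<close> by blast
  qed
  have Z_mem: "E (expo J 0) * hX (m * p ^ s) * (hX i * hY J) \<in> U" if iJ: "i < p ^ s" "J < q" and m: "m < p"
    for i J m
    using m
  proof (induction m rule: less_induct)
    case (less m)
    define f where "f k = falling (of_nat m) k * \<sigma> ^ k" for k
    define Z where "Z k = E (expo J 0) * hX (k * p ^ s) * (hX i * hY J)" for k
    have f0: "f k = 0" if "k > m" for k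
      using that by (auto simp: f_def falling_def)
    \<comment> \<open>The leading coefficient is \<open>m! * \<sigma> ^ m\<close>, a unit because
      \<open>m < p\<close>; so the system is triangular.\<close>
    have fm: "f m \<noteq> 0"
      using less.prems sigma_nonzero
      by (auto simp: f_def falling_def of_nat_eq_0_iff dest: dvd_imp_le simp flip: of_nat_diff)
    have "G i J (int m) = E (expo J 0) * E (of_nat m) * (hX i * hY J)"
      by (simp add: G_def W_def E_mult expo_def mult.assoc)
    also have "\<dots> = (\<Sum>k<p. hscalar (f k) * Z k)"
      unfolding E_def[of "of_nat m"] sum_distrib_left sum_distrib_right Z_def f_def
      by (intro sum.cong refl) (simp only: ac_simps)
    also have "\<dots> = (\<Sum>k\<in>{..m}. hscalar (f k) * Z k)"
      using less.prems by (intro sum.mono_neutral_right) (auto simp: f0)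
    also have "\<dots> = hscalar (f m) * Z m + (\<Sum>k<m. hscalar (f k) * Z k)"
      by (simp add: add.commute flip: lessThan_Suc_atMost)
    finally have "hscalar (f m) * Z m = G i J (int m) + hscalar (- 1) * (\<Sum>k<m. hscalar (f k) * Z k)"
      by (simp add: hscalar_uminus)
    moreover have "(\<Sum>k<m. hscalar (f k) * Z k) \<in> U"
      unfolding Z_def using less by (intro U_sum U_scale less.IH) auto
    ultimately have "hscalar (f m) * Z m \<in> U"
      using G_mem[OF iJ less.prems] by (auto intro: U_add U_scale)
    then have "hscalar (1 / f m) * (hscalar (f m) * Z m) \<in> U" by (rule U_scale)
    then show ?case
      using fm by (simp add: Z_def flip: mult.assoc hscalar_mult)
  qed
  have mon_mem: "hX (m * p ^ s + i) * hY J \<in> U" if iJ: "i < p ^ s" "J < q" and m: "m < p" for m i J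
  proof -
    have "hX (m * p ^ s + i) * hY J = E (- expo J 0) * E (expo J 0) * hX (m * p ^ s) * (hX i * hY J)"
      using iJ by (simp add: E_mult hX_block_low flip: mult.assoc)
    also have "\<dots> = (\<Sum>k<p. hscalar (falling (- expo J 0) k * \<sigma> ^ k)
        * (E (expo J 0) * (hX (k * p ^ s) * hX (m * p ^ s)) * (hX i * hY J)))"
      unfolding E_def[of "- expo J 0"] sum_distrib_right by (intro sum.cong refl) (simp only: ac_simps)
    also have "\<dots> \<in> U"
    proof (intro U_sum U_scale)
      fix k assume "k \<in> {..<p}"
      then have k: "k < p" by simp
      have "E (expo J 0) * (hX (k * p ^ s) * hX (m * p ^ s)) * (hX i * hY J)
          = hscalar (of_nat (k + m choose k)) * (E (expo J 0) * hX ((k + m) * p ^ s) * (hX i * hY J))"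
        unfolding hX_block_mult by (simp only: ac_simps)
      moreover have "hscalar (of_nat (k + m choose k)) * (E (expo J 0) * hX ((k + m) * p ^ s) * (hX i * hY J)) \<in> U"
      proof (cases "k + m < p")
        case True
        then show ?thesis using Z_mem[OF iJ] by (intro U_scale)
      next
        case False
        then have "(of_nat (k + m choose k) :: 'a) = 0"
          using choose_carry[of k 1 m] k m by simp
        then show ?thesis by (simp add: U_0)
      qed
      ultimately show "E (expo J 0) * (hX (k * p ^ s) * hX (m * p ^ s)) * (hX i * hY J) \<in> U" by simp
    qed
    finally show ?thesis .
  qed
  have "dp_monom p (s + 1) n (int i) (int J) \<in> fs.span (e ` Ind)" if "(i, J) \<in> dp_box p (s + 1) n" for i J
  proof -
    have i: "i < p ^ (s + 1)" "J < q" using that by (auto simp: dp_box_def)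
    have "i div p ^ s < p" using i ps_pos by (simp add: less_mult_imp_div_less)
    then have "hX (i div p ^ s * p ^ s + i mod p ^ s) * hY J \<in> U"
      using i ps_pos by (intro mon_mem) auto
    then have "hX i * hY J \<in> U" unfolding div_mult_mod_eq .
    then have "series (dp_monom p (s + 1) n (int i) (int J)) \<in> U"
      using i by (simp add: series_dp_monom del: of_nat_power One_nat_def)
    then show ?thesis by (auto simp: U_def series_eq_iff)
  qed
  then show "H \<subseteq> fs.span (e ` Ind)"
  proof (intro subsetI)
    fix f :: "nat \<times> nat \<Rightarrow> 'a" assume "f \<in> H"
    then show "f \<in> fs.span (e ` Ind)"
      by (subst dp_carrier_expand[OF \<open>f \<in> H\<close>])
        (intro fs.span_sum fs.span_scale, use \<open>\<And>i J. (i, J) \<in> _ \<Longrightarrow> _\<close> in auto)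
  qed
qed

lemma card_Ind: "card Ind = p ^ (s + 1 + n)" and finite_Ind: "finite Ind"
  by (simp_all add: AZ_index_def card_cartesian_product power_add nat_add_distrib nat_diff_distrib
      del: of_nat_power)

text \<open>By counting: a spanning family with as many members as there are monomials in the box is
  a basis.\<close>

lemma e_basis: "inj_on e Ind" "fs.independent (e ` Ind)"
proof -
  let ?T = "(\<lambda>u. dp_monom p (s + 1) n (int (fst u)) (int (snd u)) :: _ \<Rightarrow> 'a) ` dp_box p (s + 1) n"
  have T: "?T \<subseteq> fs.span (e ` Ind)" unfolding span_e by auto
  have "card Ind = card ?T"
    unfolding card_Ind dp_monom_basis(2) ..
  note basis = fs.spanning_family_independent[OF dp_monom_basis(1) T finite_Ind this]
  show "inj_on e Ind" "fs.independent (e ` Ind)"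
    by (rule basis)+
qed

lemma N_pos: "N > 0"
  using q_gt_2 by (simp only: of_nat_0_less_iff) simp

lemma e_eq_v: "(j, k, a) \<in> Ind \<Longrightarrow> e (j, k, a) = v j (a * int (p ^ s) + k)"
proof -
  assume "(j, k, a) \<in> Ind"
  then have b: "0 \<le> k + 1" "k + 1 < int (p ^ s)" "0 \<le> a" "a < int p"
    by (auto simp: AZ_index_def simp del: of_nat_power)
  have "a * int (p ^ s) + k + 1 = (k + 1) + int (p ^ s) * a" by simp
  then have "(a * int (p ^ s) + k + 1) mod int (p ^ s) = k + 1"
    "(a * int (p ^ s) + k + 1) div int (p ^ s) = a"
    using b by (simp_all only: mod_mult_self2 div_mult_self2 mod_pos_pos_trivial div_pos_pos_trivial)
  then have "idx j (a * int (p ^ s) + k) = (j, k, a)"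
    unfolding idx_def using b by (simp del: of_nat_power)
  then show ?thesis by (simp add: v_def)
qed

text \<open>Reducing the quotient modulo \<open>p\<close> changes \<open>M\<close> by a multiple of
  \<open>p ^ (s + 1)\<close>, hence the degree by a multiple of \<open>N\<close>.\<close>

lemma deg_idx: "[deg (idx j M) = - (int q - 1) * M - j] (mod N)"
proof -
  define P where "P = int (p ^ s)"
  define a where "a = (M + 1) div P"
  have M: "M = a * P + (M + 1) mod P - 1" by (simp add: a_def)
  have a: "a = int p * (a div int p) + a mod int p" by simp
  have "deg (idx j M) = (1 - int q) * (a mod int p * P + ((M + 1) mod P - 1)) - j"
    by (simp add: AZ_degree_def idx_def a_def P_def del: of_nat_power)
  moreover have "(- (int q - 1) * M - j) - \<dots> = - (int q - 1) * (M - (a mod int p * P + ((M + 1) mod P - 1)))"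
    by (simp add: algebra_simps del: of_nat_power)
  moreover have "M - (a mod int p * P + ((M + 1) mod P - 1)) = int p * P * (a div int p)"
  proof -
    have "M - (a mod int p * P + ((M + 1) mod P - 1)) = (a - a mod int p) * P"
      using M by (simp add: left_diff_distrib)
    also have "a - a mod int p = int p * (a div int p)"
      using a by linarith
    finally show ?thesis by (simp only: ac_simps)
  qed
  moreover have "N = (int q - 1) * (int p * P)"
    using q_gt_2 by (simp add: P_def of_nat_diff)
  ultimately have "(- (int q - 1) * M - j) - deg (idx j M) = N * (- (a div int p))"
    by (simp add: left_diff_distrib del: of_nat_power of_nat_mult)
  then have "N dvd (- (int q - 1) * M - j) - deg (idx j M)" by (metis dvd_triv_left)
  then show ?thesis
    by (metis cong_iff_dvd_diff cong_sym)
qed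

lemma S_eq: "S d = fs.span {v j M |j M. -1 \<le> j \<and> j < int q - 1 \<and> [- (int q - 1) * M - j = d] (mod N)}"
proof -
  have "e ` {i \<in> Ind. [deg i = d] (mod N)}
    = {v j M |j M. -1 \<le> j \<and> j < int q - 1 \<and> [- (int q - 1) * M - j = d] (mod N)}"
  proof (intro equalityI subsetI)
    fix x assume "x \<in> e ` {i \<in> Ind. [deg i = d] (mod N)}"
    then obtain j k a where u: "(j, k, a) \<in> Ind" "[deg (j, k, a) = d] (mod N)" "x = e (j, k, a)"
      by auto
    have "deg (j, k, a) = - (int q - 1) * (a * int (p ^ s) + k) - j"
      by (simp add: AZ_degree_def algebra_simps del: of_nat_power)
    moreover have "-1 \<le> j" "j < int q - 1"
      using u(1) by (auto simp: AZ_index_def simp del: of_nat_power)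
    ultimately show "x \<in> {v j M |j M. -1 \<le> j \<and> j < int q - 1 \<and> [- (int q - 1) * M - j = d] (mod N)}"
      using u e_eq_v[OF u(1)] by auto
  next
    fix x assume "x \<in> {v j M |j M. -1 \<le> j \<and> j < int q - 1 \<and> [- (int q - 1) * M - j = d] (mod N)}"
    then obtain j M where u: "x = v j M" "-1 \<le> j" "j < int q - 1" "[- (int q - 1) * M - j = d] (mod N)"
      by blast
    then have "[deg (idx j M) = d] (mod N)" using deg_idx cong_trans by blast
    then show "x \<in> e ` {i \<in> Ind. [deg i = d] (mod N)}"
      using u idx_mem by (auto simp only: v_def)
  qed
  then show ?thesis by (simp add: degree_component_def)
qed

lemma S_mod: "S (d mod N) = S d"
  by (simp add: degree_component_def cong_def)

lemma grading: "lie_grading fun_scale H br {0..<N} (\<lambda>i j. (i + j) mod N) S"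
proof unfold_locales
  let ?D = "\<lambda>d. {i \<in> Ind. [deg i = d] (mod N)}"
  show "fs.subspace (S i)" if "i \<in> {0..<N}" for i
    by (simp add: degree_component_def)
  show "fs.span (\<Union>i\<in>{0..<N}. S i) = H"
  proof
    show "fs.span (\<Union>i\<in>{0..<N}. S i) \<subseteq> H"
    proof (rule fs.span_minimal[OF _ subspace_dp_carrier])
      have "S i \<subseteq> H" for i
        unfolding degree_component_def span_e[symmetric] by (rule fs.span_mono) auto
      then show "(\<Union>i\<in>{0..<N}. S i) \<subseteq> H" by blast
    qed
    have "e u \<in> (\<Union>i\<in>{0..<N}. S i)" if "u \<in> Ind" for u
    proof
      show "deg u mod N \<in> {0..<N}"
        unfolding atLeastLessThan_iff using pos_mod_bound[OF N_pos] pos_mod_sign[OF N_pos] by blast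
      show "e u \<in> S (deg u mod N)"
        unfolding S_mod unfolding degree_component_def using that by (intro fs.span_base) auto
    qed
    then have "e ` Ind \<subseteq> (\<Union>i\<in>{0..<N}. S i)" by blast
    then show "H \<subseteq> fs.span (\<Union>i\<in>{0..<N}. S i)"
      unfolding span_e[symmetric] by (rule fs.span_mono)
  qed
  show "v k = 0"
    if K: "finite K" "K \<subseteq> {0..<N}" "\<And>i. i \<in> K \<Longrightarrow> v i \<in> S i" "(\<Sum>i\<in>K. v i) = 0" "k \<in> K" for K v k
  proof (rule fs.independent_span_family[OF e_basis(2) K(1,5), of "\<lambda>d. e ` ?D d" v])
    show "e ` ?D i \<inter> e ` ?D j = {}" if "i \<in> K" "j \<in> K" "i \<noteq> j" for i j
    proof -
      have "i mod N = i" "j mod N = j" using that K(2) by auto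
      then have "?D i \<inter> ?D j = {}" using that(3) by (auto simp: cong_def)
      then show ?thesis using inj_on_image_Int[OF e_basis(1), of "?D i" "?D j"] by auto
    qed
    show "v i \<in> fs.span (e ` ?D i)" if "i \<in> K" for i
      using K(3)[OF that] by (simp add: degree_component_def)
  qed (use K in auto)
  show "br x y \<in> S ((i + j) mod N)" if "i \<in> {0..<N}" "j \<in> {0..<N}" "x \<in> S i" "y \<in> S j" for i j x y
    unfolding S_mod
  proof (rule br_span_mem)
    let ?V = "\<lambda>d. {v j M |j M. -1 \<le> j \<and> j < int q - 1 \<and> [- (int q - 1) * M - j = d] (mod N)}"
    show "x \<in> fs.span (?V i)" "y \<in> fs.span (?V j)" using that by (simp_all only: S_eq)
    show "?V i \<subseteq> H" "?V j \<subseteq> H" using v_mem by auto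
    show "fs.subspace (S (i + j))" by (simp add: degree_component_def)
    fix a b assume "a \<in> ?V i" "b \<in> ?V j"
    then obtain k M l K where a: "a = v k M" "-1 \<le> k" "k < int q - 1" "[- (int q - 1) * M - k = i] (mod N)"
      and b: "b = v l K" "-1 \<le> l" "l < int q - 1" "[- (int q - 1) * K - l = j] (mod N)"
      by blast
    have "[- (int q - 1) * (M + K) - (k + l) = i + j] (mod N)"
      using cong_add[OF a(4) b(4)] by (simp add: algebra_simps del: of_nat_power)
    then have "v (k + l) (M + K) \<in> S (i + j)" if "-1 \<le> k + l" "k + l < int q - 1"
      unfolding S_eq using that by (intro fs.span_base) blast
    then show "br a b \<in> S (i + j)"
      unfolding a(1) b(1) using bracket_v[OF a(2,3) b(2,3), of M K]
      by (auto simp: degree_component_def intro: fs.span_zero fs.span_scale)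
  qed
qed

lemma graded_basis: "graded_basis fun_scale H br N Ind e deg"
  unfolding graded_basis_def using e_basis span_e grading by blast

end

section \<open>The loop algebra is thin\<close>

lemma (in vector_space) mem_span_pair: "x \<in> span {a, b} \<longleftrightarrow> (\<exists>c d. x = scale c a + scale d b)"
proof -
  have "x \<in> span {a, b} \<longleftrightarrow> (\<exists>c d. x - scale c a = scale d b)"
    by (simp add: span_breakdown_eq[of x a] span_singleton image_iff)
  then show ?thesis by (simp add: diff_eq_eq add.commute)
qed

text \<open>The type relations are quantified over the nonzero vectors \<open>\<kappa> v\<close> of
  a line; being homogeneous, they need checking only at \<open>\<kappa> = 1\<close>.\<close>

lemma all_nonzero_scalar:
  fixes x y z w k m :: "'a::field"
  shows "(\<forall>\<kappa>. \<kappa> \<noteq> 0 \<longrightarrow> \<kappa> * x = 0 \<and> \<kappa> * y = 0 \<and> k * (\<kappa> * z) = m * (\<kappa> * w))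
    \<longleftrightarrow> x = 0 \<and> y = 0 \<and> k * z = m * w"
proof (intro iffI allI impI)
  assume "\<forall>\<kappa>. \<kappa> \<noteq> 0 \<longrightarrow> \<kappa> * x = 0 \<and> \<kappa> * y = 0 \<and> k * (\<kappa> * z) = m * (\<kappa> * w)"
  from this[rule_format, of 1] show "x = 0 \<and> y = 0 \<and> k * z = m * w" by simp
qed (simp add: mult.left_commute[of k] mult.left_commute[of m])

context albert_zassenhaus
begin

text \<open>Otherwise Frobenius would fix \<open>\<pi>\<close>, contradicting
  \<open>param\<close>.\<close>

lemma of_int_pi_nonzero: "(of_int k :: 'a) \<noteq> 0 \<Longrightarrow> of_int k * \<pi> + of_int z \<noteq> 0"
proof
  assume k: "(of_int k :: 'a) \<noteq> 0" and "of_int k * \<pi> + of_int z = 0"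
  then have eq: "of_int k * \<pi> = of_int (- z)" by (simp add: eq_neg_iff_add_eq_0)
  have "of_int k * \<pi> ^ p = (of_int k * \<pi>) ^ p" by (simp only: power_mult_distrib pow_p_of_int)
  also have "\<dots> = of_int k * \<pi>" unfolding eq by (rule pow_p_of_int)
  finally have "of_int k * \<pi> ^ p = of_int k * \<pi>" .
  then show False using k param by simp
qed

lemma pi_nonzero: "\<pi> \<noteq> 0"
  using of_int_pi_nonzero[of 1 0] by simp

lemma two_nonzero: "(2 :: 'a) \<noteq> 0"
  using of_nat_eq_0_iff[of 2] p_gt_2 by (auto dest: dvd_imp_le)

text \<open>The degree \<open>-(q - 1) M - j\<close> is 1 both at \<open>j = -1\<close>,
  \<open>M = 0\<close> and at \<open>j = q - 2\<close>, \<open>M = -1\<close>.\<close>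

definition gX :: "nat \<times> nat \<Rightarrow> 'a" where "gX = v (-1) 0"
definition gY :: "nat \<times> nat \<Rightarrow> 'a" where "gY = v (int q - 2) (-1)"

text \<open>\<open>[e\<^bsub>0,M\<^esub>, Y]\<close> and \<open>[e\<^bsub>-1,M\<^esub>, Y]\<close> are these multiples of \<open>e\<^bsub>q-2,M-1\<^esub>\<close> and \<open>e\<^bsub>q-3,M-1\<^esub>\<close>.\<close>

definition cY :: "int \<Rightarrow> 'a" where
  "cY M = (if (M + 1) mod int (p ^ s) = 0 then \<sigma> * (2 * \<pi> + of_int ((M + 1) div int (p ^ s))) else 1)"

definition dY :: "int \<Rightarrow> 'a" where
  "dY M = (if (M + 1) mod int (p ^ s) = 0 then - (\<sigma> * (\<pi> + of_int ((M + 1) div int (p ^ s)))) else - 1)"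

lemma cY_nonzero: "cY M \<noteq> 0"
  using of_int_pi_nonzero[of 2 "(M + 1) div int (p ^ s)"] sigma_nonzero two_nonzero by (simp add: cY_def)

lemma dY_nonzero: "dY M \<noteq> 0"
  using of_int_pi_nonzero[of 1 "(M + 1) div int (p ^ s)"] sigma_nonzero by (simp add: dY_def)

lemma quotient_decomp:
  obtains i a where "M + 1 = int (p ^ s) * a + int i" "i < p ^ s"
    "(M + 1) mod int (p ^ s) = int i" "(M + 1) div int (p ^ s) = a"
proof
  have "0 \<le> (M + 1) mod int (p ^ s)" "(M + 1) mod int (p ^ s) < int (p ^ s)"
    using ps_pos by (simp_all del: of_nat_power)
  then show "(M + 1) mod int (p ^ s) = int (nat ((M + 1) mod int (p ^ s)))"
    "nat ((M + 1) mod int (p ^ s)) < p ^ s"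
    by linarith+
  then show "M + 1 = int (p ^ s) * ((M + 1) div int (p ^ s)) + int (nat ((M + 1) mod int (p ^ s)))"
    by (metis mult_div_mod_eq)
qed simp

lemma gX_mem: "gX \<in> H" and gY_mem: "gY \<in> H"
  unfolding gX_def gY_def by (rule v_mem)+

lemma series_gX: "series gX = G 1 0 0"
  unfolding gX_def using series_v'[of "-1" 0 0 1] q_gt_2 one_less_power[of p s] p_gt_2
  by (simp del: of_nat_power)

lemma series_gY: "series gY = G 0 (q - 1) 0"
proof -
  have "nat (int q - 2 + 1) = q - 1" by linarith
  then show ?thesis
    unfolding gY_def using series_v'[of "int q - 2" "-1" 0 0] q_gt_2 ps_pos
    by (simp del: of_nat_power)
qed

lemma br_gX: "0 \<le> j \<Longrightarrow> j < int q - 1 \<Longrightarrow> br (v j M) gX = v (j - 1) M"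
proof -
  assume j: "0 \<le> j" "j < int q - 1"
  obtain i a where M: "M + 1 = int (p ^ s) * a + int i" "i < p ^ s" by (rule quotient_decomp)
  have "nat (j + 1) - 1 = nat (j - 1 + 1)" using j by simp
  then have "series (br (v j M) gX) = series (v (j - 1) M)"
    using j M unfolding series_br[OF v_mem gX_mem] series_gX
    by (simp add: series_v'[of j M a i] series_v'[of "j - 1" M a i] hbracket_X del: One_nat_def of_nat_power)
  then show ?thesis by (simp add: series_eq_iff)
qed

lemma br_gX_0: "br (v (-1) M) gX = 0"
proof -
  obtain i a where M: "M + 1 = int (p ^ s) * a + int i" "i < p ^ s" by (rule quotient_decomp)
  have "series (br (v (-1) M) gX) = 0"
    using M q_gt_2 unfolding series_br[OF v_mem gX_mem] series_gX
    by (simp add: series_v'[of "-1" M a i] hbracket_X_0 del: One_nat_def of_nat_power)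
  then show ?thesis by (simp add: series_eq_0_iff)
qed

lemma br_gY: "1 \<le> j \<Longrightarrow> j < int q - 1 \<Longrightarrow> br (v j M) gY = 0"
proof -
  assume j: "1 \<le> j" "j < int q - 1"
  obtain i a where M: "M + 1 = int (p ^ s) * a + int i" "i < p ^ s" by (rule quotient_decomp)
  have J: "2 \<le> nat (j + 1)" "nat (j + 1) < q" using j by linarith+
  have "series (br (v j M) gY) = hbr (G i (nat (j + 1)) a) (G 0 (q - 1) 0)"
    using j M unfolding series_br[OF v_mem gY_mem] series_gY
    by (simp add: series_v'[of j M a i] del: One_nat_def of_nat_power)
  also have "\<dots> = 0"
    using hbracket_Y_pos(3)[of i "nat (j + 1)" a] hbracket_Y_0(3)[of "nat (j + 1)" a] J M(2)
    by (cases "i = 0") simp_all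
  finally show ?thesis by (simp add: series_eq_0_iff)
qed

text \<open>The borrow at remainder 0 is the source of the two cases in \<open>cY\<close> and
  \<open>dY\<close>.\<close>

lemma series_v_pred:
  assumes "-1 \<le> j" "j < int q - 1" "M + 1 = int (p ^ s) * a + int i" "i < p ^ s"
  shows "series (v j (M - 1))
    = (if i = 0 then G (p ^ s - 1) (nat (j + 1)) (a - 1) else G (i - 1) (nat (j + 1)) a)"
proof (cases "i = 0")
  case True
  have "M - 1 + 1 = int (p ^ s) * (a - 1) + int (p ^ s - 1)"
    using assms(3) True ps_pos by (simp add: right_diff_distrib of_nat_diff Suc_le_eq del: of_nat_power)
  then show ?thesis using series_v'[OF assms(1,2), of "M - 1" "a - 1" "p ^ s - 1"] True ps_pos by simp
next
  case False
  then have "M - 1 + 1 = int (p ^ s) * a + int (i - 1)" using assms(3) by simp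
  then show ?thesis using series_v'[OF assms(1,2), of "M - 1" a "i - 1"] False assms(4) by simp
qed

lemma br_gY_0: "br (v 0 M) gY = fun_scale (cY M) (v (int q - 2) (M - 1))"
proof -
  obtain i a where M: "M + 1 = int (p ^ s) * a + int i" "i < p ^ s"
    "(M + 1) mod int (p ^ s) = int i" "(M + 1) div int (p ^ s) = a" by (rule quotient_decomp)
  have nat: "nat (0 + 1) = 1" "nat (int q - 2 + 1) = q - 1" by (simp, linarith)
  have "series (br (v 0 M) gY) = hbr (G i 1 a) (G 0 (q - 1) 0)"
    using q_gt_2 M series_v'[of 0 M a i] unfolding series_br[OF v_mem gY_mem] series_gY nat
    by (simp del: One_nat_def of_nat_power)
  also have "\<dots> = hscalar (cY M) * series (v (int q - 2) (M - 1))"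
    using series_v_pred[of "int q - 2" M a i] q_gt_2 M hbracket_Y_pos(2)[of i a] hbracket_Y_0(2)[of a]
    unfolding nat by (cases "i = 0") (simp_all add: cY_def del: One_nat_def of_nat_power)
  finally show ?thesis by (simp flip: series_scale add: series_eq_iff)
qed

lemma br_gY_1: "br (v (-1) M) gY = fun_scale (dY M) (v (int q - 3) (M - 1))"
proof -
  obtain i a where M: "M + 1 = int (p ^ s) * a + int i" "i < p ^ s"
    "(M + 1) mod int (p ^ s) = int i" "(M + 1) div int (p ^ s) = a" by (rule quotient_decomp)
  have nat: "nat (-1 + 1) = 0" "nat (int q - 3 + 1) = q - 2" by (simp, linarith)
  have "series (br (v (-1) M) gY) = hbr (G i 0 a) (G 0 (q - 1) 0)"
    using q_gt_2 M series_v'[of "-1" M a i] unfolding series_br[OF v_mem gY_mem] series_gY nat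
    by (simp del: One_nat_def of_nat_power)
  also have "\<dots> = hscalar (dY M) * series (v (int q - 3) (M - 1))"
    using series_v_pred[of "int q - 3" M a i] q_gt_2 M hbracket_Y_pos(1)[of i a] hbracket_Y_0(1)[of a]
    unfolding nat by (cases "i = 0") (simp_all add: dY_def hscalar_uminus del: One_nat_def of_nat_power)
  finally show ?thesis by (simp flip: series_scale add: series_eq_iff)
qed

section \<open>The homogeneous components and the covering property\<close>

text \<open>With \<open>A = q - 1\<close> the congruence says that \<open>N\<close> divides
  \<open>A * (M + t) + (j + 1 + r)\<close>. Then \<open>A\<close> divides \<open>j + 1 + r\<close>,
  which lies in \<open>[0, 2 A)\<close>, so it is 0 or \<open>A\<close>, and \<open>A\<close>
  cancels.\<close>

lemma cong_N_iff:
  fixes t r j M :: int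
  assumes "-1 \<le> j" "j < int q - 1" "0 \<le> r" "r < int q - 1"
  shows "[- (int q - 1) * M - j = t * (int q - 1) + 1 + r] (mod N) \<longleftrightarrow>
    j = int q - 2 - r \<and> [M = - t - 1] (mod int (p ^ (s + 1))) \<or>
    j = -1 \<and> r = 0 \<and> [M = - t] (mod int (p ^ (s + 1)))"
proof -
  define A where "A = int q - 1"
  define R where "R = int (p ^ (s + 1))"
  have A: "A > 0" using q_gt_2 by (simp add: A_def del: of_nat_power)
  have N: "N = A * R" using q_gt_2 by (simp add: A_def R_def of_nat_diff)
  have eq: "[- A * M - j = t * A + 1 + r] (mod N) \<longleftrightarrow> A * R dvd A * (M + t) + (j + 1 + r)"
  proof -
    have "- A * M - j - (t * A + 1 + r) = - (A * (M + t) + (j + 1 + r))"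
      by (simp add: algebra_simps)
    then show ?thesis unfolding cong_iff_dvd_diff N by (simp only: dvd_minus_iff)
  qed
  have 0: "A * R dvd A * (M + t) + 0 \<longleftrightarrow> [M = - t] (mod R)"
    using A by (simp add: cong_iff_dvd_diff)
  have 1: "A * R dvd A * (M + t) + A \<longleftrightarrow> [M = - t - 1] (mod R)"
  proof -
    have "A * (M + t) + A = A * (M - (- t - 1))" by (simp add: algebra_simps)
    then show ?thesis using A by (simp add: cong_iff_dvd_diff del: diff_minus_eq_add)
  qed
  have "j + 1 + r = 0 \<or> j + 1 + r = A" if "A * R dvd A * (M + t) + (j + 1 + r)"
  proof -
    have "A dvd j + 1 + r" using that by (metis dvd_add_right_iff dvd_mult_left dvd_triv_left)
    then obtain k where k: "j + 1 + r = A * k" by blast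
    have "0 \<le> A * k" "A * k < A * 2" using assms k by (auto simp: A_def simp del: of_nat_power)
    then have "0 \<le> k" "k < 2" using A by (simp_all add: zero_le_mult_iff)
    then have "k = 0 \<or> k = 1" by auto
    then show ?thesis using k by auto
  qed
  moreover have "j + 1 + r = 0 \<longleftrightarrow> j = -1 \<and> r = 0" using assms by auto
  moreover have "j + 1 + r = A \<longleftrightarrow> j = int q - 2 - r" by (auto simp: A_def)
  ultimately show ?thesis
    using 0 1 eq unfolding A_def[symmetric] R_def[symmetric] by (metis (no_types, lifting))
qed

lemma S_component:
  assumes "0 \<le> r" "r < int q - 1"
  shows "S (t * (int q - 1) + 1 + r)
    = span (insert (v (int q - 2 - r) (- t - 1)) (if r = 0 then {v (-1) (- t)} else {}))"
proof -
  have "{v j M |j M. -1 \<le> j \<and> j < int q - 1 \<and> [- (int q - 1) * M - j = t * (int q - 1) + 1 + r] (mod N)}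
    = insert (v (int q - 2 - r) (- t - 1)) (if r = 0 then {v (-1) (- t)} else {})" (is "?L = ?R")
  proof (intro equalityI subsetI)
    fix x assume "x \<in> ?L"
    then obtain j M where x: "x = v j M" "-1 \<le> j" "j < int q - 1"
      "[- (int q - 1) * M - j = t * (int q - 1) + 1 + r] (mod N)" by blast
    from x(4) show "x \<in> ?R"
      unfolding cong_N_iff[OF x(2,3) assms] x(1) using v_cong by auto
  next
    fix x assume "x \<in> ?R"
    then consider "x = v (int q - 2 - r) (- t - 1)" | "r = 0" "x = v (-1) (- t)"
      by (auto split: if_splits)
    then show "x \<in> ?L"
    proof cases
      case 1
      have j: "-1 \<le> int q - 2 - r" "int q - 2 - r < int q - 1" using assms by auto
      have "[- (int q - 1) * (- t - 1) - (int q - 2 - r) = t * (int q - 1) + 1 + r] (mod N)"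
        unfolding cong_N_iff[OF j assms] by simp
      then show ?thesis using 1 j by blast
    next
      case 2
      have j: "-1 \<le> (-1 :: int)" "-1 < int q - 1" using q_gt_2 by (auto simp del: of_nat_power)
      have "[- (int q - 1) * (- t) - (-1) = t * (int q - 1) + 1 + r] (mod N)"
        unfolding cong_N_iff[OF j assms] using 2 by simp
      then show ?thesis using 2 j by blast
    qed
  qed
  then show ?thesis unfolding S_eq by (rule arg_cong)
qed

lemma S_line: "0 < r \<Longrightarrow> r < int q - 1 \<Longrightarrow>
    S (t * (int q - 1) + 1 + r) = span {v (int q - 2 - r) (- t - 1)}"
  using S_component[of r t] by simp

lemma S_diamond: "S (t * (int q - 1) + 1) = span {v (-1) (- t), v (int q - 2) (- t - 1)}"
  using S_component[of 0 t] q_gt_2 by (simp add: insert_commute del: of_nat_power)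

lemma S_first: "S 1 = span {gX, gY}"
  using S_diamond[of 0] by (simp add: gX_def gY_def)

lemma v_in_basis: "-1 \<le> j \<Longrightarrow> j < int q - 1 \<Longrightarrow> v j M \<in> e ` Ind"
  unfolding v_def using idx_mem by blast

lemma v_nonzero: "-1 \<le> j \<Longrightarrow> j < int q - 1 \<Longrightarrow> v j M \<noteq> 0"
  using v_in_basis[of j M] e_basis(2) dependent_zero by metis

lemma v_pair:
  "v (-1) M \<noteq> v (int q - 2) M'" "independent {v (-1) M, v (int q - 2) M'}"
proof -
  have j: "-1 \<le> (-1 :: int)" "-1 < int q - 1" "-1 \<le> int q - 2" "int q - 2 < int q - 1"
    using q_gt_2 by (auto simp del: of_nat_power)
  show "v (-1) M \<noteq> v (int q - 2) M'"
  proof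
    assume "v (-1) M = v (int q - 2) M'"
    then have "idx (-1) M = idx (int q - 2) M'"
      unfolding v_def using inj_onD[OF e_basis(1)] idx_mem j by blast
    then have "-1 = int q - 2" by (simp only: idx_def prod.inject)
    then show False using q_gt_2 by linarith
  qed
  show "independent {v (-1) M, v (int q - 2) M'}"
    by (rule independent_mono[OF e_basis(2)]) (use v_in_basis j in auto)
qed

lemma independent_gens: "fun_scale c gX + fun_scale d gY = 0 \<Longrightarrow> c = 0 \<and> d = 0"
proof -
  assume eq: "fun_scale c gX + fun_scale d gY = 0"
  note pair = v_pair[of 0 "-1", folded gX_def gY_def]
  have "independent {gX, gY}" by (rule pair)
  from independentD[OF this, of "{gX, gY}" "\<lambda>w. if w = gX then c else d"] eq pair(1)
  have "w \<in> {gX, gY} \<Longrightarrow> (if w = gX then c else d) = 0" for w by auto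
  from this[of gX] this[of gY] show ?thesis using pair(1) by simp
qed

lemma degree_cases:
  obtains (diamond) t where "d = t * (int q - 1) + 1"
  | (line) t r where "d = t * (int q - 1) + 1 + r" "0 < r" "r < int q - 1"
proof -
  have A: "int q - 1 > 0" using q_gt_2 by (simp del: of_nat_power)
  define t where "t = (d - 1) div (int q - 1)"
  define r where "r = (d - 1) mod (int q - 1)"
  have "d - 1 = t * (int q - 1) + r" unfolding t_def r_def by (rule div_mult_mod_eq[symmetric])
  moreover have "0 \<le> r" "r < int q - 1" using A by (simp_all add: r_def del: of_nat_power)
  ultimately show thesis
    using diamond[of t] line[of t r] by (cases "r = 0") auto
qed

lemma dim_S_diamond: "dim (S (t * (int q - 1) + 1)) = 2"
  unfolding S_diamond using v_pair dim_span_eq_card_independent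
  by (simp add: dim_eq_card_independent card_insert_if)

lemma dim_S_line:
  assumes "0 < r" "r < int q - 1"
  shows "dim (S (t * (int q - 1) + 1 + r)) = 1"
proof -
  have "-1 \<le> int q - 2 - r" "int q - 2 - r < int q - 1" using assms by auto
  then have "{v (int q - 2 - r) (- t - 1)} \<subseteq> e ` Ind"
    using v_in_basis by blast
  then have "independent {v (int q - 2 - r) (- t - 1)}"
    by (rule independent_mono[OF e_basis(2)])
  then show ?thesis
    unfolding S_line[OF assms] by (simp add: dim_eq_card_independent)
qed

lemma H_scale: "x \<in> H \<Longrightarrow> fun_scale c x \<in> H"
  by (rule subspace_scale[OF subspace_dp_carrier])

lemma H_add: "x \<in> H \<Longrightarrow> y \<in> H \<Longrightarrow> x + y \<in> H"
  by (rule subspace_add[OF subspace_dp_carrier])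

lemmas H_closed = H_scale H_add v_mem gX_mem gY_mem

lemma br_S_first:
  assumes "u \<in> H"
  shows "br u ` S 1 = span {br u gX, br u gY}"
proof -
  have "br u (fun_scale c gX + fun_scale d gY) = fun_scale c (br u gX) + fun_scale d (br u gY)" for c d
    using assms by (simp add: br_add_right br_scale_right H_closed del: One_nat_def)
  then have "(\<exists>x\<in>span {gX, gY}. y = br u x) \<longleftrightarrow> y \<in> span {br u gX, br u gY}" for y
    unfolding mem_span_pair Bex_def by metis
  then show ?thesis
    unfolding S_first image_def by blast
qed

lemma span_scaled_singleton: "c \<noteq> 0 \<Longrightarrow> span {fun_scale c x} = span {x}"
  using span_image_scale[of "{x}" "\<lambda>_. c"] by simp

lemma S_covering:
  assumes "u \<in> S d" "u \<noteq> 0"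
  shows "S (d + 1) = br u ` S 1"
proof (cases d rule: degree_cases)
  case (diamond t)
  have A: "0 < (1 :: int)" "1 < int q - 1" using q_gt_2 by (auto simp del: of_nat_power)
  obtain a b where u: "u = fun_scale a (v (-1) (- t)) + fun_scale b (v (int q - 2) (- t - 1))"
    using assms(1) unfolding diamond S_diamond mem_span_pair by blast
  \<comment> \<open>\<open>X\<close> kills the first summand of \<open>u\<close> and
    \<open>Y\<close> the second; the other images lie on the same line, so \<open>a\<close> and
    \<open>b\<close> cannot both go unseen.\<close>
  have "br u gX = fun_scale b (v (int q - 3) (- t - 1))"
    unfolding u using br_gX[of "int q - 2" "- t - 1"] q_gt_2
    by (simp add: br_add_left br_scale_left br_gX_0 H_closed del: of_nat_power One_nat_def)
  moreover have "br u gY = fun_scale (a * dY (- t)) (v (int q - 3) (- t - 1))"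
    unfolding u using br_gY[of "int q - 2" "- t - 1"] q_gt_2
    by (simp add: br_add_left br_scale_left br_gY_1 H_closed del: of_nat_power One_nat_def)
  moreover have "b \<noteq> 0 \<or> a \<noteq> 0" using assms(2) u by auto
  moreover have "span {fun_scale b w, fun_scale c w} = span {w}" if "b \<noteq> 0 \<or> c \<noteq> 0" for b c :: 'a and w
  proof (rule span_eq[THEN iffD2], intro conjI)
    show "{fun_scale b w, fun_scale c w} \<subseteq> span {w}"
      by (auto intro: span_scale span_base)
    have "w \<in> span {fun_scale b w, fun_scale c w}"
    proof (cases "b = 0")
      case True
      then have "w = fun_scale (1 / c) (fun_scale c w)" using that by simp
      then show ?thesis by (metis span_base span_scale insertI1 insertI2)
    next
      case False
      then have "w = fun_scale (1 / b) (fun_scale b w)" by simp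
      then show ?thesis by (metis span_base span_scale insertI1)
    qed
    then show "{w} \<subseteq> span {fun_scale b w, fun_scale c w}" by simp
  qed
  ultimately have "br u ` S 1 = span {v (int q - 3) (- t - 1)}"
    using dY_nonzero[of "- t"] br_S_first[of u] u by (simp add: H_closed del: One_nat_def of_nat_power)
  then show ?thesis unfolding diamond S_line[OF A] by simp
next
  case (line t r)
  let ?j = "int q - 2 - r"
  obtain c where u: "u = fun_scale c (v ?j (- t - 1))"
    using assms(1) unfolding line(1) S_line[OF line(2,3)] span_singleton by blast
  then have c: "c \<noteq> 0" using assms(2) by auto
  have uH: "u \<in> H" unfolding u by (intro H_closed)
  have uX: "br u gX = fun_scale c (v (?j - 1) (- t - 1))"
    unfolding u br_scale_left[OF v_mem gX_mem] using br_gX[of ?j "- t - 1"] line by simp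
  show ?thesis
  proof (cases "r = int q - 2")
    \<comment> \<open>Here \<open>j = 0\<close>, the degree just below a diamond, and
      \<open>X\<close> and \<open>Y\<close> produce its two basis elements.\<close>
    case True
    have "br u gY = fun_scale (c * cY (- t - 1)) (v (int q - 2) (- t - 2))"
    proof -
      have "- t - 1 - 1 = - t - 2" "?j = 0" using True by simp_all
      then show ?thesis
        unfolding u br_scale_left[OF v_mem gY_mem] using br_gY_0[of "- t - 1"]
        by (simp only: scale_scale)
    qed
    then have "br u ` S 1 = span ((\<lambda>w. fun_scale (if w = v (-1) (- t - 1) then c else c * cY (- t - 1)) w)
        ` {v (-1) (- t - 1), v (int q - 2) (- t - 2)})"
      using br_S_first[OF uH] uX True v_pair(1)[of "- t - 1" "- t - 2"] by (simp del: of_nat_power)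
    also have "\<dots> = span {v (-1) (- t - 1), v (int q - 2) (- t - 2)}"
      by (rule span_image_scale) (use c cY_nonzero in auto)
    also have "\<dots> = S (d + 1)"
    proof -
      have "- t - 1 = - (t + 1)" "- t - 2 = - (t + 1) - 1" "d + 1 = (t + 1) * (int q - 1) + 1"
        using line(1) True by (simp_all add: algebra_simps del: of_nat_power)
      then show ?thesis by (simp only: S_diamond)
    qed
    finally show ?thesis ..
  next
    case False
    then have "br u gY = 0"
      unfolding u br_scale_left[OF v_mem gY_mem] using br_gY[of ?j "- t - 1"] line by simp
    then have "br u ` S 1 = span {v (?j - 1) (- t - 1)}"
      using br_S_first[OF uH] uX span_scaled_singleton[OF c] by (simp add: insert_commute)
    also have "\<dots> = S (d + 1)"
    proof -
      have "?j - 1 = int q - 2 - (r + 1)" "d + 1 = t * (int q - 1) + 1 + (r + 1)"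
        using line(1) by simp_all
      moreover have "0 < r + 1" "r + 1 < int q - 1" using line False by auto
      ultimately show ?thesis by (simp only: S_line)
    qed
    finally show ?thesis ..
  qed
qed

lemma S_nonzero: "S d \<noteq> {0}"
proof
  assume "S d = {0}"
  then have "S d = span {}" by simp
  then have "dim (S d) = 0" by (simp only: dim_span_eq_card_independent[OF independent_empty] card.empty)
  then show False
    by (cases d rule: degree_cases) (simp_all only: dim_S_diamond dim_S_line zero_neq_numeral[symmetric] one_neq_zero)
qed

sublocale thin_cyclic_grading "fun_scale :: 'a \<Rightarrow> _" H br N S
proof -
  have "\<exists>k>1. dim (S (int k)) = 2"
    using dim_S_diamond[of 1] q_gt_2 by (intro exI[of _ q]) simp
  moreover have "dim (S 1) = 2"
    using dim_S_diamond[of 0] by simp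
  moreover have "cyclic_grading fun_scale H br N S"
    by (intro cyclic_grading.intro cyclic_grading_axioms.intro grading N_pos S_mod)
  ultimately show "thin_cyclic_grading fun_scale H br N S"
    by (intro thin_cyclic_grading.intro thin_cyclic_grading_axioms.intro S_nonzero S_covering)
qed

section \<open>Diamonds and their types\<close>

abbreviation lscale :: "'a \<Rightarrow> (nat \<times> nat \<Rightarrow> 'a) poly \<Rightarrow> (nat \<times> nat \<Rightarrow> 'a) poly" where
  "lscale \<equiv> loop_scale fun_scale"

abbreviation lbr :: "(nat \<times> nat \<Rightarrow> 'a) poly \<Rightarrow> (nat \<times> nat \<Rightarrow> 'a) poly \<Rightarrow> (nat \<times> nat \<Rightarrow> 'a) poly"
  where "lbr \<equiv> loop_bracket br"

abbreviation C :: "nat \<Rightarrow> (nat \<times> nat \<Rightarrow> 'a) poly set" where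
  "C \<equiv> power_component (loop_algebra fun_scale H br S)"

lemma int_q_minus_1: "int (q - 1) = int q - 1"
  using q_gt_2 by linarith

lemma is_diamond_iff: "is_diamond lscale C i \<longleftrightarrow> (\<exists>t. i = t * (q - 1) + 1)"
proof
  assume "is_diamond lscale C i"
  then have i: "i > 0" "loop.dim (C i) = 2"
    unfolding is_diamond_def by linarith+
  then have dim: "dim (S (int i)) = 2" using dim_loop_component by metis
  show "\<exists>t. i = t * (q - 1) + 1"
  proof (cases "int i" rule: degree_cases)
    case (diamond t)
    have "t \<ge> 0"
    proof (rule ccontr)
      assume "\<not> t \<ge> 0"
      then have t: "t \<le> -1" by simp
      define A where "A = int q - 1"
      have A: "A > 1" using q_gt_2 by (simp add: A_def del: of_nat_power)
      then have "t * A \<le> (-1) * A" using t by (intro mult_right_mono) auto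
      then have "int i \<le> 0" using A diamond unfolding A_def[symmetric] by linarith
      then show False using i(1) by simp
    qed
    then obtain k where "t = int k" by (metis nonneg_int_cases)
    then have "int i = int (k * (q - 1) + 1)"
      using diamond by (simp only: of_nat_add of_nat_mult int_q_minus_1 of_nat_1)
    then show ?thesis by (metis of_nat_eq_iff)
  next
    case (line t r)
    have "dim (S (int i)) = 1" unfolding line(1) by (rule dim_S_line[OF line(2,3)])
    then show ?thesis using dim by simp
  qed
next
  assume "\<exists>t. i = t * (q - 1) + 1"
  then obtain t where t: "i = t * (q - 1) + 1" by blast
  then have "int i = int t * (int q - 1) + 1"
    by (simp only: of_nat_add of_nat_mult int_q_minus_1 of_nat_1)
  then have "dim (S (int i)) = 2" by (simp only: dim_S_diamond)
  moreover have "i > 0" using t by simp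
  ultimately show "is_diamond lscale C i"
    unfolding is_diamond_def using dim_loop_component[OF \<open>i > 0\<close>] by simp
qed

lemma second_diamond_eq: "second_diamond lscale C = q"
  unfolding second_diamond_def
proof (rule Least_equality)
  show "q > 1 \<and> is_diamond lscale C q"
    unfolding is_diamond_iff using q_gt_2 by (auto intro!: exI[of _ 1])
  fix i assume "i > 1 \<and> is_diamond lscale C i"
  then obtain t where "i = t * (q - 1) + 1" "i > 1" unfolding is_diamond_iff by blast
  then show "q \<le> i" by (cases t) auto
qed

text \<open>Below a diamond, bracketing with \<open>X\<close> then \<open>Y\<close> gives the scalar
  \<open>dY M\<close>, with \<open>Y\<close> then \<open>X\<close> the scalar \<open>cY M\<close>,
  and with \<open>X\<close> twice or \<open>Y\<close> twice 0, all on one line. Hence the type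
  depends only on the ratio of these scalars.\<close>

lemma double_bracket:
  "br (br (v 0 M) (fun_scale a gX + fun_scale b gY)) (fun_scale c gX + fun_scale d gY)
    = fun_scale (a * d * dY M + b * c * cY M) (v (int q - 3) (M - 1))"
proof -
  have q: "0 \<le> int q - 2" "int q - 2 < int q - 1" "1 \<le> int q - 2" "0 < int q - 1" "int q - 2 - 1 = int q - 3"
    using q_gt_2 by (simp_all del: of_nat_power)
  have "br (v 0 M) (fun_scale a gX + fun_scale b gY)
      = fun_scale a (v (-1) M) + fun_scale (b * cY M) (v (int q - 2) (M - 1))"
    using br_gX[of 0 M] q
    by (simp add: br_add_right br_scale_right br_gY_0 H_closed del: of_nat_power One_nat_def)
  then show ?thesis
    using br_gX[of "int q - 2" "M - 1"] br_gY[of "int q - 2" "M - 1"] q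
    by (simp add: br_add_left br_scale_left br_add_right br_scale_right br_gX_0 br_gY_1 H_closed
        del: of_nat_power One_nat_def)
      (simp add: scale_left_distrib ac_simps)
qed

abbreviation gen :: "'a \<Rightarrow> 'a \<Rightarrow> (nat \<times> nat \<Rightarrow> 'a) poly" where
  "gen a b \<equiv> monom (fun_scale a gX + fun_scale b gY) 1"

lemma double_loop_bracket:
  "lbr (lbr (monom (fun_scale \<kappa> (v 0 M)) k) (gen a b)) (gen c d)
    = monom (fun_scale (\<kappa> * (a * d * dY M + b * c * cY M)) (v (int q - 3) (M - 1))) (k + 2)"
proof -
  have "br (br (fun_scale \<kappa> (v 0 M)) x) y = fun_scale \<kappa> (br (br (v 0 M) x) y)" if "x \<in> H" "y \<in> H" for x y
    using that by (simp add: br_scale_left H_closed br_closed del: One_nat_def)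
  then show ?thesis
    by (simp add: H_closed br_closed double_bracket del: One_nat_def) (simp add: numeral_2_eq_2)
qed

lemma v_q_minus_3_nonzero: "v (int q - 3) M \<noteq> 0"
  using q_gt_2 by (intro v_nonzero) (auto simp del: of_nat_power)

lemma mem_C_1: "Z \<in> C 1 \<longleftrightarrow> (\<exists>a b. Z = gen a b)"
  unfolding power_component_loop[OF zero_less_one] of_nat_1 S_first image_iff Bex_def mem_span_pair by blast

lemma gen_eq_0_iff: "gen a b = 0 \<longleftrightarrow> a = 0 \<and> b = 0"
  using independent_gens[of a b] by auto

lemma mem_C_pred_diamond:
  assumes "t \<ge> 1"
  shows "Z \<in> C (t * (q - 1)) \<longleftrightarrow> (\<exists>\<kappa>. Z = monom (fun_scale \<kappa> (v 0 (- int t))) (t * (q - 1)))"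
    "dim (S (int (t * (q - 1)))) = 1"
proof -
  have q: "0 < int q - 2" "int q - 2 < int q - 1" "int q - 2 - (int q - 2) = 0"
    using q_gt_2 by (simp_all del: of_nat_power)
  have pos: "t * (q - 1) > 0" using assms q_gt_2 by simp
  have eq: "int (t * (q - 1)) = (int t - 1) * (int q - 1) + 1 + (int q - 2)"
    unfolding of_nat_mult int_q_minus_1 by (simp add: algebra_simps del: of_nat_power)
  have "- (int t - 1) - 1 = - int t" by simp
  then have "S (int (t * (q - 1))) = span {v 0 (- int t)}"
    unfolding eq S_line[OF q(1,2)] q(3) by simp
  then show "Z \<in> C (t * (q - 1)) \<longleftrightarrow> (\<exists>\<kappa>. Z = monom (fun_scale \<kappa> (v 0 (- int t))) (t * (q - 1)))"
    unfolding power_component_loop[OF pos] by (auto simp: span_singleton)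
  show "dim (S (int (t * (q - 1)))) = 1" unfolding eq by (rule dim_S_line[OF q(1,2)])
qed

lemma all_C_pred_diamond:
  assumes "t \<ge> 1"
  shows "(\<forall>V\<in>C (t * (q - 1)). V \<noteq> 0 \<longrightarrow> P V)
    \<longleftrightarrow> (\<forall>\<kappa>. \<kappa> \<noteq> 0 \<longrightarrow> P (monom (fun_scale \<kappa> (v 0 (- int t))) (t * (q - 1))))"
proof -
  have "v 0 (- int t) \<noteq> 0" using q_gt_2 by (intro v_nonzero) (auto simp del: of_nat_power)
  then show ?thesis using mem_C_pred_diamond(1)[OF assms] by auto
qed

text \<open>Both generators are arbitrary combinations, so that one formula covers every admissible
  pair, including the interchanged one.\<close>

lemma finite_type_iff:
  assumes "t \<ge> 1"
  shows "finite_type lscale lbr C (gen a b) (gen c d) (t * (q - 1) + 1) \<mu> \<longleftrightarrow>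
    c * d * (dY (- int t) + cY (- int t)) = 0 \<and> a * b * (dY (- int t) + cY (- int t)) = 0 \<and>
    (1 - \<mu>) * (a * d * dY (- int t) + b * c * cY (- int t))
      = \<mu> * (c * b * dY (- int t) + d * a * cY (- int t))"
proof -
  have pos: "t * (q - 1) > 0" using assms q_gt_2 by simp
  have "loop.dim (C (t * (q - 1))) = 1"
    using dim_loop_component[OF pos] mem_C_pred_diamond(2)[OF assms] by simp
  moreover have "is_diamond lscale C (t * (q - 1) + 1)" unfolding is_diamond_iff by blast
  ultimately have "finite_type lscale lbr C (gen a b) (gen c d) (t * (q - 1) + 1) \<mu> \<longleftrightarrow>
    (\<forall>\<kappa>. \<kappa> \<noteq> 0 \<longrightarrow>
      \<kappa> * (c * d * dY (- int t) + d * c * cY (- int t)) = 0 \<and>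
      \<kappa> * (a * b * dY (- int t) + b * a * cY (- int t)) = 0 \<and>
      (1 - \<mu>) * (\<kappa> * (a * d * dY (- int t) + b * c * cY (- int t)))
        = \<mu> * (\<kappa> * (c * b * dY (- int t) + d * a * cY (- int t))))"
    unfolding finite_type_def diff_add_inverse2 all_C_pred_diamond[OF assms] double_loop_bracket
    using pos v_q_minus_3_nonzero[of "- int t - 1"]
    by (simp only: loop_scale_monom monom_eq_iff monom_eq_0_iff scale_scale scale_cancel_right
        scale_eq_0_iff) simp
  also have "\<dots> \<longleftrightarrow> c * d * dY (- int t) + d * c * cY (- int t) = 0 \<and>
      a * b * dY (- int t) + b * a * cY (- int t) = 0 \<and>
      (1 - \<mu>) * (a * d * dY (- int t) + b * c * cY (- int t)) = \<mu> * (c * b * dY (- int t) + d * a * cY (- int t))"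
    by (rule all_nonzero_scalar)
  also have "\<dots> \<longleftrightarrow> c * d * (dY (- int t) + cY (- int t)) = 0 \<and> a * b * (dY (- int t) + cY (- int t)) = 0 \<and>
    (1 - \<mu>) * (a * d * dY (- int t) + b * c * cY (- int t))
      = \<mu> * (c * b * dY (- int t) + d * a * cY (- int t))"
  proof -
    have eqs: "c * d * dY (- int t) + d * c * cY (- int t) = c * d * (dY (- int t) + cY (- int t))"
      "a * b * dY (- int t) + b * a * cY (- int t) = a * b * (dY (- int t) + cY (- int t))"
      by (simp_all add: algebra_simps)
    show ?thesis unfolding eqs by simp
  qed
  finally show ?thesis .
qed

lemma uminus_poly: "- F = lscale (- 1) F"
  by (rule poly_eqI) simp

lemma infinite_type_iff:
  assumes "t \<ge> 1"
  shows "infinite_type lscale lbr C (gen a b) (gen c d) (t * (q - 1) + 1) \<longleftrightarrow>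
    c * d * (dY (- int t) + cY (- int t)) = 0 \<and> a * b * (dY (- int t) + cY (- int t)) = 0 \<and>
    - (a * d * dY (- int t) + b * c * cY (- int t)) = c * b * dY (- int t) + d * a * cY (- int t)"
proof -
  have pos: "t * (q - 1) > 0" using assms q_gt_2 by simp
  have "loop.dim (C (t * (q - 1))) = 1"
    using dim_loop_component[OF pos] mem_C_pred_diamond(2)[OF assms] by simp
  moreover have "is_diamond lscale C (t * (q - 1) + 1)" unfolding is_diamond_iff by blast
  ultimately have "infinite_type lscale lbr C (gen a b) (gen c d) (t * (q - 1) + 1) \<longleftrightarrow>
    (\<forall>\<kappa>. \<kappa> \<noteq> 0 \<longrightarrow>
      \<kappa> * (c * d * dY (- int t) + d * c * cY (- int t)) = 0 \<and>
      \<kappa> * (a * b * dY (- int t) + b * a * cY (- int t)) = 0 \<and>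
      (- 1) * (\<kappa> * (a * d * dY (- int t) + b * c * cY (- int t)))
        = \<kappa> * (c * b * dY (- int t) + d * a * cY (- int t)))"
    unfolding infinite_type_def diff_add_inverse2 all_C_pred_diamond[OF assms] double_loop_bracket uminus_poly
    using pos v_q_minus_3_nonzero[of "- int t - 1"]
    by (simp only: loop_scale_monom monom_eq_iff monom_eq_0_iff scale_scale scale_cancel_right
        scale_eq_0_iff) simp
  also have "\<dots> \<longleftrightarrow> c * d * dY (- int t) + d * c * cY (- int t) = 0 \<and>
      a * b * dY (- int t) + b * a * cY (- int t) = 0 \<and>
      (- 1) * (a * d * dY (- int t) + b * c * cY (- int t)) = c * b * dY (- int t) + d * a * cY (- int t)"
    by (rule all_nonzero_scalar[where m = 1, unfolded mult_1])
  also have "\<dots> \<longleftrightarrow> c * d * (dY (- int t) + cY (- int t)) = 0 \<and> a * b * (dY (- int t) + cY (- int t)) = 0 \<and>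
    - (a * d * dY (- int t) + b * c * cY (- int t)) = c * b * dY (- int t) + d * a * cY (- int t)"
  proof -
    have eqs: "c * d * dY (- int t) + d * c * cY (- int t) = c * d * (dY (- int t) + cY (- int t))"
      "a * b * dY (- int t) + b * a * cY (- int t) = a * b * (dY (- int t) + cY (- int t))"
      by (simp_all add: algebra_simps)
    show ?thesis unfolding eqs by simp
  qed
  finally show ?thesis .
qed

lemma gen_eq_iff: "gen a b = gen c d \<longleftrightarrow> a = c \<and> b = d"
proof -
  have "gen a b = gen c d \<longleftrightarrow> fun_scale (a - c) gX + fun_scale (b - d) gY = 0"
    by (simp add: scale_left_diff_distrib algebra_simps)
  also have "\<dots> \<longleftrightarrow> a - c = 0 \<and> b - d = 0"
    using independent_gens[of "a - c" "b - d"] by auto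
  finally show ?thesis by simp
qed

lemma scale_gen: "lscale k (gen a b) = gen (k * a) (k * b)"
  by (simp add: scale_right_distrib)

lemma mem_span_gen: "gen a b \<in> loop.span {gen c d} \<longleftrightarrow> (\<exists>k. a = k * c \<and> b = k * d)"
  unfolding loop.span_singleton image_iff Bex_def scale_gen gen_eq_iff by blast

text \<open>Degree 2 is spanned by \<open>v (q - 3) (-1)\<close>. For \<open>q > 3\<close> it is
  killed by \<open>Y\<close>, as \<open>q - 3 \<ge> 1\<close>, while \<open>X\<close> lowers its
  first index to \<open>q - 4 \<ge> -1\<close>.\<close>

lemma kills_C_2:
  assumes "q > 3"
  shows "(\<forall>u\<in>C 2. lbr u (gen c d) = 0) \<longleftrightarrow> c = 0"
proof -
  have q: "(0 :: int) < 1" "1 < int q - 1" "0 \<le> int q - 3" "1 \<le> int q - 3" "int q - 3 < int q - 1"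
    "int q - 3 - 1 = int q - 4" "-1 \<le> int q - 4" "int q - 4 < int q - 1"
    using assms by (simp_all del: of_nat_power)
  have "br (v (int q - 3) (-1)) (fun_scale c gX + fun_scale d gY) = fun_scale c (v (int q - 4) (-1))"
    using br_gX[of "int q - 3" "-1"] br_gY[of "int q - 3" "-1"] q
    by (simp add: br_add_right br_scale_right H_closed del: of_nat_power One_nat_def)
  then have br2: "lbr (monom (fun_scale \<kappa> (v (int q - 3) (-1))) 2) (gen c d)
      = monom (fun_scale (\<kappa> * c) (v (int q - 4) (-1))) (2 + 1)" for \<kappa>
    by (simp add: H_closed br_scale_left del: One_nat_def)
  have "S (int 2) = span {v (int q - 3) (-1)}"
    using S_line[OF q(1,2), of 0] by simp
  then have mem: "u \<in> C 2 \<longleftrightarrow> (\<exists>\<kappa>. u = monom (fun_scale \<kappa> (v (int q - 3) (-1))) 2)" for u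
    unfolding power_component_loop[OF zero_less_numeral] by (auto simp: span_singleton)
  have "(\<forall>u\<in>C 2. lbr u (gen c d) = 0)
      \<longleftrightarrow> (\<forall>\<kappa>. lbr (monom (fun_scale \<kappa> (v (int q - 3) (-1))) 2) (gen c d) = 0)"
    unfolding Ball_def mem by blast
  also have "\<dots> \<longleftrightarrow> (\<forall>\<kappa>. \<kappa> * c = 0)"
    unfolding br2 using v_nonzero[OF q(7,8), of "-1"] by (simp only: monom_eq_0_iff scale_eq_0_iff) simp
  also have "\<dots> \<longleftrightarrow> c = 0" by (metis mult_1 mult_zero_right)
  finally show ?thesis .
qed

text \<open>The ratio -2 is exactly the normalization imposed on the generators at the second
  diamond, which thereby gets type -1 for the standard pair.\<close>

lemma dY_first: "dY (- 1) = - (\<sigma> * \<pi>)" and cY_first: "cY (- 1) = 2 * (\<sigma> * \<pi>)"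
  by (simp_all add: dY_def cY_def)

lemma diamond_generators_gen:
  "diamond_generators lscale lbr C (gen a b) (gen c d) \<longleftrightarrow>
    \<not> (c = 0 \<and> d = 0) \<and> (\<nexists>k. a = k * c \<and> b = k * d) \<and> (q > 3 \<longrightarrow> c = 0) \<and> a * b = 0 \<and> c * d = 0 \<and>
    c * b * dY (- 1) + d * a * cY (- 1) = - 2 * (a * d * dY (- 1) + b * c * cY (- 1))"
proof -
  \<comment> \<open>The sum is \<open>\<sigma> * \<pi>\<close>. Being nonzero, it lets the vanishing
    of both double brackets force \<open>a * b = 0\<close> and \<open>c * d = 0\<close>.\<close>
  have D: "dY (- 1) + cY (- 1) \<noteq> 0"
    using sigma_nonzero pi_nonzero by (simp add: dY_first cY_first)
  have w: "v (int q - 3) (- 1 - 1) \<noteq> 0" by (rule v_q_minus_3_nonzero)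
  have "(\<forall>V\<in>C (q - 1). V \<noteq> 0 \<longrightarrow>
        lbr (lbr V (gen a b)) (gen a b) = 0 \<and> lbr (lbr V (gen c d)) (gen c d) = 0 \<and>
        lbr (lbr V (gen c d)) (gen a b) = lscale (- 2) (lbr (lbr V (gen a b)) (gen c d)))
    \<longleftrightarrow> (\<forall>\<kappa>. \<kappa> \<noteq> 0 \<longrightarrow>
      \<kappa> * (a * b * dY (- 1) + b * a * cY (- 1)) = 0 \<and>
      \<kappa> * (c * d * dY (- 1) + d * c * cY (- 1)) = 0 \<and>
      \<kappa> * (c * b * dY (- 1) + d * a * cY (- 1)) = (- 2) * (\<kappa> * (a * d * dY (- 1) + b * c * cY (- 1))))"
    using all_C_pred_diamond[of 1] w unfolding mult_1 of_nat_1
    by (simp only: order.refl double_loop_bracket loop_scale_monom monom_eq_iff monom_eq_0_iff scale_scale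
        scale_cancel_right scale_eq_0_iff) simp
  also have "\<dots> \<longleftrightarrow> a * b * dY (- 1) + b * a * cY (- 1) = 0 \<and>
      c * d * dY (- 1) + d * c * cY (- 1) = 0 \<and>
      c * b * dY (- 1) + d * a * cY (- 1) = (- 2) * (a * d * dY (- 1) + b * c * cY (- 1))"
    by (rule all_nonzero_scalar[where k = 1, unfolded mult_1])
  also have "\<dots> \<longleftrightarrow> a * b = 0 \<and> c * d = 0 \<and>
      c * b * dY (- 1) + d * a * cY (- 1) = - 2 * (a * d * dY (- 1) + b * c * cY (- 1))"
  proof -
    have eqs: "c * d * dY (- 1) + d * c * cY (- 1) = c * d * (dY (- 1) + cY (- 1))"
      "a * b * dY (- 1) + b * a * cY (- 1) = a * b * (dY (- 1) + cY (- 1))"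
      by (simp_all add: algebra_simps)
    show ?thesis unfolding eqs using D by simp
  qed
  finally have rel: "(\<forall>V\<in>C (q - 1). V \<noteq> 0 \<longrightarrow>
        lbr (lbr V (gen a b)) (gen a b) = 0 \<and> lbr (lbr V (gen c d)) (gen c d) = 0 \<and>
        lbr (lbr V (gen c d)) (gen a b) = lscale (- 2) (lbr (lbr V (gen a b)) (gen c d)))
    \<longleftrightarrow> a * b = 0 \<and> c * d = 0 \<and>
      c * b * dY (- 1) + d * a * cY (- 1) = - 2 * (a * d * dY (- 1) + b * c * cY (- 1))" .
  have C2: "(q > 3 \<longrightarrow> (\<forall>u\<in>C 2. lbr u (gen c d) = 0)) \<longleftrightarrow> (q > 3 \<longrightarrow> c = 0)"
    using kills_C_2 by simp
  have mem: "gen a b \<in> C 1" "gen c d \<in> C 1"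
    unfolding mem_C_1 by blast+
  show ?thesis
    unfolding diamond_generators_def second_diamond_eq mem_span_gen gen_eq_0_iff rel C2
    by (simp only: mem simp_thms)
qed

text \<open>Since \<open>a * b = 0\<close> and \<open>c * d = 0\<close>, independence leaves only
  scaled or interchanged standard generators. Interchange does occur for \<open>q = 3\<close>: it
  replaces the ratio -2 by its inverse, and 4 = 1 in characteristic 3.\<close>

lemma diamond_generators_cases:
  assumes "diamond_generators lscale lbr C X Y"
  obtains a d where "X = gen a 0" "Y = gen 0 d" "a \<noteq> 0" "d \<noteq> 0"
  | b c where "X = gen 0 b" "Y = gen c 0" "b \<noteq> 0" "c \<noteq> 0" "q = 3"
proof -
  obtain a b c d where XY: "X = gen a b" "Y = gen c d"
    using assms unfolding diamond_generators_def mem_C_1 by blast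
  have h: "\<not> (c = 0 \<and> d = 0)" "\<nexists>k. a = k * c \<and> b = k * d" "q > 3 \<longrightarrow> c = 0" "a * b = 0" "c * d = 0"
    using assms unfolding XY diamond_generators_gen by blast+
  have q3: "q = 3" if "c \<noteq> 0" using h(3) that q_gt_2 by linarith
  have ab: "\<not> (a = 0 \<and> b = 0)" using h(2) by (metis mult_zero_left)
  show thesis
  proof (cases "c = 0")
    case True
    then have d: "d \<noteq> 0" using h(1) by simp
    have "a \<noteq> 0"
    proof
      assume "a = 0"
      then have "a = b / d * c \<and> b = b / d * d" using True d by simp
      then show False using h(2) by blast
    qed
    then show thesis using that(1)[of a d] XY True d h(4) by simp
  next
    case False
    then have d: "d = 0" using h(5) by simp
    have "b \<noteq> 0"
    proof
      assume "b = 0"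
      then have "a = a / c * c \<and> b = a / c * d" using False d by simp
      then show False using h(2) by blast
    qed
    then show thesis using that(2)[of b c] XY False d h(4) q3 by simp
  qed
qed

lemma diamond_generators_standard: "diamond_generators lscale lbr C (gen 1 0) (gen 0 1)"
  unfolding diamond_generators_gen by (simp add: dY_first cY_first)

section \<open>The values of the types\<close>

lemma neg_mod_iff: "(- int t + 1) mod int (p ^ s) = 0 \<longleftrightarrow> [t = 1] (mod p ^ s)"
proof -
  have "(- int t + 1) mod int (p ^ s) = 0 \<longleftrightarrow> int (p ^ s) dvd 1 - int t"
    by (simp add: dvd_eq_mod_eq_0 del: of_nat_power)
  also have "\<dots> \<longleftrightarrow> [1 = int t] (mod int (p ^ s))"
    by (simp only: cong_iff_dvd_diff)
  also have "\<dots> \<longleftrightarrow> [t = 1] (mod p ^ s)"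
    by (metis cong_int_iff cong_sym_eq of_nat_1)
  finally show ?thesis .
qed

lemma infinite_coeffs:
  "\<not> [t = 1] (mod p ^ s) \<Longrightarrow> dY (- int t) = - 1 \<and> cY (- int t) = 1"
  using neg_mod_iff by (simp add: dY_def cY_def del: of_nat_power)

lemma finite_coeffs:
  "dY (- int (m * p ^ s + 1)) = - (\<sigma> * (\<pi> - of_nat m))"
  "cY (- int (m * p ^ s + 1)) = \<sigma> * (2 * \<pi> - of_nat m)"
proof -
  have eq: "- int (m * p ^ s + 1) + 1 = (- int m) * int (p ^ s)" by simp
  have "(- int (m * p ^ s + 1) + 1) mod int (p ^ s) = 0"
    unfolding eq by (rule mod_mult_self2_is_0)
  moreover have "(- int (m * p ^ s + 1) + 1) div int (p ^ s) = - int m"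
    unfolding eq using ps_pos by (intro nonzero_mult_div_cancel_right) (simp del: of_nat_power)
  ultimately show "dY (- int (m * p ^ s + 1)) = - (\<sigma> * (\<pi> - of_nat m))"
    "cY (- int (m * p ^ s + 1)) = \<sigma> * (2 * \<pi> - of_nat m)"
    unfolding dY_def cY_def by simp_all
qed

lemma cong_1_obtain:
  assumes "[t = 1] (mod p ^ s)" "t \<ge> 1"
  obtains m where "t = m * p ^ s + 1"
  using assms by (metis cong_le_nat mult.commute add.commute)

text \<open>In the difference of the two sides the products of \<open>\<mu>\<close> with
  \<open>of_nat m\<close> cancel, leaving \<open>\<sigma> * (m - \<pi> - \<mu> * \<pi>)\<close>;
  this makes the solution linear in \<open>m\<close>.\<close>

lemma type_ratio:
  "(1 - \<mu>) * - (\<sigma> * (\<pi> - of_nat m)) = \<mu> * (\<sigma> * (2 * \<pi> - of_nat m)) \<longleftrightarrow> \<mu> = - 1 + of_nat m * (1 / \<pi>)"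
proof -
  have "(1 - \<mu>) * - (\<sigma> * (\<pi> - of_nat m)) - \<mu> * (\<sigma> * (2 * \<pi> - of_nat m))
      = \<sigma> * (of_nat m - \<pi> - \<mu> * \<pi>)" by (simp add: algebra_simps)
  then have "(1 - \<mu>) * - (\<sigma> * (\<pi> - of_nat m)) = \<mu> * (\<sigma> * (2 * \<pi> - of_nat m))
    \<longleftrightarrow> of_nat m - \<pi> - \<mu> * \<pi> = 0"
    using sigma_nonzero by (metis eq_iff_diff_eq_0 mult_eq_0_iff)
  also have "\<dots> \<longleftrightarrow> \<mu> = - 1 + of_nat m * (1 / \<pi>)"
    using pi_nonzero by (auto simp: field_simps)
  finally show ?thesis .
qed

lemma finite_type_standard:
  assumes "a \<noteq> 0" "d \<noteq> 0" "t \<ge> 1"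
  shows "finite_type lscale lbr C (gen a 0) (gen 0 d) (t * (q - 1) + 1) \<mu>
    \<longleftrightarrow> (1 - \<mu>) * dY (- int t) = \<mu> * cY (- int t)"
  unfolding finite_type_iff[OF assms(3)] using assms
  by (simp add: mult.left_commute[of _ "a * d"] mult.commute[of d a] mult.assoc[symmetric])

text \<open>Written with \<open>1 - (1 - \<mu>)\<close> so that it is literally the standard
  condition at \<open>1 - \<mu>\<close>.\<close>

lemma finite_type_swapped:
  assumes "b \<noteq> 0" "c \<noteq> 0" "t \<ge> 1"
  shows "finite_type lscale lbr C (gen 0 b) (gen c 0) (t * (q - 1) + 1) \<mu>
    \<longleftrightarrow> (1 - (1 - \<mu>)) * dY (- int t) = (1 - \<mu>) * cY (- int t)"
proof -
  have "(1 - \<mu>) * (b * c * cY (- int t)) = (b * c) * ((1 - \<mu>) * cY (- int t))"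
    "\<mu> * (c * b * dY (- int t)) = (b * c) * (\<mu> * dY (- int t))" by (simp_all only: ac_simps)
  then show ?thesis
    unfolding finite_type_iff[OF assms(3)] using assms by auto
qed

lemma infinite_type_standard:
  assumes "a \<noteq> 0" "d \<noteq> 0" "t \<ge> 1"
  shows "infinite_type lscale lbr C (gen a 0) (gen 0 d) (t * (q - 1) + 1) \<longleftrightarrow> - dY (- int t) = cY (- int t)"
  unfolding infinite_type_iff[OF assms(3)] using assms
  by (simp add: mult.commute[of d a] flip: mult_minus_right)

lemma infinite_type_swapped:
  assumes "b \<noteq> 0" "c \<noteq> 0" "t \<ge> 1"
  shows "infinite_type lscale lbr C (gen 0 b) (gen c 0) (t * (q - 1) + 1) \<longleftrightarrow> - dY (- int t) = cY (- int t)"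
  unfolding infinite_type_iff[OF assms(3)] using assms
  by (simp add: mult.commute[of c b] minus_equation_iff[of _ "cY _"] flip: mult_minus_right)

lemma types_standard:
  assumes "a \<noteq> 0" "d \<noteq> 0"
  shows "finite_type lscale lbr C (gen a 0) (gen 0 d) ((m * p ^ s + 1) * (q - 1) + 1) \<mu>
    \<longleftrightarrow> \<mu> = - 1 + of_nat m * (1 / \<pi>)"
  using finite_type_standard[OF assms, of "m * p ^ s + 1" \<mu>] finite_coeffs[of m] type_ratio[of \<mu> m]
  by simp

lemma types_swapped:
  assumes "b \<noteq> 0" "c \<noteq> 0"
  shows "finite_type lscale lbr C (gen 0 b) (gen c 0) ((m * p ^ s + 1) * (q - 1) + 1) \<mu>
    \<longleftrightarrow> \<mu> = 2 + of_nat m * (- 1 / \<pi>)"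
proof -
  have "1 - \<mu> = - 1 + x \<longleftrightarrow> \<mu> = 2 + - x" for x
    by (auto simp: algebra_simps)
  then show ?thesis
    using finite_type_swapped[OF assms, of "m * p ^ s + 1" \<mu>] finite_coeffs[of m] type_ratio[of "1 - \<mu>" m]
    by simp
qed

lemma generator_types:
  assumes gens: "diamond_generators lscale lbr C X Y"
  shows "t \<ge> 1 \<Longrightarrow> (\<exists>\<mu>. finite_type lscale lbr C X Y (t * (q - 1) + 1) \<mu>) \<longleftrightarrow> [t = 1] (mod p ^ s)"
    and "t \<ge> 1 \<Longrightarrow> infinite_type lscale lbr C X Y (t * (q - 1) + 1) \<longleftrightarrow> \<not> [t = 1] (mod p ^ s)"
    and "\<exists>\<mu> \<delta>. (\<forall>m. finite_type lscale lbr C X Y ((m * p ^ s + 1) * (q - 1) + 1) (\<mu> + of_nat m * \<delta>))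
        \<and> \<not> range (\<lambda>m::nat. \<mu> + of_nat m * \<delta>) \<subseteq> range of_int"
    and "q \<noteq> 3 \<Longrightarrow> finite_type lscale lbr C X Y ((q - 1) * (p ^ s + 1) + 1) (- 1 + 1 / \<pi>)"
proof -
  \<comment> \<open>The member with \<open>m = 1\<close> already lies outside: a value
    \<open>y\<close> in the prime field would give \<open>(x - y) * \<pi> + k = 0\<close>.\<close>
  have not_prime_field: "\<not> range (\<lambda>m::nat. of_int x + of_nat m * (of_int k / \<pi>)) \<subseteq> range (of_int :: int \<Rightarrow> 'a)"
    if "k = 1 \<or> k = - 1" for x k
  proof
    assume "range (\<lambda>m::nat. of_int x + of_nat m * (of_int k / \<pi>)) \<subseteq> range (of_int :: int \<Rightarrow> 'a)"
    then obtain y where "of_int x + of_nat 1 * (of_int k / \<pi>) = (of_int y :: 'a)" by blast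
    then have "of_int (x - y) * \<pi> + of_int k = 0"
      using pi_nonzero by (simp add: field_simps)
    moreover have "(of_int k :: 'a) \<noteq> 0" using that by auto
    ultimately have "(of_int (x - y) :: 'a) \<noteq> 0" by auto
    then show False
      using of_int_pi_nonzero[of "x - y" k] \<open>of_int (x - y) * \<pi> + of_int k = 0\<close> by blast
  qed
  have inf: "\<not> (\<exists>\<mu>. (1 - \<mu>) * dY (- int t) = \<mu> * cY (- int t))" "- dY (- int t) = cY (- int t)"
    if "\<not> [t = 1] (mod p ^ s)" for t
    using infinite_coeffs[OF that] by simp_all
  \<comment> \<open>The two sides differ by \<open>\<sigma> * \<pi>\<close>, whatever
    \<open>m\<close> is, so a diamond of finite type is never also of infinite type.\<close>
  have fin: "- dY (- int t) \<noteq> cY (- int t)" if t: "[t = 1] (mod p ^ s)" "t \<ge> 1" for t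
  proof -
    obtain m where "t = m * p ^ s + 1" using cong_1_obtain[OF t] by blast
    moreover have "(2 :: 'a) \<noteq> 1" by (metis add_cancel_left_right one_add_one one_neq_zero)
    ultimately show ?thesis
      using sigma_nonzero pi_nonzero by (simp only: finite_coeffs) (simp add: algebra_simps)
  qed
  have last: "(q - 1) * (p ^ s + 1) + 1 = (1 * p ^ s + 1) * (q - 1) + 1" by simp
  show "t \<ge> 1 \<Longrightarrow> (\<exists>\<mu>. finite_type lscale lbr C X Y (t * (q - 1) + 1) \<mu>) \<longleftrightarrow> [t = 1] (mod p ^ s)"
  proof
    assume t: "t \<ge> 1" and "[t = 1] (mod p ^ s)"
    then obtain m where m: "t = m * p ^ s + 1" using cong_1_obtain by blast
    show "\<exists>\<mu>. finite_type lscale lbr C X Y (t * (q - 1) + 1) \<mu>"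
      using gens
    proof (cases rule: diamond_generators_cases)
      case (1 a d)
      then show ?thesis unfolding m 1(1,2) types_standard[OF 1(3,4)] by blast
    next
      case (2 b c)
      then show ?thesis unfolding m 2(1,2) types_swapped[OF 2(3,4)] by blast
    qed
  next
    assume t: "t \<ge> 1" and ex: "\<exists>\<mu>. finite_type lscale lbr C X Y (t * (q - 1) + 1) \<mu>"
    from gens show "[t = 1] (mod p ^ s)"
    proof (cases rule: diamond_generators_cases)
      case (1 a d)
      then show ?thesis
        using ex inf(1)[of t] unfolding 1(1,2) finite_type_standard[OF 1(3,4) t] by blast
    next
      case (2 b c)
      then show ?thesis
        using ex inf(1)[of t] unfolding 2(1,2) finite_type_swapped[OF 2(3,4) t] by blast
    qed
  qed
  show "infinite_type lscale lbr C X Y (t * (q - 1) + 1) \<longleftrightarrow> \<not> [t = 1] (mod p ^ s)" if t: "t \<ge> 1"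
    using gens
  proof (cases rule: diamond_generators_cases)
    case (1 a d)
    then show ?thesis
      using inf(2)[of t] fin[of t] t unfolding 1(1,2) infinite_type_standard[OF 1(3,4) t] by blast
  next
    case (2 b c)
    then show ?thesis
      using inf(2)[of t] fin[of t] t unfolding 2(1,2) infinite_type_swapped[OF 2(3,4) t] by blast
  qed
  show "\<exists>\<mu> \<delta>. (\<forall>m. finite_type lscale lbr C X Y ((m * p ^ s + 1) * (q - 1) + 1) (\<mu> + of_nat m * \<delta>))
        \<and> \<not> range (\<lambda>m::nat. \<mu> + of_nat m * \<delta>) \<subseteq> range of_int"
    using gens
  proof (cases rule: diamond_generators_cases)
    case (1 a d)
    show ?thesis
    proof (rule exI[of _ "- 1"], rule exI[of _ "1 / \<pi>"], intro conjI allI)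
      show "finite_type lscale lbr C X Y ((m * p ^ s + 1) * (q - 1) + 1) (- 1 + of_nat m * (1 / \<pi>))" for m
        unfolding 1(1,2) types_standard[OF 1(3,4)] ..
    qed (use not_prime_field[of 1 "- 1"] in simp)
  next
    case (2 b c)
    show ?thesis
    proof (rule exI[of _ 2], rule exI[of _ "- 1 / \<pi>"], intro conjI allI)
      show "finite_type lscale lbr C X Y ((m * p ^ s + 1) * (q - 1) + 1) (2 + of_nat m * (- 1 / \<pi>))" for m
        unfolding 2(1,2) types_swapped[OF 2(3,4)] ..
    qed (use not_prime_field[of "- 1" 2] in simp)
  qed
  show "finite_type lscale lbr C X Y ((q - 1) * (p ^ s + 1) + 1) (- 1 + 1 / \<pi>)" if "q \<noteq> 3"
    using gens
  proof (cases rule: diamond_generators_cases)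
    case (1 a d)
    show ?thesis unfolding last 1(1,2) types_standard[OF 1(3,4)] by simp
  qed (use that in simp)
qed

text \<open>For \<open>q = 3\<close> the interchanged generators give \<open>2 - 1 / \<pi>\<close>
  instead of \<open>- 1 + 1 / \<pi>\<close>. Hence that value is asserted for some pair always, and
  for every pair when \<open>q \<noteq> 3\<close>.\<close>

theorem thin_with_diamond_types:
  "graded_basis fun_scale H br N Ind e deg
    \<and> thin_lie_algebra lscale (loop_algebra fun_scale H br S) lbr C
    \<and> second_diamond lscale C = q
    \<and> (\<forall>i. is_diamond lscale C i \<longleftrightarrow> (\<exists>t. i = t * (q - 1) + 1))
    \<and> (\<exists>X Y. diamond_generators lscale lbr C X Y
         \<and> finite_type lscale lbr C X Y ((q - 1) * (p ^ s + 1) + 1) (- 1 + 1 / \<pi>))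
    \<and> (\<forall>X Y. diamond_generators lscale lbr C X Y \<longrightarrow>
         (\<forall>t\<ge>1.
            ((\<exists>\<mu>. finite_type lscale lbr C X Y (t * (q - 1) + 1) \<mu>) \<longleftrightarrow> [t = 1] (mod p ^ s))
          \<and> (infinite_type lscale lbr C X Y (t * (q - 1) + 1) \<longleftrightarrow> \<not> [t = 1] (mod p ^ s)))
         \<and> (\<exists>\<mu> \<delta>. (\<forall>m. finite_type lscale lbr C X Y ((m * p ^ s + 1) * (q - 1) + 1)
                       (\<mu> + of_nat m * \<delta>))
              \<and> \<not> range (\<lambda>m::nat. \<mu> + of_nat m * \<delta>) \<subseteq> range of_int)
         \<and> (q \<noteq> 3 \<longrightarrow>
              finite_type lscale lbr C X Y ((q - 1) * (p ^ s + 1) + 1) (- 1 + 1 / \<pi>)))"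
proof -
  have "finite_type lscale lbr C (gen 1 0) (gen 0 1) ((q - 1) * (p ^ s + 1) + 1) (- 1 + 1 / \<pi>)"
    using types_standard[of 1 1 1 "- 1 + 1 / \<pi>"] by (simp add: mult.commute)
  with diamond_generators_standard
  have ex: "\<exists>X Y. diamond_generators lscale lbr C X Y
      \<and> finite_type lscale lbr C X Y ((q - 1) * (p ^ s + 1) + 1) (- 1 + 1 / \<pi>)"
    by (intro exI conjI)
  show ?thesis
    by (intro conjI allI impI graded_basis thin_loop second_diamond_eq is_diamond_iff ex generator_types)
qed

end

theorem theorem5p1:
  fixes \<sigma> \<pi> :: "'a::field" and p n s q :: nat and N :: int
    and H :: "(nat \<times> nat \<Rightarrow> 'a) set"
    and br :: "(nat \<times> nat \<Rightarrow> 'a) \<Rightarrow> (nat \<times> nat \<Rightarrow> 'a) \<Rightarrow> nat \<times> nat \<Rightarrow> 'a"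
    and S :: "int \<Rightarrow> (nat \<times> nat \<Rightarrow> 'a) set"
    and L :: "(nat \<times> nat \<Rightarrow> 'a) poly set"
    and C :: "nat \<Rightarrow> (nat \<times> nat \<Rightarrow> 'a) poly set"
    and lscale :: "'a \<Rightarrow> (nat \<times> nat \<Rightarrow> 'a) poly \<Rightarrow> (nat \<times> nat \<Rightarrow> 'a) poly"
    and lbr :: "(nat \<times> nat \<Rightarrow> 'a) poly \<Rightarrow> (nat \<times> nat \<Rightarrow> 'a) poly \<Rightarrow> (nat \<times> nat \<Rightarrow> 'a) poly"
  assumes char: "CHAR('a) = p" "odd p"
    and pos: "n > 0" "s > 0"
    and q: "q = p ^ n"
    and param: "(\<pi> ^ p - \<pi>) * \<sigma> ^ p = 1"
    and N: "N = int ((q - 1) * p ^ (s + 1))"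
    and H: "H = dp_carrier p (s + 1) n"
    and br: "br = AZ_bracket p (s + 1) n"
    and S: "S = degree_component fun_scale N (AZ_index p s n) (AZ_elem p s n \<sigma> \<pi>) (AZ_degree p s n)"
    and L: "L = loop_algebra fun_scale H br S"
    and C: "C = power_component L"
    and lscale: "lscale = loop_scale fun_scale"
    and lbr: "lbr = loop_bracket br"
  shows "graded_basis fun_scale H br N (AZ_index p s n) (AZ_elem p s n \<sigma> \<pi>)
        (AZ_degree p s n)
    \<and> thin_lie_algebra lscale L lbr C
    \<and> second_diamond lscale C = q
    \<and> (\<forall>i. is_diamond lscale C i \<longleftrightarrow> (\<exists>t. i = t * (q - 1) + 1))
    \<and> (\<exists>X Y. diamond_generators lscale lbr C X Y
         \<and> finite_type lscale lbr C X Y ((q - 1) * (p ^ s + 1) + 1) (- 1 + 1 / \<pi>))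
    \<and> (\<forall>X Y. diamond_generators lscale lbr C X Y \<longrightarrow>
         (\<forall>t\<ge>1.
            ((\<exists>\<mu>. finite_type lscale lbr C X Y (t * (q - 1) + 1) \<mu>) \<longleftrightarrow> [t = 1] (mod p ^ s))
          \<and> (infinite_type lscale lbr C X Y (t * (q - 1) + 1) \<longleftrightarrow> \<not> [t = 1] (mod p ^ s)))
         \<and> (\<exists>\<mu> \<delta>. (\<forall>m. finite_type lscale lbr C X Y ((m * p ^ s + 1) * (q - 1) + 1)
                       (\<mu> + of_nat m * \<delta>))
              \<and> \<not> range (\<lambda>m::nat. \<mu> + of_nat m * \<delta>) \<subseteq> range of_int)
         \<and> (q \<noteq> 3 \<longrightarrow>
              finite_type lscale lbr C X Y ((q - 1) * (p ^ s + 1) + 1) (- 1 + 1 / \<pi>)))"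
proof -
  interpret albert_zassenhaus \<sigma> \<pi> p n s
    by unfold_locales (use char pos param in simp_all)
  show ?thesis
    unfolding C lscale lbr L S br H N q by (rule thin_with_diamond_types)
qed

end
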